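(* Let $X$ be a real algebraic set and let $X'$ be its normalization. Let $Y$ be a real algebraic set equipped with a finite birational map $\pi:Y\to X$. Then $\pi$ induces a bijection from $\mathrm{Cent}\,Y$ to $\mathrm{Cent}\,X$ if and only if the weak-normalization map relative to the central locus $\pi^{w_c}:X^{w_c}\to X$ factorizes through $\pi$ (i.e. $\pi^{w_c}=\pi\circ\psi$ for some polynomial map $\psi:X^{w_c}\to Y$).
   Context: A real algebraic set is the zero set $X\subset\mathbb R^n$ of a family of polynomials; $\mathcal P(X)=\mathbb R[x_1,\dots,x_n]/\mathcal I(X)$ is its ring of polynomial functions, and maps between real algebraic sets are polynomial maps unless specified. $\mathcal K(X)$ is the total ring of fractions of $\mathcal P(X)$ (the ring of rational functions on $X$). A rational function is regular on a Zariski-dense open $U\subset X$ if it equals $p/q$ on $U$ with $p,q$ polynomials and $q$ nowhere zero on $U$. A polynomial map $\pi:Y\to X$ is finite if it makes $\mathcal P(Y)$ a finite $\mathcal P(X)$-module, and birational if it induces an isomorphism from a Zariski-dense open subset of $Y$ onto one of $X$ (equivalently an isomorphism $\mathcal K(X)\simeq\mathcal K(Y)$). The normalization $X'$ is the real algebraic set whose ring of polynomial functions is the integral closure of $\mathcal P(X)$ in $\mathcal K(X)$; it comes with a finite birational map $\pi':X'\to X$. Central locus: if $X$ is irreducible, $\mathrm{Cent}\,X$ is the Euclidean closure in $X$ of the set of nonsingular points of $X$; if $X$ has irreducible components $X_1,\dots,X_t$, $\mathrm{Cent}\,X=\bigcup_i\mathrm{Cent}\,X_i$. $\mathcal K^0(\mathrm{Cent}\,X)$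 is the ring of continuous (Euclidean topology) functions $f:\mathrm{Cent}\,X\to\mathbb R$ for which there are a Zariski-dense open $U\subset X$ and a regular function $g$ on $U$ with $f=g$ on $U\cap\mathrm{Cent}\,X$; it injects canonically in $\mathcal K(X)$. The weak-normalization of $X$ relative to its central locus, $X^{w_c}$, is the real algebraic set whose ring of polynomial functions is the integral closure of $\mathcal P(X)$ in $\mathcal K^0(\mathrm{Cent}\,X)$ (a subring of $\mathcal P(X')$), and $\pi^{w_c}:X^{w_c}\to X$ is the finite birational map induced by the inclusion $\mathcal P(X)\subset\mathcal P(X^{w_c})$. *)

theory Defs
  imports "HOL-Analysis.Analysis" "HOL-Algebra.QuotRing"
    "HOL-Library.Extended_Nat"
begin

section \<open>Real algebraic sets and the Zariski topology\<close>

definition real_algebraic_set :: "(real^'n) set \<Rightarrow> bool" where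
  "real_algebraic_set X \<longleftrightarrow>
     (\<exists>P. (\<forall>p\<in>P. real_polynomial_function p) \<and> X = {x. \<forall>p\<in>P. p x = 0})"

definition zariski :: "(real^'n) topology" where
  "zariski = topology (\<lambda>U. real_algebraic_set (- U))"

lemma real_algebraic_set_Un:
  assumes "real_algebraic_set A" "real_algebraic_set B"
  shows "real_algebraic_set (A \<union> B)"
proof -
  obtain P where P: "\<forall>p\<in>P. real_polynomial_function p" "A = {x. \<forall>p\<in>P. p x = 0}"
    using assms(1) unfolding real_algebraic_set_def by (elim exE conjE)
  obtain Q where Q: "\<forall>q\<in>Q. real_polynomial_function q" "B = {x. \<forall>q\<in>Q. q x = 0}"
    using assms(2) unfolding real_algebraic_set_def by (elim exE conjE)
  define R where "R = (\<lambda>(p, q) x. p x * q x :: real) ` (P \<times> Q)"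
  have "\<forall>r\<in>R. real_polynomial_function r"
    using P(1) Q(1) by (auto simp: R_def intro: real_polynomial_function.intros)
  moreover have "A \<union> B = {x. \<forall>r\<in>R. r x = 0}"
    unfolding P(2) Q(2) R_def by auto
  ultimately show ?thesis
    unfolding real_algebraic_set_def by (intro exI[of _ R] conjI)
qed

lemma real_algebraic_set_Inter:
  assumes "\<And>A. A \<in> \<A> \<Longrightarrow> real_algebraic_set A"
  shows "real_algebraic_set (\<Inter>\<A>)"
proof -
  define R where "R = {p. real_polynomial_function p \<and> (\<forall>x\<in>\<Inter>\<A>. p x = 0)}"
  have "x \<in> A" if A: "A \<in> \<A>" and x: "\<forall>p\<in>R. p x = 0" for x A
  proof -
    obtain P where P: "\<forall>p\<in>P. real_polynomial_function p" "A = {x. \<forall>p\<in>P. p x = 0}"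
      using assms[OF A] unfolding real_algebraic_set_def by (elim exE conjE)
    have "P \<subseteq> R"
    proof
      fix p assume "p \<in> P"
      moreover have "\<forall>y\<in>\<Inter>\<A>. y \<in> A" using A by simp
      ultimately show "p \<in> R" using P by (simp add: R_def)
    qed
    then show ?thesis using x P(2) by auto
  qed
  then have "\<Inter>\<A> = {x. \<forall>p\<in>R. p x = 0}" by (auto simp: R_def)
  moreover have "\<forall>p\<in>R. real_polynomial_function p" by (simp add: R_def)
  ultimately show ?thesis
    unfolding real_algebraic_set_def by (intro exI[of _ R] conjI)
qed

lemma istopology_zariski: "istopology (\<lambda>U :: (real^'n) set. real_algebraic_set (- U))"
  unfolding istopology_def
proof (intro conjI allI impI)
  fix S T :: "(real^'n) set"
  assume "real_algebraic_set (- S)" "real_algebraic_set (- T)"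
  then show "real_algebraic_set (- (S \<inter> T))"
    using real_algebraic_set_Un by (simp add: Compl_Int)
next
  fix \<K> :: "(real^'n) set set"
  assume "\<forall>K\<in>\<K>. real_algebraic_set (- K)"
  then have "real_algebraic_set (\<Inter>(uminus ` \<K>))"
    by (intro real_algebraic_set_Inter) auto
  then show "real_algebraic_set (- \<Union>\<K>)" by (simp add: uminus_Sup)
qed

lemma openin_zariski: "openin zariski U \<longleftrightarrow> real_algebraic_set (- U)"
  unfolding zariski_def by (rule topology_inverse'[THEN fun_cong, OF istopology_zariski])

definition zariski_dense_open :: "(real^'n) set \<Rightarrow> (real^'n) set \<Rightarrow> bool" where
  "zariski_dense_open X U \<longleftrightarrow>
     openin (subtopology zariski X) U \<and> (subtopology zariski X) closure_of U = X"

definition irreducible_algebraic_set :: "(real^'n) set \<Rightarrow> bool" where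
  "irreducible_algebraic_set X \<longleftrightarrow> real_algebraic_set X \<and> X \<noteq> {} \<and>
     (\<forall>A B. real_algebraic_set A \<and> real_algebraic_set B \<and> X = A \<union> B \<longrightarrow> X = A \<or> X = B)"

definition irreducible_components :: "(real^'n) set \<Rightarrow> (real^'n) set set" where
  "irreducible_components X =
     {Z. irreducible_algebraic_set Z \<and> Z \<subseteq> X \<and>
         (\<forall>Z'. irreducible_algebraic_set Z' \<and> Z \<subseteq> Z' \<and> Z' \<subseteq> X \<longrightarrow> Z' = Z)}"

section \<open>Rings of functions\<close>

text \<open>Real functions on \<open>D\<close> are represented extensionally, so that equality in the ring is
  equality on \<open>D\<close>.\<close>

definition function_ring :: "'a set \<Rightarrow> ('a \<Rightarrow> real) set \<Rightarrow> ('a \<Rightarrow> real) ring" where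
  "function_ring D F =
     \<lparr>carrier = F,
      monoid.mult = (\<lambda>f g. \<lambda>x\<in>D. f x * g x),
      one = (\<lambda>x\<in>D. 1),
      zero = (\<lambda>x\<in>D. 0),
      add = (\<lambda>f g. \<lambda>x\<in>D. f x + g x)\<rparr>"

definition polys_on :: "(real^'n) set \<Rightarrow> (real^'n \<Rightarrow> real) set" where
  "polys_on D = {restrict p D |p. real_polynomial_function p}"

text \<open>The quotient of the polynomial ring by the vanishing ideal of \<open>X\<close>, realised as the ring of
  restrictions to \<open>X\<close> of polynomials.\<close>

definition poly_fun_ring :: "(real^'n) set \<Rightarrow> (real^'n \<Rightarrow> real) ring" where
  "poly_fun_ring X = function_ring X (polys_on X)"

definition regular_on :: "(real^'n) set \<Rightarrow> (real^'n \<Rightarrow> real) \<Rightarrow> bool" where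
  "regular_on U g \<longleftrightarrow>
     (\<exists>p q. real_polynomial_function p \<and> real_polynomial_function q \<and>
            (\<forall>x\<in>U. q x \<noteq> 0 \<and> g x = p x / q x))"

definition regular_elements :: "('a, 'b) ring_scheme \<Rightarrow> 'a set" where
  "regular_elements R =
     {s \<in> carrier R. \<forall>a\<in>carrier R. a \<otimes>\<^bsub>R\<^esub> s = \<zero>\<^bsub>R\<^esub> \<longrightarrow> a = \<zero>\<^bsub>R\<^esub>}"

definition fraction_rel :: "('a, 'b) ring_scheme \<Rightarrow> (('a \<times> 'a) \<times> ('a \<times> 'a)) set" where
  "fraction_rel R =
     {((a, s), (b, t)). a \<in> carrier R \<and> b \<in> carrier R \<and>
        s \<in> regular_elements R \<and> t \<in> regular_elements R \<and> a \<otimes>\<^bsub>R\<^esub> t = b \<otimes>\<^bsub>R\<^esub> s}"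

definition fraction :: "('a, 'b) ring_scheme \<Rightarrow> 'a \<Rightarrow> 'a \<Rightarrow> ('a \<times> 'a) set" where
  "fraction R a s = fraction_rel R `` {(a, s)}"

definition total_fraction_ring :: "('a, 'b) ring_scheme \<Rightarrow> ('a \<times> 'a) set ring" where
  "total_fraction_ring R =
     \<lparr>carrier = (carrier R \<times> regular_elements R) // fraction_rel R,
      monoid.mult = (\<lambda>A B. \<Union>(a, s)\<in>A. \<Union>(b, t)\<in>B. fraction R (a \<otimes>\<^bsub>R\<^esub> b) (s \<otimes>\<^bsub>R\<^esub> t)),
      one = fraction R \<one>\<^bsub>R\<^esub> \<one>\<^bsub>R\<^esub>,
      zero = fraction R \<zero>\<^bsub>R\<^esub> \<one>\<^bsub>R\<^esub>,
      add = (\<lambda>A B. \<Union>(a, s)\<in>A. \<Union>(b, t)\<in>B.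
               fraction R ((a \<otimes>\<^bsub>R\<^esub> t) \<oplus>\<^bsub>R\<^esub> (b \<otimes>\<^bsub>R\<^esub> s)) (s \<otimes>\<^bsub>R\<^esub> t))\<rparr>"

definition rational_ring :: "(real^'n) set \<Rightarrow> ((real^'n \<Rightarrow> real) \<times> (real^'n \<Rightarrow> real)) set ring" where
  "rational_ring X = total_fraction_ring (poly_fun_ring X)"

text \<open>The case \<open>n = 0\<close> matters only for the zero ring.\<close>

definition integral_closure :: "('a, 'b) ring_scheme \<Rightarrow> 'a set \<Rightarrow> 'a set" where
  "integral_closure S A =
     {x \<in> carrier S. \<exists>(n::nat) a. (\<forall>i<n. a i \<in> A) \<and>
        x [^]\<^bsub>S\<^esub> n \<oplus>\<^bsub>S\<^esub> (\<Oplus>\<^bsub>S\<^esub>i\<in>{..<n}. a i \<otimes>\<^bsub>S\<^esub> x [^]\<^bsub>S\<^esub> i) = \<zero>\<^bsub>S\<^esub>}"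

section \<open>Nonsingular points and the central locus\<close>

definition krull_dim :: "('a, 'b) ring_scheme \<Rightarrow> enat" where
  "krull_dim R =
     Sup {enat n |n. \<exists>I. (\<forall>i\<le>n. primeideal (I i) R) \<and> (\<forall>i<n. I i \<subset> I (Suc i))}"

definition zariski_tangent_space :: "(real^'n) set \<Rightarrow> real^'n \<Rightarrow> (real^'n) set" where
  "zariski_tangent_space X x =
     {v. \<forall>p. real_polynomial_function p \<and> (\<forall>y\<in>X. p y = 0) \<longrightarrow> frechet_derivative p (at x) v = 0}"

text \<open>The Jacobian criterion, meant for irreducible \<open>X\<close>: the rank at \<open>x\<close> of the Jacobian matrix
  of generators of the vanishing ideal of \<open>X\<close> is \<open>CARD('n)\<close> minus the dimension of \<open>X\<close>.\<close>

definition nonsingular_points :: "(real^'n) set \<Rightarrow> (real^'n) set" where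
  "nonsingular_points X =
     {x \<in> X. enat (dim (zariski_tangent_space X x)) = krull_dim (poly_fun_ring X)}"

definition Cent :: "(real^'n) set \<Rightarrow> (real^'n) set" where
  "Cent X = (\<Union>Z\<in>irreducible_components X. Z \<inter> closure (nonsingular_points Z))"

section \<open>Polynomial maps\<close>

definition polynomial_map :: "(real^'m) set \<Rightarrow> (real^'n) set \<Rightarrow> (real^'m \<Rightarrow> real^'n) \<Rightarrow> bool" where
  "polynomial_map Y X f \<longleftrightarrow>
     f \<in> Y \<rightarrow> X \<and> (\<exists>F. polynomial_function F \<and> (\<forall>y\<in>Y. f y = F y))"

text \<open>The polynomial functions on \<open>Y\<close> are generated by a finite set \<open>B\<close> as a module over those
  on \<open>X\<close>, which act through composition with \<open>\<pi>\<close>.\<close>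

definition finite_map :: "(real^'m) set \<Rightarrow> (real^'n) set \<Rightarrow> (real^'m \<Rightarrow> real^'n) \<Rightarrow> bool" where
  "finite_map Y X \<pi> \<longleftrightarrow>
     (\<exists>B. finite B \<and> B \<subseteq> polys_on Y \<and>
          (\<forall>f\<in>polys_on Y. \<exists>a. (\<forall>b\<in>B. a b \<in> polys_on X) \<and>
                              (\<forall>y\<in>Y. f y = (\<Sum>b\<in>B. a b (\<pi> y) * b y))))"

definition birational_map :: "(real^'m) set \<Rightarrow> (real^'n) set \<Rightarrow> (real^'m \<Rightarrow> real^'n) \<Rightarrow> bool" where
  "birational_map Y X \<pi> \<longleftrightarrow>
     (\<exists>V U. zariski_dense_open Y V \<and> zariski_dense_open X U \<and> bij_betw \<pi> V U \<and>
            (\<forall>i. regular_on U (\<lambda>x. inv_into V \<pi> x $ i)))"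

section \<open>Normalization and weak-normalization relative to the central locus\<close>

text \<open>These real algebraic sets are determined only up to isomorphism over \<open>X\<close>, so they are
  specified by predicates on a set together with its map to \<open>X\<close>; the equation on polynomials \<open>p\<close>
  says that the map is the one induced by the inclusion of rings.\<close>

definition is_normalization ::
    "(real^'n) set \<Rightarrow> (real^'k) set \<Rightarrow> (real^'k \<Rightarrow> real^'n) \<Rightarrow> bool" where
  "is_normalization X X' \<pi>' \<longleftrightarrow>
     real_algebraic_set X' \<and> polynomial_map X' X \<pi>' \<and>
     (\<exists>\<phi> \<in> ring_iso
             (rational_ring X \<lparr>carrier := integral_closure (rational_ring X)
                {fraction (poly_fun_ring X) a \<one>\<^bsub>poly_fun_ring X\<^esub> |a. a \<in> polys_on X}\<rparr>)
             (poly_fun_ring X').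
        \<forall>p. real_polynomial_function p \<longrightarrow>
            \<phi> (fraction (poly_fun_ring X) (restrict p X) \<one>\<^bsub>poly_fun_ring X\<^esub>) = restrict (p \<circ> \<pi>') X')"

definition K0_Cent :: "(real^'n) set \<Rightarrow> (real^'n \<Rightarrow> real) ring" where
  "K0_Cent X = function_ring (Cent X)
     {f \<in> extensional (Cent X). continuous_on (Cent X) f \<and>
        (\<exists>U g. zariski_dense_open X U \<and> regular_on U g \<and> (\<forall>x\<in>U \<inter> Cent X. f x = g x))}"

text \<open>The polynomial functions on \<open>X\<close> embed in \<open>K0_Cent X\<close> by restriction, because \<open>Cent X\<close> is
  Zariski dense in \<open>X\<close>.\<close>

definition is_weak_normalization_Cent ::
    "(real^'n) set \<Rightarrow> (real^'k) set \<Rightarrow> (real^'k \<Rightarrow> real^'n) \<Rightarrow> bool" where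
  "is_weak_normalization_Cent X W \<pi>w \<longleftrightarrow>
     real_algebraic_set W \<and> polynomial_map W X \<pi>w \<and>
     (\<exists>\<phi> \<in> ring_iso
             (K0_Cent X \<lparr>carrier := integral_closure (K0_Cent X) (polys_on (Cent X))\<rparr>)
             (poly_fun_ring W).
        \<forall>p. real_polynomial_function p \<longrightarrow>
            \<phi> (restrict p (Cent X)) = restrict (p \<circ> \<pi>w) W)"

end

theory Submission
  imports Defs "HOL-Library.Function_Algebras" "HOL-Computational_Algebra.Polynomial"
begin

text \<open>
  Both implications pass through continuous sections of \<open>\<pi>\<close> over the central locus.  Suppose
  that \<open>\<pi>\<close> maps \<open>Cent Y\<close> bijectively to \<open>Cent X\<close>, and let \<open>f\<close> be the inverse.  It is continuous,
  because a finite map pulls compact sets back to bounded sets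
  (\<open>continuous_inverse_of_finite_map\<close>); its coordinates are rational, because \<open>\<pi>\<close> is birational;
  and they are integral over \<open>\<P>(X)\<close>, because the coordinates of \<open>Y\<close> are.  Hence the coordinates of
  \<open>f\<close> are polynomial functions on \<open>W\<close> and define \<open>\<psi>\<close>: the equations that \<open>f\<close> satisfies on
  \<open>Cent X\<close> are equations in the ring \<open>\<P>(W)\<close>.  Conversely, the coordinates of \<open>\<psi>\<close> are continuous
  functions on \<open>Cent X\<close> and define a section \<open>f\<close> of \<open>\<pi>\<close> with values in \<open>Y\<close>.  It remains to see that
  \<open>\<pi>\<close> and \<open>f\<close> exchange the two central loci and are inverse to each other there.  Since both maps
  are continuous and central loci are closed, this only has to be checked over a dense open set on
  which \<open>\<pi>\<close> is an isomorphism (\<open>Cent_dense_off_zeros\<close>), and there one needs that an isomorphism of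
  dense open sets preserves centrality (\<open>central_image\<close>, \<open>central_section\<close>).

  For this, \<open>Cent_eq_central\<close> describes the central locus without components and without
  singularities: a point \<open>x\<close> of \<open>X\<close> is central if and only if for every ball \<open>B\<close> around \<open>x\<close> the
  Zariski closure of \<open>X \<inter> B\<close> contains a nonempty Zariski open subset of \<open>X\<close>.  The substance of this
  description is local: if \<open>Z\<close> is irreducible, the nonsingular points contain a nonempty Zariski
  open subset of \<open>Z\<close>, and every ball around a nonsingular point is Zariski dense in \<open>Z\<close>
  (\<open>nonsingular_points_open\<close>, \<open>ball_zariski_dense\<close>).

  A point is nonsingular if the tangent space has dimension equal to the Krull dimension of
  \<open>\<P>(Z)\<close>.  Let \<open>d\<close> be the smallest dimension of a tangent space of \<open>Z\<close>.  If a set \<open>S\<close> of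
  coordinates is algebraically independent on \<open>Z\<close>, then at a generic point the \<open>S\<close>-components of a
  tangent vector can be prescribed, because the corresponding derivations extend along a tower of
  simple algebraic extensions (\<open>generic_tangent_vectors\<close>); so \<open>S\<close> has at most \<open>d\<close> elements.  A chain
  of primes in \<open>\<P>(Z)\<close> produces an independent set as long as the chain
  (\<open>prime_chain_independent\<close>), so the Krull dimension is at most \<open>d\<close>.

  For the opposite inequality and for the density of balls, take a point where the tangent
  dimension is \<open>d\<close>.  All but \<open>d\<close> of the coordinates can be exchanged for polynomials vanishing on
  \<open>Z\<close> so that the result is a local chart of the ambient space.  Vector fields obtained from
  Cramer's rule are tangent to the level sets of the new functions and preserve the ideal of \<open>Z\<close>.
  Along their integral curves generators of this ideal therefore satisfy a linear system of
  differential equations with initial value \<open>0\<close>, and vanish.  So \<open>Z\<close> contains the \<open>d\<close>-dimensional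
  coordinate slice of the chart (\<open>chart_covers\<close>), and the remaining \<open>d\<close> coordinates are
  independent on every ball.  This gives the density by incomparability
  (\<open>ideal_eq_prime_if_independent\<close>), and repeated hyperplane sections give a chain of \<open>d + 1\<close>
  irreducible sets (\<open>irreducible_chain\<close>); hence \<open>krull_dim_eq_generic_dim\<close>.
\<close>

section \<open>Noetherian rings and modules\<close>

text \<open>Coefficient rings, such as the polynomials in some of the coordinates, occur as subsets of the ring
  of all functions on a space, so that they and their extensions share one type.\<close>

locale unital_subring =
  fixes A :: "'a::comm_ring_1 set"
  assumes one_closed: "1 \<in> A"
    and diff_closed: "a \<in> A \<Longrightarrow> b \<in> A \<Longrightarrow> a - b \<in> A"
    and mult_closed: "a \<in> A \<Longrightarrow> b \<in> A \<Longrightarrow> a * b \<in> A"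
begin

lemma zero_closed: "0 \<in> A"
  using diff_closed[OF one_closed one_closed] by simp

lemma minus_closed: "a \<in> A \<Longrightarrow> - a \<in> A"
  using diff_closed[OF zero_closed] by fastforce

lemma add_closed: "a \<in> A \<Longrightarrow> b \<in> A \<Longrightarrow> a + b \<in> A"
  using diff_closed[OF _ minus_closed] by fastforce

lemma power_closed: "a \<in> A \<Longrightarrow> a ^ n \<in> A"
  by (induction n) (auto intro: one_closed mult_closed)

lemma sum_closed: "(\<And>i. i \<in> I \<Longrightarrow> f i \<in> A) \<Longrightarrow> sum f I \<in> A"
  by (induction I rule: infinite_finite_induct) (auto intro: zero_closed add_closed)

end

inductive_set linear_hull :: "'a::comm_ring_1 set \<Rightarrow> 'a set \<Rightarrow> 'a set" for A S where
  zero: "0 \<in> linear_hull A S"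
| step: "a \<in> A \<Longrightarrow> s \<in> S \<Longrightarrow> x \<in> linear_hull A S \<Longrightarrow> a * s + x \<in> linear_hull A S"

text \<open>This form of the ascending chain condition is the one that is applied: to the powers of an
  element it yields a monic equation, to a sequence of polynomials vanishing on a decreasing sequence
  of sets it yields stationarity.\<close>

definition noetherian :: "'a::comm_ring_1 set \<Rightarrow> bool" where
  "noetherian A \<longleftrightarrow>
     (\<forall>s::nat \<Rightarrow> 'a. (\<forall>k. s k \<in> A) \<longrightarrow> (\<exists>k. s k \<in> linear_hull A (s ` {..<k})))"

lemma noetherianD:
  fixes s :: "nat \<Rightarrow> 'a::comm_ring_1"
  assumes "noetherian A" "\<And>k. s k \<in> A"
  shows "\<exists>k. s k \<in> linear_hull A (s ` {..<k})"
  using assms by (simp add: noetherian_def)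

lemma linear_hull_mono: "S \<subseteq> T \<Longrightarrow> linear_hull A S \<subseteq> linear_hull A T"
proof
  fix x assume "S \<subseteq> T" "x \<in> linear_hull A S"
  from this(2,1) show "x \<in> linear_hull A T"
    by induction (auto intro: linear_hull.intros)
qed

context unital_subring
begin

lemma linear_hull_add:
  "x \<in> linear_hull A S \<Longrightarrow> y \<in> linear_hull A S \<Longrightarrow> x + y \<in> linear_hull A S"
  by (induction rule: linear_hull.induct) (auto simp: add.assoc intro: linear_hull.intros)

lemma linear_hull_scale: "x \<in> linear_hull A S \<Longrightarrow> a \<in> A \<Longrightarrow> a * x \<in> linear_hull A S"
proof (induction rule: linear_hull.induct)
  case (step b s x)
  then have "(a * b) * s + a * x \<in> linear_hull A S"
    by (intro linear_hull.step mult_closed)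
  then show ?case by (simp add: algebra_simps)
qed (auto intro: linear_hull.zero)

lemma linear_hull_diff:
  "x \<in> linear_hull A S \<Longrightarrow> y \<in> linear_hull A S \<Longrightarrow> x - y \<in> linear_hull A S"
  using linear_hull_add[of x S "- 1 * y"] linear_hull_scale[of y S "- 1"]
    minus_closed[OF one_closed] by auto

lemma linear_hull_sum:
  "(\<And>i. i \<in> I \<Longrightarrow> f i \<in> linear_hull A S) \<Longrightarrow> sum f I \<in> linear_hull A S"
  by (induction I rule: infinite_finite_induct) (auto intro: linear_hull.zero linear_hull_add)

lemma linear_hull_base: "s \<in> S \<Longrightarrow> s \<in> linear_hull A S"
  using linear_hull.step[OF one_closed _ linear_hull.zero, of s S] by simp

lemma linear_hull_subset: "S \<subseteq> linear_hull A T \<Longrightarrow> linear_hull A S \<subseteq> linear_hull A T"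
proof
  fix x assume "S \<subseteq> linear_hull A T" "x \<in> linear_hull A S"
  from this(2,1) show "x \<in> linear_hull A T"
    by induction (auto intro: linear_hull.zero linear_hull_add linear_hull_scale)
qed

lemma linear_hull_closed: "S \<subseteq> A \<Longrightarrow> linear_hull A S \<subseteq> A"
proof
  fix x assume "S \<subseteq> A" "x \<in> linear_hull A S"
  from this(2,1) show "x \<in> A"
    by induction (auto intro: zero_closed add_closed mult_closed)
qed

lemma linear_hull_insertE:
  assumes "x \<in> linear_hull A (insert b B)"
  obtains a m where "a \<in> A" "m \<in> linear_hull A B" "x = a * b + m"
proof -
  from assms have "\<exists>a m. a \<in> A \<and> m \<in> linear_hull A B \<and> x = a * b + m"
  proof induction
    case zero
    then show ?case by (intro exI[of _ 0]) (auto intro: zero_closed linear_hull.zero)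
  next
    case (step c s x)
    then obtain a m where am: "a \<in> A" "m \<in> linear_hull A B" "x = a * b + m" by blast
    show ?case
    proof (cases "s = b")
      case True
      then have "c * s + x = (c + a) * b + m" using am by (simp add: algebra_simps)
      then show ?thesis using am step add_closed by blast
    next
      case False
      then have "c * s + x = a * b + (c * s + m)" using am by (simp add: algebra_simps)
      moreover have "c * s + m \<in> linear_hull A B"
        using False step am by (intro linear_hull.step) auto
      ultimately show ?thesis using am by blast
    qed
  qed
  then show ?thesis using that by blast
qed

lemma linear_hull_finite_sumE:
  assumes "x \<in> linear_hull A (f ` I)" "finite I"
  obtains c where "\<And>i. c i \<in> A" "x = (\<Sum>i\<in>I. c i * f i)"
proof -
  from assms(2,1) have "\<exists>c. (\<forall>i. c i \<in> A) \<and> x = (\<Sum>i\<in>I. c i * f i)"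
  proof (induction I arbitrary: x rule: finite_induct)
    case empty
    then have "x = 0" by (auto elim: linear_hull.cases)
    then show ?case by (intro exI[of _ "\<lambda>_. 0"]) (auto intro: zero_closed)
  next
    case (insert j I)
    then obtain a m where am: "a \<in> A" "m \<in> linear_hull A (f ` I)" "x = a * f j + m"
      by (auto elim!: linear_hull_insertE)
    from insert.IH[OF this(2)] obtain c where c: "\<forall>i. c i \<in> A" "m = (\<Sum>i\<in>I. c i * f i)"
      by blast
    have "(\<Sum>i\<in>I. (c(j := a)) i * f i) = (\<Sum>i\<in>I. c i * f i)"
      using insert by (intro sum.cong) auto
    then show ?case using insert am c by (intro exI[of _ "c(j := a)"]) auto
  qed
  then show ?thesis using that by blast
qed

text \<open>Otherwise a subsequence would violate the chain condition.\<close>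

lemma noetherian_stable:
  fixes s :: "nat \<Rightarrow> 'a"
  assumes N: "noetherian A" and s: "\<And>k. s k \<in> A"
  obtains K where "\<And>k. k \<ge> K \<Longrightarrow> s k \<in> linear_hull A (s ` {..<K})"
proof (rule ccontr)
  assume "\<not> thesis"
  then have "\<forall>K. \<exists>k. k \<ge> K \<and> s k \<notin> linear_hull A (s ` {..<K})" using that by blast
  from choice[OF this]
  obtain f where f: "\<And>K. f K \<ge> K" "\<And>K. s (f K) \<notin> linear_hull A (s ` {..<K})" by blast
  define g where "g = rec_nat (f 0) (\<lambda>_ k. f (Suc k))"
  have g: "g 0 = f 0" "\<And>n. g (Suc n) = f (Suc (g n))" by (simp_all add: g_def)
  have "strict_mono g" unfolding strict_mono_Suc_iff using f(1) g by (metis Suc_le_eq)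
  from noetherianD[OF N, of "\<lambda>k. s (g k)", OF s]
  obtain k where k: "s (g k) \<in> linear_hull A ((\<lambda>k. s (g k)) ` {..<k})" ..
  show False
  proof (cases k)
    case 0
    then show ?thesis using k f(2)[of 0] g by auto
  next
    case (Suc n)
    have "(\<lambda>k. s (g k)) ` {..<k} \<subseteq> s ` {..<Suc (g n)}"
      using \<open>strict_mono g\<close> Suc
      by (auto simp: strict_mono_less_eq less_Suc_eq_le intro!: imageI)
    from subsetD[OF linear_hull_mono[OF this] k]
    show ?thesis using f(2)[of "Suc (g n)"] g Suc by simp
  qed
qed

text \<open>Finitely generated modules are Noetherian, by induction on the generators: once the coefficients
  of one generator have stabilised, that generator can be eliminated from the later terms.\<close>

lemma noetherian_module:
  fixes s :: "nat \<Rightarrow> 'a"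
  assumes N: "noetherian A" and "finite B" and "\<And>k. s k \<in> linear_hull A B"
  shows "\<exists>k. s k \<in> linear_hull A (s ` {..<k})"
  using assms(2,3)
proof (induction B arbitrary: s rule: finite_induct)
  case empty
  have "s 0 = 0" using empty[of 0] by (auto elim: linear_hull.cases)
  then show ?case by (metis linear_hull.zero)
next
  case (insert b B)
  have "\<forall>k. \<exists>a m. a \<in> A \<and> m \<in> linear_hull A B \<and> s k = a * b + m"
    using insert.prems by (meson linear_hull_insertE)
  then obtain a m where am: "\<And>k. a k \<in> A" "\<And>k. m k \<in> linear_hull A B"
    "\<And>k. s k = a k * b + m k" by metis
  obtain K where K: "\<And>k. k \<ge> K \<Longrightarrow> a k \<in> linear_hull A (a ` {..<K})"
    using noetherian_stable[OF N, of a] am(1) by blast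
  have "\<forall>k. \<exists>c. (\<forall>i. c i \<in> A) \<and> (k \<ge> K \<longrightarrow> a k = (\<Sum>i<K. c i * a i))"
  proof
    fix k
    show "\<exists>c. (\<forall>i. c i \<in> A) \<and> (k \<ge> K \<longrightarrow> a k = (\<Sum>i<K. c i * a i))"
    proof (cases "k \<ge> K")
      case True
      obtain c where "\<And>i. c i \<in> A" "a k = (\<Sum>i<K. c i * a i)"
        using linear_hull_finite_sumE[OF K[OF True]] by blast
      then show ?thesis by blast
    qed (auto intro!: exI[of _ "\<lambda>_. 0"] zero_closed)
  qed
  then obtain c where c: "\<And>k i. c k i \<in> A" "\<And>k. k \<ge> K \<Longrightarrow> a k = (\<Sum>i<K. c k i * a i)"
    by metis
  define t where "t k = s (K + k) - (\<Sum>i<K. c (K + k) i * s i)" for k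
  have "t k = m (K + k) - (\<Sum>i<K. c (K + k) i * m i)" for k
    using c(2)[of "K + k"] unfolding t_def am(3)
    by (simp add: algebra_simps sum.distrib sum_distrib_left)
  then have "t k \<in> linear_hull A B" for k
    using am(2) c(1) by (auto intro!: linear_hull_diff linear_hull_sum linear_hull_scale)
  from insert.IH[of t, OF this] obtain k where k: "t k \<in> linear_hull A (t ` {..<k})" by blast
  let ?H = "linear_hull A (s ` {..<K + k})"
  have early: "(\<Sum>i<K. c (K + j) i * s i) \<in> ?H" for j
    using c(1) by (intro linear_hull_sum linear_hull_scale linear_hull_base) auto
  have "t ` {..<k} \<subseteq> ?H"
    unfolding t_def by (intro image_subsetI linear_hull_diff early linear_hull_base) auto
  then have "t k \<in> ?H" using k linear_hull_subset by blast
  then have "t k + (\<Sum>i<K. c (K + k) i * s i) \<in> ?H" using early by (rule linear_hull_add)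
  then show ?case unfolding t_def by auto
qed

lemma noetherian_finite_generators:
  assumes N: "noetherian A" and J: "J \<subseteq> A"
  obtains G where "finite G" "G \<subseteq> J" "J \<subseteq> linear_hull A G"
proof (rule ccontr)
  assume *: "\<not> thesis"
  have "\<forall>G. \<exists>x. finite G \<and> G \<subseteq> J \<longrightarrow> x \<in> J \<and> x \<notin> linear_hull A G" using * that by blast
  from choice[OF this]
  obtain f where f: "\<And>G. finite G \<Longrightarrow> G \<subseteq> J \<Longrightarrow> f G \<in> J \<and> f G \<notin> linear_hull A G"
    by blast
  define G where "G = rec_nat {} (\<lambda>_ G. insert (f G) G)"
  have G: "G 0 = {}" "\<And>n. G (Suc n) = insert (f (G n)) (G n)" by (simp_all add: G_def)
  have GJ: "finite (G n) \<and> G n \<subseteq> J" for n by (induction n) (use G f in auto)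
  have img: "G n = (\<lambda>k. f (G k)) ` {..<n}" for n
    by (induction n) (auto simp: G lessThan_Suc)
  have "f (G k) \<in> A" for k using J GJ f by blast
  from noetherianD[OF N, of "\<lambda>k. f (G k)", OF this]
  obtain k where "f (G k) \<in> linear_hull A ((\<lambda>k. f (G k)) ` {..<k})" ..
  then have "f (G k) \<in> linear_hull A (G k)" unfolding img[of k, symmetric] .
  then show False using f[of "G k"] GJ[of k] by simp
qed

end

section \<open>Polynomials with coefficients in a subring\<close>

definition polys_over :: "'a::comm_ring_1 set \<Rightarrow> 'a poly set" where
  "polys_over A = {F. \<forall>k. coeff F k \<in> A}"

definition adjoin :: "'a::comm_ring_1 set \<Rightarrow> 'a \<Rightarrow> 'a set" where
  "adjoin A y = (\<lambda>F. poly F y) ` polys_over A"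

lemma polys_overD: "F \<in> polys_over A \<Longrightarrow> coeff F k \<in> A"
  by (simp add: polys_over_def)

context unital_subring
begin

lemma unital_subring_polys_over: "unital_subring (polys_over A)"
  by standard
    (auto simp: polys_over_def coeff_1 coeff_mult
      intro!: one_closed zero_closed diff_closed mult_closed sum_closed)

lemma monom_polys_over: "a \<in> A \<Longrightarrow> monom a n \<in> polys_over A"
  by (auto simp: polys_over_def coeff_monom intro: zero_closed)

lemma smult_polys_over: "a \<in> A \<Longrightarrow> F \<in> polys_over A \<Longrightarrow> smult a F \<in> polys_over A"
  by (auto simp: polys_over_def intro: mult_closed)

lemma unital_subring_adjoin: "unital_subring (adjoin A y)"
proof -
  interpret PA: unital_subring "polys_over A" by (rule unital_subring_polys_over)
  show ?thesis
  proof
    show "1 \<in> adjoin A y" unfolding adjoin_def by (rule image_eqI[of _ _ 1]) (auto intro: PA.one_closed)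
  next
    fix a b assume "a \<in> adjoin A y" "b \<in> adjoin A y"
    then obtain F G where "F \<in> polys_over A" "G \<in> polys_over A" "a = poly F y" "b = poly G y"
      unfolding adjoin_def by blast
    then show "a - b \<in> adjoin A y" "a * b \<in> adjoin A y"
      unfolding adjoin_def using PA.diff_closed[of F G] PA.mult_closed[of F G]
      by (metis imageI poly_diff, metis imageI poly_mult)
  qed
qed

lemma adjoin_base: "A \<subseteq> adjoin A y"
proof
  fix a assume "a \<in> A"
  then show "a \<in> adjoin A y"
    unfolding adjoin_def by (auto intro!: image_eqI[of _ _ "monom a 0"] monom_polys_over
        simp: poly_monom)
qed

lemma adjoin_generator: "y \<in> adjoin A y"
  unfolding adjoin_def
  by (rule image_eqI[of _ _ "monom 1 1"]) (auto intro!: monom_polys_over one_closed simp: poly_monom)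

lemma poly_closed:
  assumes "unital_subring R" "A \<subseteq> R" "y \<in> R" "F \<in> polys_over A"
  shows "poly F y \<in> R"
proof -
  interpret R: unital_subring R by fact
  show ?thesis
    unfolding poly_altdef using assms
    by (auto intro!: R.sum_closed R.mult_closed R.power_closed dest: polys_overD)
qed

text \<open>Hilbert's basis theorem.\<close>

lemma noetherian_polys_over:
  assumes N: "noetherian A"
  shows "noetherian (polys_over A)"
  unfolding noetherian_def
proof (intro allI impI, rule ccontr)
  interpret PA: unital_subring "polys_over A" by (rule unital_subring_polys_over)
  let ?H = "linear_hull (polys_over A)"
  fix F :: "nat \<Rightarrow> 'a poly"
  assume F: "\<forall>k. F k \<in> polys_over A" and no: "\<nexists>k. F k \<in> ?H (F ` {..<k})"
  \<comment> \<open>If no \<open>F k\<close> lies in the ideal of its predecessors, then the ideal \<open>J\<close> of all of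
    them is not finitely generated.\<close>
  define J where "J = ?H (range F)"
  have J_sub: "J \<subseteq> polys_over A" unfolding J_def using F by (intro PA.linear_hull_closed) auto
  have J_fin: "\<exists>k. x \<in> ?H (F ` {..<k})" if "x \<in> J" for x
    using that unfolding J_def
  proof induction
    case zero
    then show ?case by (auto intro: linear_hull.zero)
  next
    case (step a s x)
    then obtain i k where ik: "s = F i" "x \<in> ?H (F ` {..<k})" by auto
    have "x \<in> ?H (F ` {..<max k (Suc i)})"
      by (rule subsetD[OF linear_hull_mono ik(2)]) auto
    then have "a * s + x \<in> ?H (F ` {..<max k (Suc i)})"
      using ik step by (intro linear_hull.step) auto
    then show ?case by blast
  qed
  have proper: "\<exists>x\<in>J. x \<notin> ?H G" if G: "finite G" "G \<subseteq> J" for G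
  proof -
    have "\<exists>k. \<forall>g\<in>G. g \<in> ?H (F ` {..<k})"
      using G
    proof (induction G rule: finite_induct)
      case (insert g G)
      then obtain k where k: "\<forall>g\<in>G. g \<in> ?H (F ` {..<k})" by auto
      obtain l where l: "g \<in> ?H (F ` {..<l})" using J_fin[of g] insert.prems by blast
      have "?H (F ` {..<k}) \<subseteq> ?H (F ` {..<max k l})" "?H (F ` {..<l}) \<subseteq> ?H (F ` {..<max k l})"
        by (intro linear_hull_mono; force)+
      then show ?case using k l by blast
    qed auto
    then obtain k where "G \<subseteq> ?H (F ` {..<k})" by blast
    then have "?H G \<subseteq> ?H (F ` {..<k})" by (rule PA.linear_hull_subset)
    moreover have "F k \<in> J" unfolding J_def by (intro PA.linear_hull_base) auto
    ultimately show ?thesis using no by blast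
  qed
  have "\<forall>G. \<exists>x. finite G \<and> G \<subseteq> J \<longrightarrow> x \<in> J \<and> x \<notin> ?H G \<and>
              (\<forall>z. z \<in> J \<longrightarrow> z \<notin> ?H G \<longrightarrow> degree x \<le> degree z)"
  proof
    fix G
    show "\<exists>x. finite G \<and> G \<subseteq> J \<longrightarrow> x \<in> J \<and> x \<notin> ?H G \<and>
              (\<forall>z. z \<in> J \<longrightarrow> z \<notin> ?H G \<longrightarrow> degree x \<le> degree z)"
    proof (cases "finite G \<and> G \<subseteq> J")
      case True
      then obtain x where "x \<in> J \<and> x \<notin> ?H G" using proper by blast
      from ex_has_least_nat[of "\<lambda>x. x \<in> J \<and> x \<notin> ?H G", OF this, of degree]
      obtain y where "(y \<in> J \<and> y \<notin> ?H G) \<and>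
          (\<forall>z. z \<in> J \<and> z \<notin> ?H G \<longrightarrow> degree y \<le> degree z)" ..
      then show ?thesis by (intro exI[of _ y]) simp
    next
      case False
      then show ?thesis by (intro exI[of _ 0] impI) simp
    qed
  qed
  from choice[OF this]
  obtain f where f: "\<forall>G. finite G \<and> G \<subseteq> J \<longrightarrow> f G \<in> J \<and> f G \<notin> ?H G \<and>
              (\<forall>z. z \<in> J \<longrightarrow> z \<notin> ?H G \<longrightarrow> degree (f G) \<le> degree z)" ..
  define G where "G = rec_nat {} (\<lambda>_ G. insert (f G) G)"
  \<comment> \<open>Each \<open>g n\<close> has least degree among the elements of \<open>J\<close> outside the ideal of \<open>g 0\<close>, ...,
    \<open>g (n - 1)\<close>.\<close>
  define g where "g n = f (G n)" for n
  have G: "G 0 = {}" "\<And>n. G (Suc n) = insert (g n) (G n)" by (simp_all add: G_def g_def)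
  have GJ: "finite (G n) \<and> G n \<subseteq> J" for n
    by (induction n) (use f in \<open>auto simp: G g_def\<close>)
  have img: "G n = g ` {..<n}" for n
    by (induction n) (auto simp: G lessThan_Suc)
  have g: "g n \<in> J" "g n \<notin> ?H (g ` {..<n})"
    "\<And>z. z \<in> J \<Longrightarrow> z \<notin> ?H (g ` {..<n}) \<Longrightarrow> degree (g n) \<le> degree z" for n
    using f[rule_format, of "G n"] GJ[of n] unfolding img[of n, symmetric] g_def by auto
  have deg_mono: "degree (g i) \<le> degree (g n)" if "i \<le> n" for i n
  proof (rule g(3)[OF g(1)])
    have "g ` {..<i} \<subseteq> g ` {..<n}" using that by auto
    then show "g n \<notin> ?H (g ` {..<i})" using g(2)[of n] linear_hull_mono by blast
  qed
  have gA: "g n \<in> polys_over A" for n using g(1) J_sub by blast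
  have "lead_coeff (g k) \<in> A" for k using gA by (rule polys_overD)
  from noetherianD[OF N, of "\<lambda>k. lead_coeff (g k)", OF this]
  obtain k where "lead_coeff (g k) \<in> linear_hull A ((\<lambda>k. lead_coeff (g k)) ` {..<k})" ..
  then obtain c where c: "\<And>i. c i \<in> A" "lead_coeff (g k) = (\<Sum>i<k. c i * lead_coeff (g i))"
    by (auto elim!: linear_hull_finite_sumE)
  \<comment> \<open>\<open>g k - r\<close> has lower degree than \<open>g k\<close>, against the choice of \<open>g k\<close>.\<close>
  define r where "r = (\<Sum>i<k. monom (c i) (degree (g k) - degree (g i)) * g i)"
  have r_hull: "r \<in> ?H (g ` {..<k})"
    unfolding r_def using c(1)
    by (intro PA.linear_hull_sum PA.linear_hull_scale PA.linear_hull_base monom_polys_over) auto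
  have deg_r: "degree r \<le> degree (g k)"
    unfolding r_def
  proof (intro degree_sum_le, goal_cases)
    case (2 i)
    have "degree (monom (c i) (degree (g k) - degree (g i)) * g i) \<le>
        (degree (g k) - degree (g i)) + degree (g i)"
      by (rule order.trans[OF degree_mult_le]) (simp add: degree_monom_le)
    then show ?case using deg_mono[of i k] 2 by auto
  qed auto
  have "coeff r (degree (g k)) = (\<Sum>i<k. c i * lead_coeff (g i))"
    unfolding r_def coeff_sum
  proof (intro sum.cong refl, goal_cases)
    case (1 i)
    then have "degree (g i) \<le> degree (g k)" using deg_mono by auto
    then show ?case by (simp add: coeff_monom_mult)
  qed
  then have top: "coeff (g k - r) (degree (g k)) = 0" using c(2) by simp
  have notin: "g k - r \<notin> ?H (g ` {..<k})"
    using g(2)[of k] r_hull PA.linear_hull_add[of "g k - r" _ r] by auto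
  have "r \<in> J"
    using r_hull PA.linear_hull_subset[of "g ` {..<k}" "range F"] g(1) unfolding J_def by blast
  then have "g k - r \<in> J" using g(1) PA.linear_hull_diff unfolding J_def by blast
  then have "degree (g k) \<le> degree (g k - r)" using g(3) notin by blast
  moreover have "degree (g k - r) \<le> degree (g k)" using deg_r by (simp add: degree_diff_le)
  ultimately have "lead_coeff (g k - r) = 0" using top by simp
  then have "g k - r = 0" unfolding leading_coeff_0_iff .
  then show False using notin linear_hull.zero by metis
qed

lemma noetherian_adjoin:
  assumes "noetherian A"
  shows "noetherian (adjoin A y)"
  unfolding noetherian_def
proof (intro allI impI)
  interpret PA: unital_subring "polys_over A" by (rule unital_subring_polys_over)
  fix s :: "nat \<Rightarrow> 'a" assume "\<forall>k. s k \<in> adjoin A y"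
  then have "\<forall>k. \<exists>F. F \<in> polys_over A \<and> s k = poly F y" unfolding adjoin_def by blast
  then obtain F where F: "\<And>k. F k \<in> polys_over A" "\<And>k. s k = poly (F k) y" by metis
  from noetherianD[OF noetherian_polys_over[OF assms], of F, OF F(1)]
  obtain k where "F k \<in> linear_hull (polys_over A) (F ` {..<k})" ..
  then have "poly (F k) y \<in> linear_hull (adjoin A y) (s ` {..<k})"
  proof induction
    case (step a f x)
    then show ?case
      by (auto simp: F(2) adjoin_def intro!: linear_hull.step)
  qed (auto intro: linear_hull.zero)
  then show "\<exists>k. s k \<in> linear_hull (adjoin A y) (s ` {..<k})" using F by auto
qed

text \<open>Division with remainder after multiplication by a power of the leading coefficient of the divisor.
  The bound on the degree of the quotient is stated because leading coefficients may be zero divisors.\<close>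

lemma pseudo_division:
  assumes F: "F \<in> polys_over A" and deg: "degree F \<ge> 1" and G: "G \<in> polys_over A"
  obtains q r n where "q \<in> polys_over A" "r \<in> polys_over A"
    "smult (lead_coeff F ^ n) G = q * F + r" "degree r < degree F"
    "degree q \<le> degree G - degree F"
proof -
  interpret PA: unital_subring "polys_over A" by (rule unital_subring_polys_over)
  have "\<exists>q r n. q \<in> polys_over A \<and> r \<in> polys_over A \<and>
    smult (lead_coeff F ^ n) G = q * F + r \<and> degree r < degree F \<and>
    degree q \<le> degree G - degree F"
    using G
  proof (induction "degree G" arbitrary: G rule: less_induct)
    case less
    show ?case
    proof (cases "degree G < degree F")
      case True
      then show ?thesis using less.prems
        by (intro exI[of _ 0] exI[of _ G]) (auto intro: PA.zero_closed)
    next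
      case False
      define t where "t = monom (lead_coeff G) (degree G - degree F)"
      define H where "H = smult (lead_coeff F) G - t * F"
      have t: "t \<in> polys_over A" "degree t \<le> degree G - degree F"
        unfolding t_def using less.prems
        by (auto intro: monom_polys_over polys_overD simp: degree_monom_le)
      have H: "H \<in> polys_over A"
        unfolding H_def using less.prems F t
        by (intro PA.diff_closed PA.mult_closed smult_polys_over) (auto dest: polys_overD)
      have "degree H < degree G"
      proof -
        have "degree (t * F) \<le> degree G"
          using degree_mult_le[of t F] t(2) False by linarith
        moreover have "degree (smult (lead_coeff F) G) \<le> degree G" by (rule degree_smult_le)
        ultimately have "degree H \<le> degree G" unfolding H_def by (simp add: degree_diff_le)
        moreover have "coeff H (degree G) = 0"
          unfolding H_def t_def using False by (simp add: coeff_monom_mult)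
        ultimately show ?thesis
          using False deg by (metis coeff_0 degree_0 dual_order.strict_trans1 leading_coeff_0_iff
              le_neq_implies_less less_one linorder_not_le)
      qed
      then obtain q r n where q: "q \<in> polys_over A" "r \<in> polys_over A"
        "smult (lead_coeff F ^ n) H = q * F + r" "degree r < degree F"
        "degree q \<le> degree H - degree F"
        using less.hyps[OF _ H] by blast
      define c where "c = lead_coeff F ^ n"
      have "smult (lead_coeff F ^ Suc n) G = smult c H + smult c t * F"
        unfolding H_def c_def by (simp add: smult_diff_right mult.commute)
      also have "\<dots> = (q + smult c t) * F + r"
        using q(3) by (simp add: algebra_simps c_def)
      finally have eq: "smult (lead_coeff F ^ Suc n) G = (q + smult c t) * F + r" .
      have "degree (q + smult c t) \<le> degree G - degree F"
        using q(5) t(2) \<open>degree H < degree G\<close> degree_smult_le[of c t]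
        by (intro degree_add_le) linarith+
      moreover have "q + smult c t \<in> polys_over A"
        unfolding c_def using q t F
        by (intro PA.add_closed smult_polys_over power_closed) (auto dest: polys_overD)
      ultimately show ?thesis using eq q by blast
    qed
  qed
  then show ?thesis using that by blast
qed

end

section \<open>Algebraic elements modulo a prime ideal\<close>

locale ideal_of_subring = R: unital_subring R for R :: "'a::comm_ring_1 set" +
  fixes P :: "'a set"
  assumes P_sub: "P \<subseteq> R" and P_zero: "0 \<in> P"
    and P_add: "a \<in> P \<Longrightarrow> b \<in> P \<Longrightarrow> a + b \<in> P"
    and P_mult: "a \<in> R \<Longrightarrow> b \<in> P \<Longrightarrow> a * b \<in> P"
begin

lemma P_mult': "a \<in> P \<Longrightarrow> b \<in> R \<Longrightarrow> a * b \<in> P"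
  using P_mult[of b a] by (simp add: mult.commute)

lemma P_minus: "a \<in> P \<Longrightarrow> - a \<in> P"
  using P_mult[of "-1" a] R.minus_closed[OF R.one_closed] by auto

lemma P_diff: "a \<in> P \<Longrightarrow> b \<in> P \<Longrightarrow> a - b \<in> P"
  using P_add[of a "- b"] P_minus by auto

lemma P_sum: "(\<And>i. i \<in> I \<Longrightarrow> f i \<in> P) \<Longrightarrow> sum f I \<in> P"
  by (induction I rule: infinite_finite_induct) (auto intro: P_zero P_add)

end

locale prime_of_subring = ideal_of_subring +
  assumes P_prime: "a \<in> R \<Longrightarrow> b \<in> R \<Longrightarrow> a * b \<in> P \<Longrightarrow> a \<in> P \<or> b \<in> P"
    and P_proper: "1 \<notin> P"
begin

lemma P_power: "a \<in> R \<Longrightarrow> a \<notin> P \<Longrightarrow> a ^ n \<notin> P"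
proof (induction n)
  case (Suc n)
  then show ?case using P_prime[of a "a ^ n"] R.power_closed by auto
qed (simp add: P_proper)

end

text \<open>The leading coefficient is required to survive modulo \<open>P\<close>, so that \<open>F\<close> keeps its degree
  there and the class of \<open>y\<close> really is algebraic over the fraction field of \<open>A\<close> modulo
  \<open>P\<close>.\<close>

definition algebraic_relation :: "'a::comm_ring_1 set \<Rightarrow> 'a set \<Rightarrow> 'a \<Rightarrow> 'a poly \<Rightarrow> bool" where
  "algebraic_relation A P y F \<longleftrightarrow>
     F \<in> polys_over A \<and> degree F \<ge> 1 \<and> lead_coeff F \<notin> P \<and> poly F y \<in> P"

definition minimal_relation :: "'a::comm_ring_1 set \<Rightarrow> 'a set \<Rightarrow> 'a \<Rightarrow> 'a poly \<Rightarrow> bool" where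
  "minimal_relation A P y F \<longleftrightarrow> algebraic_relation A P y F \<and>
     (\<forall>G. algebraic_relation A P y G \<longrightarrow> degree F \<le> degree G)"

text \<open>The formal derivative, over coefficient rings that may have zero divisors.\<close>

definition formal_deriv :: "'a::comm_ring_1 poly \<Rightarrow> 'a poly" where
  "formal_deriv F = (\<Sum>k\<le>degree F. monom (of_nat k * coeff F k) (k - 1))"

lemma poly_formal_deriv:
  "poly (formal_deriv F) y = (\<Sum>k\<le>degree F. of_nat k * coeff F k * y ^ (k - 1))"
  by (simp add: formal_deriv_def poly_sum poly_monom)

lemma minimal_relation_exists:
  "algebraic_relation A P y G \<Longrightarrow> \<exists>F. minimal_relation A P y F"
  using ex_has_least_nat[of "algebraic_relation A P y" G degree]
  unfolding minimal_relation_def by blast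

lemma (in ideal_of_subring) drop_leading_term:
  assumes A: "unital_subring A" and y: "y \<in> R" and G: "G \<in> polys_over A"
    and lc: "lead_coeff G \<in> P" and deg: "degree G \<ge> 1"
  obtains G' where "G' \<in> polys_over A" "degree G' < degree G" "poly G y - poly G' y \<in> P"
    "\<And>k. coeff G k - coeff G' k \<in> P"
proof -
  interpret A: unital_subring A by fact
  interpret PA: unital_subring "polys_over A" by (rule A.unital_subring_polys_over)
  define t where "t = monom (lead_coeff G) (degree G)"
  define G' where "G' = G - t"
  have "G' \<in> polys_over A"
    unfolding G'_def t_def using G by (intro PA.diff_closed A.monom_polys_over) (auto dest: polys_overD)
  moreover have "degree G' < degree G"
  proof -
    have "degree G' \<le> degree G"
      unfolding G'_def t_def by (intro degree_diff_le degree_monom_le order.refl)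
    moreover have "coeff G' (degree G) = 0" by (simp add: G'_def t_def)
    ultimately show ?thesis
      using deg by (metis degree_0 le_neq_implies_less leading_coeff_0_iff not_one_le_zero)
  qed
  moreover have "poly G y - poly G' y \<in> P"
    using lc y by (simp add: G'_def t_def poly_monom P_mult' R.power_closed)
  moreover have "coeff G k - coeff G' k \<in> P" for k
    using lc P_zero by (auto simp: G'_def t_def coeff_monom)
  ultimately show ?thesis using that by blast
qed

context prime_of_subring
begin

context
  fixes A y F
  assumes A: "unital_subring A" and AR: "A \<subseteq> R" and y: "y \<in> R"
    and F: "minimal_relation A P y F"
begin

interpretation A: unital_subring A by (rule A)
interpretation PA: unital_subring "polys_over A" by (rule A.unital_subring_polys_over)

lemma minimal_relationD: "F \<in> polys_over A" "degree F \<ge> 1" "lead_coeff F \<notin> P" "poly F y \<in> P"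
  using F unfolding minimal_relation_def algebraic_relation_def by auto

text \<open>A minimal relation plays the role of a minimal polynomial: below its degree the powers of \<open>y\<close> are
  linearly independent modulo \<open>P\<close>.\<close>

lemma minimal_relation_low_degree:
  assumes "G \<in> polys_over A" "degree G < degree F" "poly G y \<in> P"
  shows "coeff G k \<in> P"
  using assms
proof (induction "degree G" arbitrary: G rule: less_induct)
  case less
  show ?case
  proof (cases "degree G")
    case 0
    then obtain c where "G = [:c:]" by (rule degree_eq_zeroE)
    then show ?thesis using less.prems P_zero by (cases k) auto
  next
    case (Suc n)
    then have "lead_coeff G \<in> P"
      using F less.prems unfolding minimal_relation_def algebraic_relation_def
      by (metis One_nat_def Suc_leI linorder_not_le zero_less_Suc)
    then obtain G' where G': "G' \<in> polys_over A" "degree G' < degree G" "poly G y - poly G' y \<in> P"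
      "\<And>k. coeff G k - coeff G' k \<in> P"
      using drop_leading_term[OF A y less.prems(1)] Suc by auto
    have "poly G' y \<in> P" using P_diff[OF less.prems(3) G'(3)] by simp
    then have "coeff G' k \<in> P" using less.hyps[OF G'(2,1)] G'(2) less.prems by auto
    from P_add[OF this G'(4)[of k]] show ?thesis by simp
  qed
qed

text \<open>Separability in characteristic zero.\<close>

lemma minimal_relation_formal_deriv:
  assumes char: "\<And>n a. n \<ge> 1 \<Longrightarrow> of_nat n * a \<in> P \<Longrightarrow> a \<in> P"
  shows "poly (formal_deriv F) y \<notin> P"
proof
  assume *: "poly (formal_deriv F) y \<in> P"
  have nat: "of_nat k * a \<in> A" if "a \<in> A" for k a
    using that by (induction k) (auto simp: algebra_simps intro: A.zero_closed A.add_closed)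
  have "formal_deriv F \<in> polys_over A"
    unfolding formal_deriv_def using minimal_relationD(1)
    by (intro PA.sum_closed A.monom_polys_over nat) (auto dest: polys_overD)
  moreover have "degree (formal_deriv F) < degree F"
  proof -
    have "degree (formal_deriv F) \<le> degree F - 1"
      unfolding formal_deriv_def
      by (intro degree_sum_le) (auto intro!: order.trans[OF degree_monom_le])
    then show ?thesis using minimal_relationD(2) by linarith
  qed
  ultimately have mem: "coeff (formal_deriv F) (degree F - 1) \<in> P"
    using minimal_relation_low_degree * by blast
  have "coeff (formal_deriv F) (degree F - 1) =
      (\<Sum>k\<le>degree F. if k = degree F then of_nat k * coeff F k else 0)"
    unfolding formal_deriv_def coeff_sum
  proof (intro sum.cong refl)
    fix k assume "k \<in> {..degree F}"
    then show "coeff (monom (of_nat k * coeff F k) (k - 1)) (degree F - 1) =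
        (if k = degree F then of_nat k * coeff F k else 0)"
      using minimal_relationD(2) by (cases "k = 0") (auto simp: coeff_monom)
  qed
  then have "of_nat (degree F) * lead_coeff F \<in> P"
    using mem by simp
  then show False using char minimal_relationD by blast
qed

text \<open>Incomparability for one simple algebraic extension.  Consider an
  element \<open>poly G y\<close> of \<open>Q\<close> outside \<open>P\<close> with \<open>G\<close> of least degree.  If \<open>G\<close> is constant, it lies in
  \<open>Q \<inter> A\<close>; otherwise \<open>G\<close> turns out to divide the minimal relation modulo \<open>P\<close>, which is
  irreducible.\<close>

lemma prime_tower_step:
  assumes Q: "ideal_of_subring R Q" and PQ: "P \<subseteq> Q" and base: "Q \<inter> A \<subseteq> P"
  shows "Q \<inter> adjoin A y \<subseteq> P"
proof (rule ccontr)
  interpret Q: ideal_of_subring R Q by fact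
  define bad where "bad G \<longleftrightarrow> G \<in> polys_over A \<and> poly G y \<in> Q \<and> poly G y \<notin> P" for G
  assume "\<not> Q \<inter> adjoin A y \<subseteq> P"
  then have "\<exists>G. bad G" unfolding adjoin_def bad_def by blast
  then obtain G where G: "bad G" "\<And>H. bad H \<Longrightarrow> degree G \<le> degree H"
    using ex_has_least_nat[of bad _ degree] by blast
  have polyR: "poly H y \<in> R" if "H \<in> polys_over A" for H
    using A.poly_closed[OF R.unital_subring_axioms AR y that] .
  have lcR: "lead_coeff H \<in> R" if "H \<in> polys_over A" for H
    using that AR by (auto dest: polys_overD)
  have GA: "G \<in> polys_over A" using G(1) bad_def by blast
  have deg1: "degree G \<ge> 1"
  proof (rule ccontr)
    assume "\<not> ?thesis"
    then have "degree G = 0" by simp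
    then obtain c where c: "G = [:c:]" by (rule degree_eq_zeroE)
    then have "c \<in> A" using GA by (metis lead_coeff_pCons(2) polys_overD)
    then show False using c G(1) base unfolding bad_def by auto
  qed
  have lcG: "lead_coeff G \<notin> P"
  proof
    assume "lead_coeff G \<in> P"
    then obtain G' where G': "G' \<in> polys_over A" "degree G' < degree G" "poly G y - poly G' y \<in> P"
      using drop_leading_term[OF A y GA _ deg1] by blast
    have "poly G' y \<in> Q" using G(1) G'(3) PQ Q.P_diff[of "poly G y" "poly G y - poly G' y"]
      unfolding bad_def by auto
    moreover have "poly G' y \<notin> P" using G(1) G'(3) P_add unfolding bad_def by fastforce
    ultimately show False using G(2)[of G'] G' unfolding bad_def by auto
  qed
  have "degree G < degree F"
  proof -
    obtain q r n where q: "q \<in> polys_over A" "r \<in> polys_over A"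
      "smult (lead_coeff F ^ n) G = q * F + r" "degree r < degree F"
      using A.pseudo_division[OF minimal_relationD(1,2) GA] by blast
    have "lead_coeff F ^ n * poly G y = poly q y * poly F y + poly r y"
      using arg_cong[OF q(3), of "\<lambda>p. poly p y"] by simp
    then have r: "poly r y = lead_coeff F ^ n * poly G y - poly q y * poly F y" by simp
    have "poly q y * poly F y \<in> P" using minimal_relationD(4) polyR q by (intro P_mult)
    moreover have "lead_coeff F ^ n * poly G y \<in> Q"
      using G(1) lcR[OF minimal_relationD(1)] unfolding bad_def by (intro Q.P_mult R.power_closed) auto
    moreover have "lead_coeff F ^ n * poly G y \<notin> P"
      using G(1) lcR[OF minimal_relationD(1)] P_prime P_power[OF lcR[OF minimal_relationD(1)]] minimal_relationD(3) polyR[OF GA]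
        R.power_closed unfolding bad_def by blast
    ultimately have "bad r"
      unfolding bad_def r using q PQ Q.P_diff
      by (metis (no_types, lifting) P_add diff_add_cancel r subsetD)
    then show ?thesis using G(2) q(4) by fastforce
  qed
  \<comment> \<open>The remainder of \<open>F\<close> modulo \<open>G\<close> lies in \<open>Q\<close> and has smaller degree than \<open>G\<close>, so it lies in
    \<open>P\<close>.  Then \<open>G\<close> divides \<open>F\<close> modulo \<open>P\<close>, against the minimality of \<open>F\<close>.\<close>
  obtain u r n where u: "u \<in> polys_over A" "r \<in> polys_over A"
    "smult (lead_coeff G ^ n) F = u * G + r" "degree r < degree G"
    "degree u \<le> degree F - degree G"
    using A.pseudo_division[OF GA deg1 minimal_relationD(1)] by blast
  have eq: "lead_coeff G ^ n * poly F y = poly u y * poly G y + poly r y"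
    using arg_cong[OF u(3), of "\<lambda>p. poly p y"] by simp
  have FP: "lead_coeff G ^ n * poly F y \<in> P"
    using minimal_relationD(4) lcR[OF GA] by (intro P_mult R.power_closed)
  have rP: "poly r y \<in> P"
  proof (rule ccontr)
    assume "poly r y \<notin> P"
    moreover have "poly r y \<in> Q"
    proof -
      have "poly u y * poly G y \<in> Q" using G(1) polyR u unfolding bad_def by (intro Q.P_mult) auto
      then show ?thesis
        using Q.P_diff[of "lead_coeff G ^ n * poly F y" "poly u y * poly G y"] FP PQ eq by auto
    qed
    ultimately show False using G(2)[of r] u unfolding bad_def by auto
  qed
  have "poly u y * poly G y \<in> P" using P_diff[OF FP rP] eq by simp
  then have "poly u y \<in> P" using P_prime polyR u(1) GA G(1) unfolding bad_def by blast
  moreover have "degree u < degree F" using u(5) deg1 \<open>degree G < degree F\<close> by linarith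
  ultimately have uP: "coeff u k \<in> P" for k using minimal_relation_low_degree u(1) by blast
  have "coeff (u * G) (degree F) \<in> P"
    unfolding coeff_mult using uP GA AR by (intro P_sum P_mult') (auto dest: polys_overD)
  moreover have "coeff r (degree F) = 0"
    using u(4) \<open>degree G < degree F\<close> by (intro coeff_eq_0) linarith
  ultimately have "coeff (smult (lead_coeff G ^ n) F) (degree F) \<in> P"
    unfolding u(3) by simp
  then have "lead_coeff G ^ n * lead_coeff F \<in> P" by simp
  then show False
    using P_prime P_power[OF lcR[OF GA] lcG] minimal_relationD(3) lcR[OF minimal_relationD(1)] lcR[OF GA]
      R.power_closed by blast
qed

end

end

section \<open>Polynomial functions on Euclidean space\<close>

definition polynomials :: "(real^'n \<Rightarrow> real) set" where
  "polynomials = {p. real_polynomial_function p}"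

lemma polynomials_iff [simp]: "p \<in> polynomials \<longleftrightarrow> real_polynomial_function p"
  by (simp add: polynomials_def)

lemmas rpf_linear = real_polynomial_function.intros(1)
  and rpf_const = real_polynomial_function.intros(2)
  and rpf_add = real_polynomial_function.intros(3)
  and rpf_mult = real_polynomial_function.intros(4)

lemma rpf_plus: "real_polynomial_function p \<Longrightarrow> real_polynomial_function q \<Longrightarrow>
    real_polynomial_function (p + q)"
  unfolding plus_fun_def by (rule rpf_add)

lemma rpf_times: "real_polynomial_function p \<Longrightarrow> real_polynomial_function q \<Longrightarrow>
    real_polynomial_function (p * q)"
  unfolding times_fun_def by (rule rpf_mult)

lemma rpf_coord: "real_polynomial_function (\<lambda>x::real^'n. x $ i)"
  by (intro rpf_linear bounded_linear_vec_nth)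

lemma linear_functional_expand:
  fixes L :: "real^'n \<Rightarrow> real"
  assumes "linear L"
  shows "L v = (\<Sum>i\<in>UNIV. v $ i * L (axis i 1))"
proof -
  have "v = (\<Sum>i\<in>UNIV. v $ i *\<^sub>R axis i 1)"
    using basis_expansion[of v] by (simp add: scalar_mult_eq_scaleR)
  then have "L v = L (\<Sum>i\<in>UNIV. v $ i *\<^sub>R axis i 1)" by (rule arg_cong)
  also have "\<dots> = (\<Sum>i\<in>UNIV. v $ i * L (axis i 1))"
    using assms by (simp add: linear_sum linear_scale)
  finally show ?thesis .
qed

lemma polynomial_function_vecI:
  fixes f :: "'a::euclidean_space \<Rightarrow> real^'n"
  assumes "\<And>i. real_polynomial_function (\<lambda>x. f x $ i)"
  shows "polynomial_function f"
  unfolding polynomial_function_iff_Basis_inner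
  using assms by (auto simp: Basis_vec_def inner_axis)

lemma polynomial_function_vecD:
  assumes "polynomial_function f"
  shows "real_polynomial_function (\<lambda>x. f x $ i)"
  using real_polynomial_function_compose[OF assms rpf_coord[of i]] by (simp add: o_def)

lemma rpf_compose: "polynomial_function f \<Longrightarrow> real_polynomial_function p \<Longrightarrow>
    real_polynomial_function (\<lambda>x. p (f x))"
  using real_polynomial_function_compose[of f p] by (simp add: o_def)

lemma sum_fun_apply: "(sum f I) x = (\<Sum>i\<in>I. f i x)" for f :: "'i \<Rightarrow> 'a \<Rightarrow> 'b::comm_monoid_add"
  by (induction I rule: infinite_finite_induct) auto

lemma power_fun_apply: "(f ^ n) x = f x ^ n" for f :: "'a \<Rightarrow> 'b::comm_ring_1"
  by (induction n) auto

interpretation polynomials: unital_subring "polynomials :: (real^'n \<Rightarrow> real) set"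
  by standard
    (auto simp: fun_diff_def times_fun_def one_fun_def intro: real_polynomial_function.intros)

subsection \<open>Restriction to lines\<close>

lemma univariate_polynomial_finite_roots:
  fixes f :: "real \<Rightarrow> real"
  assumes "real_polynomial_function f" "f t0 \<noteq> 0"
  shows "finite {t. f t = 0}"
proof -
  obtain a n where f: "f = (\<lambda>x. \<Sum>i\<le>n. a i * x ^ i)"
    using real_polynomial_function_imp_sum[OF assms(1)] by blast
  define F where "F = (\<Sum>i\<le>n. monom (a i) i)"
  have F: "poly F t = f t" for t
    by (simp add: F_def f poly_sum poly_monom)
  then have "F \<noteq> 0" using assms(2) by (metis poly_0)
  then show ?thesis using poly_roots_finite[of F] F by simp
qed

lemma polynomial_on_line:
  fixes p :: "real^'n \<Rightarrow> real"
  assumes "real_polynomial_function p"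
  shows "real_polynomial_function (\<lambda>t::real. p (a + t *\<^sub>R v))"
  by (intro rpf_compose[OF _ assms] polynomial_function_vecI)
     (simp, intro rpf_add rpf_const rpf_mult rpf_linear bounded_linear_ident)

text \<open>On the line through a point where \<open>p\<close> is nonzero and a point where \<open>q\<close> is nonzero, both have only
  finitely many zeros.\<close>

lemma polynomial_mult_eq_0:
  fixes p q :: "real^'n \<Rightarrow> real"
  assumes p: "real_polynomial_function p" and q: "real_polynomial_function q"
    and 0: "\<And>x. p x * q x = 0"
  shows "(\<forall>x. p x = 0) \<or> (\<forall>x. q x = 0)"
proof (rule ccontr)
  assume "\<not> ?thesis"
  then obtain a b where ab: "p a \<noteq> 0" "q b \<noteq> 0" by blast
  let ?l = "\<lambda>t. a + t *\<^sub>R (b - a)"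
  have "finite {t. p (?l t) = 0}"
    using univariate_polynomial_finite_roots[OF polynomial_on_line[OF p, of a "b - a"], of 0] ab
    by simp
  moreover have "finite {t. q (?l t) = 0}"
    using univariate_polynomial_finite_roots[OF polynomial_on_line[OF q, of a "b - a"], of 1] ab
    by simp
  ultimately have "finite ({t. p (?l t) = 0} \<union> {t. q (?l t) = 0})" by simp
  moreover have "{t. p (?l t) = 0} \<union> {t. q (?l t) = 0} = UNIV" using 0 by auto
  ultimately show False using infinite_UNIV_char_0[where 'a=real] by simp
qed

subsection \<open>Polynomials in some of the coordinates\<close>

definition depends_on :: "'n set \<Rightarrow> (real^'n \<Rightarrow> real) \<Rightarrow> bool" where
  "depends_on T p \<longleftrightarrow> (\<forall>x y. (\<forall>i\<in>T. x $ i = y $ i) \<longrightarrow> p x = p y)"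

definition polys_in :: "'n set \<Rightarrow> (real^'n \<Rightarrow> real) set" where
  "polys_in T = {p. real_polynomial_function p \<and> depends_on T p}"

definition coord :: "'n \<Rightarrow> real^'n \<Rightarrow> real" where
  "coord j = (\<lambda>x. x $ j)"

definition coord_proj :: "'n set \<Rightarrow> real^'n \<Rightarrow> real^'n" where
  "coord_proj T x = (\<chi> i. if i \<in> T then x $ i else 0)"

lemma coord_proj_nth [simp]: "coord_proj T x $ i = (if i \<in> T then x $ i else 0)"
  by (simp add: coord_proj_def)

lemma rpf_coord_if: "real_polynomial_function (\<lambda>x::real^'n. if i \<in> T then x $ i else 0)"
  by (cases "i \<in> T") (auto intro: rpf_coord)

lemma polynomial_function_coord_proj: "polynomial_function (coord_proj T)"
  by (intro polynomial_function_vecI) (simp add: rpf_coord_if)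

lemma polys_in_UNIV [simp]: "polys_in UNIV = polynomials"
proof -
  have "depends_on UNIV p" for p :: "real^'n \<Rightarrow> real"
    unfolding depends_on_def by (metis UNIV_I vec_eq_iff)
  then show ?thesis by (auto simp: polys_in_def)
qed

lemma polys_in_mono: "S \<subseteq> T \<Longrightarrow> polys_in S \<subseteq> polys_in T"
  unfolding polys_in_def depends_on_def by blast

lemma polys_in_polynomials: "polys_in T \<subseteq> polynomials"
  unfolding polys_in_def by auto

lemma polys_in_coord_proj: "p \<in> polys_in T \<Longrightarrow> p (coord_proj T x) = p x"
  unfolding polys_in_def depends_on_def by simp

lemma unital_subring_polys_in: "unital_subring (polys_in T)"
proof
  show "1 \<in> polys_in T" by (auto simp: polys_in_def depends_on_def one_fun_def)
next
  fix a b assume "a \<in> polys_in T" "b \<in> polys_in T"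
  then have "real_polynomial_function a" "real_polynomial_function b"
    and *: "\<And>x y. (\<forall>i\<in>T. x $ i = y $ i) \<Longrightarrow> a x = a y \<and> b x = b y"
    by (auto simp: polys_in_def depends_on_def)
  then show "a - b \<in> polys_in T" "a * b \<in> polys_in T"
    unfolding polys_in_def depends_on_def
    by (auto simp: fun_diff_def times_fun_def) (metis *)+
qed

lemma coord_polys_in: "j \<in> T \<Longrightarrow> coord j \<in> polys_in T"
  by (auto simp: polys_in_def depends_on_def coord_def rpf_coord)

lemma poly_fun_cong:
  fixes F :: "('a \<Rightarrow> real) poly"
  assumes "\<And>k. coeff F k x = coeff F k x'" "z x = z' x'"
  shows "poly F z x = poly F z' x'"
  using assms(1)
proof (induction F)
  case (pCons c F)
  have "coeff F k x = coeff F k x'" for k using pCons.prems[of "Suc k"] by simp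
  then show ?case using pCons.IH pCons.prems[of 0] assms(2) by simp
qed simp

text \<open>Substituting into the coefficients while keeping the value of the variable; used to make
  coefficients independent of further coordinates.\<close>

lemma poly_map_poly_fun:
  fixes F :: "('a \<Rightarrow> real) poly"
  shows "poly (map_poly (\<lambda>c x. c (g x)) F) z x = poly F (\<lambda>_. z x) (g x)"
proof (induction F)
  case (pCons c F)
  have "map_poly (\<lambda>c x. c (g x)) (pCons c F) = pCons (\<lambda>x. c (g x)) (map_poly (\<lambda>c x. c (g x)) F)"
    by (intro map_poly_pCons) (auto simp: zero_fun_def)
  then show ?case using pCons.IH by simp
qed simp

lemma polynomial_adjoin_coord:
  assumes "real_polynomial_function p"
  shows "p \<in> adjoin (polys_in (- {j})) (coord j)"
proof -
  interpret A: unital_subring "polys_in (- {j})" by (rule unital_subring_polys_in)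
  interpret B: unital_subring "adjoin (polys_in (- {j})) (coord j)" by (rule A.unital_subring_adjoin)
  have const: "(\<lambda>x. c) \<in> adjoin (polys_in (- {j})) (coord j)" for c
    using A.adjoin_base by (auto simp: polys_in_def depends_on_def)
  show ?thesis
    using assms
  proof induction
    case (linear f)
    interpret f: bounded_linear f by fact
    have "f x = f (coord_proj (- {j}) x) + f (axis j 1) * coord j x" for x
    proof -
      have "x = coord_proj (- {j}) x + x $ j *\<^sub>R axis j 1"
        by (auto simp: vec_eq_iff axis_def)
      then have "f x = f (coord_proj (- {j}) x + x $ j *\<^sub>R axis j 1)" by simp
      then show ?thesis by (simp add: f.add f.scaleR coord_def)
    qed
    then have split: "f = (\<lambda>x. f (coord_proj (- {j}) x)) + (\<lambda>x. f (axis j 1)) * coord j"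
      unfolding plus_fun_def times_fun_def by (rule ext)
    have "(\<lambda>x. f (coord_proj (- {j}) x)) \<in> polys_in (- {j})"
    proof -
      have "coord_proj (- {j}) x = coord_proj (- {j}) y" if "\<forall>i\<in>- {j}. x $ i = y $ i" for x y :: "real^'a"
        using that by (auto simp: vec_eq_iff)
      then show ?thesis
        unfolding polys_in_def depends_on_def
        using rpf_compose[OF polynomial_function_coord_proj rpf_linear[OF \<open>bounded_linear f\<close>]]
        by (auto intro: arg_cong[of _ _ f])
    qed
    moreover have "(\<lambda>x. f (axis j 1)) * coord j \<in> adjoin (polys_in (- {j})) (coord j)"
      by (intro B.mult_closed const A.adjoin_generator)
    ultimately have "(\<lambda>x. f (coord_proj (- {j}) x)) + (\<lambda>x. f (axis j 1)) * coord j
        \<in> adjoin (polys_in (- {j})) (coord j)"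
      using A.adjoin_base by (intro B.add_closed) (rule subsetD, assumption+)
    then show ?case unfolding split[symmetric] .
  next
    case (const c)
    then show ?case using \<open>\<And>c. (\<lambda>x. c) \<in> adjoin (polys_in (- {j})) (coord j)\<close> by simp
  next
    case (add f g)
    from B.add_closed[OF add.IH] show ?case by (simp add: plus_fun_def)
  next
    case (mult f g)
    from B.mult_closed[OF mult.IH] show ?case by (simp add: times_fun_def)
  qed
qed

text \<open>Coordinates are adjoined one at a time, which turns statements about polynomials in several
  variables into inductions over simple extensions.\<close>

lemma polys_in_insert:
  assumes "j \<notin> T"
  shows "polys_in (insert j T) = adjoin (polys_in T) (coord j)"
proof (intro subset_antisym subsetI)
  fix p assume p: "p \<in> polys_in (insert j T)"
  then obtain F where F: "F \<in> polys_over (polys_in (- {j}))" "p = poly F (coord j)"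
    using polynomial_adjoin_coord[of p j] by (auto simp: polys_in_def adjoin_def)
  define G where "G = map_poly (\<lambda>c x. c (coord_proj T x)) F"
  have coeff_G: "coeff G k = (\<lambda>x. coeff F k (coord_proj T x))" for k
    unfolding G_def by (intro coeff_map_poly) (auto simp: zero_fun_def)
  have "coeff G k \<in> polys_in T" for k
  proof -
    have "real_polynomial_function (coeff F k)"
      using polys_overD[OF F(1)] by (simp add: polys_in_def)
    moreover have "coord_proj T x = coord_proj T y" if "\<forall>i\<in>T. x $ i = y $ i" for x y :: "real^'a"
      using that by (auto simp: vec_eq_iff)
    ultimately show ?thesis
      unfolding coeff_G polys_in_def depends_on_def
      by (auto intro!: rpf_compose[OF polynomial_function_coord_proj] arg_cong[of _ _ "coeff F k"])
  qed
  then have "G \<in> polys_over (polys_in T)" by (simp add: polys_over_def)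
  moreover have "p x = poly G (coord j) x" for x
  proof -
    have "p x = poly F (coord j) (coord_proj (insert j T) x)"
      using polys_in_coord_proj[OF p] F(2) by metis
    also have "\<dots> = poly F (\<lambda>_. x $ j) (coord_proj T x)"
    proof (rule poly_fun_cong)
      fix k
      have "depends_on (- {j}) (coeff F k)"
        using polys_overD[OF F(1)] by (simp add: polys_in_def)
      then show "coeff F k (coord_proj (insert j T) x) = coeff F k (coord_proj T x)"
        unfolding depends_on_def by auto
    qed (simp add: coord_def)
    also have "\<dots> = poly G (coord j) x"
      unfolding G_def poly_map_poly_fun by (simp add: coord_def)
    finally show ?thesis .
  qed
  ultimately show "p \<in> adjoin (polys_in T) (coord j)"
    unfolding adjoin_def by (intro image_eqI[of _ _ G] ext) auto
next
  fix p assume "p \<in> adjoin (polys_in T) (coord j)"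
  then obtain F where F: "F \<in> polys_over (polys_in T)" "p = poly F (coord j)"
    by (auto simp: adjoin_def)
  show "p \<in> polys_in (insert j T)"
    unfolding F(2)
    by (rule unital_subring.poly_closed[OF unital_subring_polys_in unital_subring_polys_in _ _ F(1)])
       (auto intro: coord_polys_in polys_in_mono[THEN subsetD])
qed

lemma noetherian_polys_in_empty: "noetherian (polys_in ({} :: 'n::finite set))"
  unfolding noetherian_def
proof (intro allI impI)
  fix s :: "nat \<Rightarrow> real^'n \<Rightarrow> real" assume s: "\<forall>k. s k \<in> polys_in {}"
  have const: "s k x = s k y" for k x y
    using s by (simp add: polys_in_def depends_on_def)
  show "\<exists>k. s k \<in> linear_hull (polys_in {}) (s ` {..<k})"
  proof (cases "s 0 = 0")
    case True
    then show ?thesis by (metis linear_hull.zero)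
  next
    case False
    then have "s 0 0 \<noteq> 0" using const by (metis ext zero_fun_apply)
    define c where "c = (\<lambda>x::real^'n. s 1 0 / s 0 0)"
    have "s 1 = c * s 0 + 0"
    proof
      fix x
      show "s 1 x = (c * s 0 + 0) x"
        using \<open>s 0 0 \<noteq> 0\<close> const[of 1 x 0] const[of 0 x 0] by (simp add: c_def)
    qed
    moreover have "c \<in> polys_in {}" by (auto simp: c_def polys_in_def depends_on_def)
    ultimately have "s 1 \<in> linear_hull (polys_in {}) (s ` {..<1})"
      by (metis linear_hull.zero linear_hull.step imageI lessThan_iff zero_less_one)
    then show ?thesis by blast
  qed
qed

lemma noetherian_polys_in: "noetherian (polys_in (T :: 'n::finite set))"
proof -
  have "finite T" by simp
  then show ?thesis
  proof induction
    case (insert j T)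
    then show ?case
      by (metis polys_in_insert unital_subring.noetherian_adjoin unital_subring_polys_in)
  qed (rule noetherian_polys_in_empty)
qed

lemma noetherian_polynomials: "noetherian (polynomials :: (real^'n \<Rightarrow> real) set)"
  using noetherian_polys_in[of "UNIV :: 'n set"] by simp

text \<open>Along a line through the centre \<open>a\<close> with direction supported in \<open>E\<close>, \<open>p\<close> has infinitely many zeros.\<close>

lemma polys_in_vanishing_near:
  assumes p: "p \<in> polys_in E" and r: "r > 0"
    and van: "\<And>w. (\<And>i. i \<notin> E \<Longrightarrow> w $ i = 0) \<Longrightarrow> norm w < r \<Longrightarrow> p (a + w) = 0"
  shows "p = 0"
proof (rule ccontr)
  assume "p \<noteq> 0"
  then obtain y where y: "p y \<noteq> 0" by (auto simp: fun_eq_iff)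
  define w where "w = coord_proj E (y - a)"
  have "p (a + w) = p y"
    using p unfolding polys_in_def depends_on_def w_def by auto
  then have "finite {t. p (a + t *\<^sub>R w) = 0}"
    using y p univariate_polynomial_finite_roots[OF polynomial_on_line[of p a w], of 1]
    by (simp add: polys_in_def)
  moreover have "{0<..<r / (norm w + 1)} \<subseteq> {t. p (a + t *\<^sub>R w) = 0}"
  proof
    fix t assume t: "t \<in> {0<..<r / (norm w + 1)}"
    have "norm (t *\<^sub>R w) < r"
    proof -
      have "norm (t *\<^sub>R w) \<le> t * (norm w + 1)" using t by (simp add: mult_left_mono)
      also have "\<dots> < r" using t by (simp add: pos_less_divide_eq add_nonneg_pos)
      finally show ?thesis .
    qed
    then show "t \<in> {t. p (a + t *\<^sub>R w) = 0}"
      using van[of "t *\<^sub>R w"] by (simp add: w_def)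
  qed
  moreover have "infinite {0<..<r / (norm w + 1)}"
    using r by (intro infinite_Ioo) (simp add: add_nonneg_pos)
  ultimately show False using finite_subset by blast
qed

section \<open>Directional derivatives\<close>

abbreviation dderiv :: "(real^'n \<Rightarrow> real) \<Rightarrow> real^'n \<Rightarrow> real^'n \<Rightarrow> real" where
  "dderiv p x v \<equiv> frechet_derivative p (at x) v"

lemma polynomial_differentiable:
  fixes p :: "real^'n \<Rightarrow> real"
  shows "real_polynomial_function p \<Longrightarrow> p differentiable at x"
  by (intro differentiable_at_polynomial_function) (simp add: real_polynomial_function_eq)

lemma polynomial_has_derivative:
  fixes p :: "real^'n \<Rightarrow> real"
  shows "real_polynomial_function p \<Longrightarrow> (p has_derivative dderiv p x) (at x)"
  by (simp add: polynomial_differentiable flip: frechet_derivative_works)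

lemma linear_dderiv:
  fixes p :: "real^'n \<Rightarrow> real"
  shows "real_polynomial_function p \<Longrightarrow> linear (dderiv p x)"
  by (rule bounded_linear.linear[OF has_derivative_bounded_linear[OF polynomial_has_derivative]])

lemma dderiv_plus:
  assumes "real_polynomial_function p" "real_polynomial_function q"
  shows "dderiv (p + q) x v = dderiv p x v + dderiv q x v"
proof -
  have "((\<lambda>x. p x + q x) has_derivative (\<lambda>v. dderiv p x v + dderiv q x v)) (at x)"
    using assms by (intro has_derivative_add polynomial_has_derivative)
  from frechet_derivative_at[OF this] show ?thesis
    by (simp add: plus_fun_def fun_eq_iff)
qed

lemma dderiv_times:
  assumes "real_polynomial_function p" "real_polynomial_function q"
  shows "dderiv (p * q) x v = p x * dderiv q x v + dderiv p x v * q x"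
proof -
  have "((\<lambda>x. p x * q x) has_derivative (\<lambda>v. p x * dderiv q x v + dderiv p x v * q x)) (at x)"
    using assms by (intro has_derivative_mult polynomial_has_derivative)
  from frechet_derivative_at[OF this] show ?thesis
    by (simp add: times_fun_def fun_eq_iff)
qed

lemma dderiv_const: "dderiv (\<lambda>_. c) x v = 0"
  by (simp add: frechet_derivative_const)

lemma dderiv_linear: "bounded_linear f \<Longrightarrow> dderiv f x v = f v"
  using frechet_derivative_at[OF bounded_linear_imp_has_derivative, of f x] by simp

lemma dderiv_coord: "dderiv (coord j) x v = v $ j"
  unfolding coord_def by (intro dderiv_linear bounded_linear_vec_nth)

lemma rpf_power: "real_polynomial_function p \<Longrightarrow> real_polynomial_function (p ^ n)"
  by (induction n) (auto intro: rpf_times simp: one_fun_def)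

lemma dderiv_power:
  assumes "real_polynomial_function p"
  shows "dderiv (p ^ n) x v = of_nat n * p x ^ (n - 1) * dderiv p x v"
proof (induction n)
  case 0
  have "dderiv (p ^ 0) x v = 0"
    unfolding power_0 one_fun_def by (rule dderiv_const)
  then show ?case by simp
next
  case (Suc n)
  have "dderiv (p ^ Suc n) x v = p x * dderiv (p ^ n) x v + dderiv p x v * p x ^ n"
    unfolding power_Suc dderiv_times[OF assms rpf_power[OF assms]] power_fun_apply ..
  also have "\<dots> = (of_nat (Suc n) * p x ^ n) * dderiv p x v"
    unfolding Suc by (cases n) (auto simp: algebra_simps)
  finally show ?case unfolding diff_Suc_1 .
qed

lemma dderiv_sum:
  assumes "\<And>i. i \<in> I \<Longrightarrow> real_polynomial_function (f i)"
  shows "dderiv (sum f I) x v = (\<Sum>i\<in>I. dderiv (f i) x v)"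
  using assms
proof (induction I rule: infinite_finite_induct)
  case (insert i I)
  have "real_polynomial_function (sum f I)"
    using insert polynomials.sum_closed[of I f] by simp
  then have "dderiv (f i + sum f I) x v = dderiv (f i) x v + dderiv (sum f I) x v"
    using insert by (intro dderiv_plus) auto
  then show ?case using insert by (simp only: sum.insert insert_iff simp_thms)
next
  case (infinite I)
  have "dderiv 0 x v = 0" unfolding zero_fun_def by (rule dderiv_const)
  then show ?case by (simp only: sum.infinite[OF infinite(1)])
next
  case empty
  have "dderiv 0 x v = 0" unfolding zero_fun_def by (rule dderiv_const)
  then show ?case by (simp only: sum.empty)
qed

lemma rpf_dderiv:
  fixes p :: "real^'n \<Rightarrow> real"
  assumes "real_polynomial_function p" "polynomial_function V"
  shows "real_polynomial_function (\<lambda>x. dderiv p x (V x))"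
  using assms(1)
proof induction
  case (linear f)
  then show ?case
    using rpf_compose[OF assms(2) rpf_linear] by (simp add: dderiv_linear)
next
  case (const c)
  then show ?case by (simp add: dderiv_const rpf_const)
next
  case (add f g)
  then show ?case
    using dderiv_plus[of f g] by (auto simp: plus_fun_def intro: rpf_add)
next
  case (mult f g)
  then show ?case
    using dderiv_times[of f g]
    by (auto simp: times_fun_def intro!: rpf_add rpf_mult)
qed

text \<open>A polynomial in the coordinates \<open>T\<close> is constant in the directions on which \<open>v\<close> and \<open>w\<close> may differ.\<close>

lemma dderiv_polys_in_cong:
  assumes "p \<in> polys_in T" "\<And>i. i \<in> T \<Longrightarrow> v $ i = w $ i"
  shows "dderiv p x v = dderiv p x w"
proof -
  have p: "real_polynomial_function p" using assms(1) by (simp add: polys_in_def)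
  interpret L: linear "dderiv p x" using linear_dderiv[OF p] .
  have "((\<lambda>t. p (x + t *\<^sub>R (v - w))) has_derivative (\<lambda>t. dderiv p x (t *\<^sub>R (v - w)))) (at 0)"
  proof -
    have "((\<lambda>t. x + t *\<^sub>R (v - w)) has_derivative (\<lambda>t. t *\<^sub>R (v - w))) (at (0::real))"
      by (auto intro!: derivative_eq_intros)
    from diff_chain_at[OF this, of p "dderiv p x"] polynomial_has_derivative[OF p, of x]
    show ?thesis by (simp add: o_def)
  qed
  moreover have "p (x + t *\<^sub>R (v - w)) = p x" for t
    using assms unfolding polys_in_def depends_on_def by simp
  ultimately have "((\<lambda>t::real. p x) has_derivative (\<lambda>t. dderiv p x (t *\<^sub>R (v - w)))) (at 0)"
    by simp
  then have "(\<lambda>t. dderiv p x (t *\<^sub>R (v - w))) = (\<lambda>_. 0)"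
    by (rule has_derivative_unique) (rule has_derivative_const)
  from fun_cong[OF this, of 1] have "dderiv p x (1 *\<^sub>R (v - w)) = 0" by simp
  then show ?thesis by (simp add: L.diff)
qed

section \<open>Real algebraic sets\<close>

definition vanishing :: "(real^'n) set \<Rightarrow> (real^'n \<Rightarrow> real) set" where
  "vanishing S = {p. real_polynomial_function p \<and> (\<forall>x\<in>S. p x = 0)}"

definition zariski_closure :: "(real^'n) set \<Rightarrow> (real^'n) set" where
  "zariski_closure S = {x. \<forall>p\<in>vanishing S. p x = 0}"

lemma vanishing_mono: "S \<subseteq> T \<Longrightarrow> vanishing T \<subseteq> vanishing S"
  unfolding vanishing_def by auto

lemma ideal_vanishing: "ideal_of_subring polynomials (vanishing S)"
  by standard
    (auto simp: vanishing_def zero_fun_def intro: rpf_plus rpf_times)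

lemma vanishing_generators:
  obtains G where "finite G" "G \<subseteq> vanishing S" "vanishing S \<subseteq> linear_hull polynomials G"
proof (rule polynomials.noetherian_finite_generators[OF noetherian_polynomials])
  show "vanishing S \<subseteq> polynomials" by (auto simp: vanishing_def)
qed

lemma linear_hull_vanishing:
  assumes "p \<in> linear_hull A G" "\<And>g. g \<in> G \<Longrightarrow> g x = 0"
  shows "p x = 0"
  using assms(1) by induction (simp_all add: assms(2))

text \<open>Over the reals, finitely many equations are equivalent to the vanishing of the sum of their squares.\<close>

lemma common_zeros_eq_single_zero_set:
  assumes "\<forall>p\<in>P. real_polynomial_function p"
  obtains f :: "real^'n \<Rightarrow> real"
  where "real_polynomial_function f" "{x. \<forall>p\<in>P. p x = 0} = {x. f x = 0}"
proof -
  have "P \<subseteq> polynomials" using assms by auto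
  from polynomials.noetherian_finite_generators[OF noetherian_polynomials this]
  obtain G where G: "finite G" "G \<subseteq> P" "P \<subseteq> linear_hull polynomials G" .
  define f where "f = (\<lambda>x. \<Sum>g\<in>G. g x * g x)"
  have "real_polynomial_function f"
    unfolding f_def using G assms by (intro real_polynomial_function_sum) auto
  moreover have "f x = 0 \<longleftrightarrow> (\<forall>g\<in>G. g x = 0)" for x
    unfolding f_def using G(1) by (subst sum_nonneg_eq_0_iff) auto
  moreover have "(\<forall>g\<in>G. g x = 0) \<longleftrightarrow> (\<forall>p\<in>P. p x = 0)" for x
    using G(2,3) linear_hull_vanishing[of _ polynomials G x] by (meson subsetD)
  ultimately show ?thesis using that[of f] by simp
qed

lemma real_algebraic_set_iff:
  "real_algebraic_set Z \<longleftrightarrow> (\<exists>f. real_polynomial_function f \<and> Z = {x. f x = 0})"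
proof
  assume "real_algebraic_set Z"
  then show "\<exists>f. real_polynomial_function f \<and> Z = {x. f x = 0}"
    unfolding real_algebraic_set_def
  proof (elim exE conjE)
    fix P assume P: "\<forall>p\<in>P. real_polynomial_function p" "Z = {x. \<forall>p\<in>P. p x = 0}"
    from common_zeros_eq_single_zero_set[OF P(1)] obtain f where
      "real_polynomial_function f" "{x. \<forall>p\<in>P. p x = 0} = {x. f x = 0}" .
    then show ?thesis using P(2) by (intro exI[of _ f]) simp
  qed
next
  assume "\<exists>f. real_polynomial_function f \<and> Z = {x. f x = 0}"
  then obtain f where "real_polynomial_function f" "Z = {x. f x = 0}" by blast
  then show "real_algebraic_set Z"
    unfolding real_algebraic_set_def by (intro exI[of _ "{f}"]) auto
qed

lemma real_algebraic_set_zariski_closure: "real_algebraic_set (zariski_closure S)"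
  unfolding real_algebraic_set_def zariski_closure_def
  by (intro exI[of _ "vanishing S"]) (auto simp: vanishing_def)

lemma zariski_closure_subset: "S \<subseteq> zariski_closure S"
  by (auto simp: zariski_closure_def vanishing_def)

lemma zariski_closure_minimal: "real_algebraic_set Z \<Longrightarrow> S \<subseteq> Z \<Longrightarrow> zariski_closure S \<subseteq> Z"
  unfolding real_algebraic_set_iff zariski_closure_def vanishing_def by auto

lemma zariski_closure_algebraic: "real_algebraic_set Z \<Longrightarrow> zariski_closure Z = Z"
  using zariski_closure_minimal zariski_closure_subset by blast

lemma algebraic_eq_zeros_of_vanishing:
  "real_algebraic_set Z \<Longrightarrow> Z = {x. \<forall>p\<in>vanishing Z. p x = 0}"
  using zariski_closure_algebraic unfolding zariski_closure_def by blast

lemma real_algebraic_set_Int: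
  "real_algebraic_set A \<Longrightarrow> real_algebraic_set B \<Longrightarrow> real_algebraic_set (A \<inter> B)"
  using real_algebraic_set_Inter[of "{A, B}"] by auto

lemma closed_real_algebraic_set:
  assumes "real_algebraic_set Z" shows "closed Z"
proof -
  obtain f where f: "real_polynomial_function f" "Z = {x. f x = 0}"
    using assms real_algebraic_set_iff by blast
  have "continuous_on UNIV f"
    using f(1) continuous_on_polymonial_function real_polynomial_function_eq by blast
  then have "closed (f -` {0})" using continuous_closed_vimage[of "{0}" f]
    by (simp add: continuous_on_eq_continuous_at)
  moreover have "f -` {0} = Z" using f(2) by auto
  ultimately show ?thesis by simp
qed

text \<open>In a strictly decreasing sequence of algebraic sets, polynomials that vanish on the next set but not
  on the present one contradict the chain condition.\<close>

lemma wf_real_algebraic_sets: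
  "wf {(A :: (real^'n) set, B). real_algebraic_set A \<and> real_algebraic_set B \<and> A \<subset> B}"
  unfolding wf_iff_no_infinite_down_chain
proof (intro notI, elim exE)
  fix Z :: "nat \<Rightarrow> (real^'n) set"
  assume "\<forall>i. (Z (Suc i), Z i) \<in> {(A, B). real_algebraic_set A \<and> real_algebraic_set B \<and> A \<subset> B}"
  then have alg: "\<And>i. real_algebraic_set (Z i)" and sub: "\<And>i. Z (Suc i) \<subset> Z i" by auto
  have "\<forall>i. \<exists>p. p \<in> vanishing (Z (Suc i)) \<and> \<not> (\<forall>x\<in>Z i. p x = 0)"
  proof
    fix i
    obtain x where "x \<in> Z i" "x \<notin> Z (Suc i)" using sub by blast
    then show "\<exists>p. p \<in> vanishing (Z (Suc i)) \<and> \<not> (\<forall>x\<in>Z i. p x = 0)"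
      using algebraic_eq_zeros_of_vanishing[OF alg[of "Suc i"]] by blast
  qed
  from choice[OF this] obtain p where
    p: "\<And>i. p i \<in> vanishing (Z (Suc i))" "\<And>i. \<not> (\<forall>x\<in>Z i. p i x = 0)" by blast
  have "p i \<in> polynomials" for i using p(1) by (simp add: vanishing_def)
  from noetherianD[OF noetherian_polynomials, of p, OF this]
  obtain k where k: "p k \<in> linear_hull polynomials (p ` {..<k})" ..
  have "Z k \<subseteq> Z (Suc i)" if "i < k" for i
    using lift_Suc_antimono_le[of Z "Suc i" k] sub that by auto
  then have "p k x = 0" if "x \<in> Z k" for x
    using that p(1) by (intro linear_hull_vanishing[OF k]) (auto simp: vanishing_def)
  then show False using p(2) by blast
qed

lemma prime_vanishing:
  assumes "irreducible_algebraic_set Z"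
  shows "prime_of_subring polynomials (vanishing Z)"
proof -
  interpret ideal_of_subring polynomials "vanishing Z" by (rule ideal_vanishing)
  have Z: "real_algebraic_set Z" "Z \<noteq> {}" and irr: "\<And>A B. real_algebraic_set A \<Longrightarrow>
      real_algebraic_set B \<Longrightarrow> Z = A \<union> B \<Longrightarrow> Z = A \<or> Z = B"
    using assms unfolding irreducible_algebraic_set_def by auto
  show ?thesis
  proof
    fix a b :: "real^'a \<Rightarrow> real"
    assume a: "a \<in> polynomials" and b: "b \<in> polynomials" and ab: "a * b \<in> vanishing Z"
    have zeros: "real_algebraic_set {x. p x = 0}" if "p \<in> polynomials" for p :: "real^'a \<Rightarrow> real"
      using that unfolding real_algebraic_set_iff polynomials_iff by (intro exI[of _ p]) simp
    have "real_algebraic_set (Z \<inter> {x. a x = 0})" "real_algebraic_set (Z \<inter> {x. b x = 0})"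
      by (intro real_algebraic_set_Int Z zeros a b)+
    moreover have "Z = (Z \<inter> {x. a x = 0}) \<union> (Z \<inter> {x. b x = 0})"
      using ab by (auto simp: vanishing_def)
    ultimately have "Z = Z \<inter> {x. a x = 0} \<or> Z = Z \<inter> {x. b x = 0}" by (rule irr)
    then show "a \<in> vanishing Z \<or> b \<in> vanishing Z" using a b by (auto simp: vanishing_def)
  next
    show "1 \<notin> vanishing Z" using Z(2) by (auto simp: vanishing_def)
  qed
qed

subsection \<open>Irreducible components\<close>

lemma irreducible_decomposition:
  assumes "real_algebraic_set (Z :: (real^'n) set)"
  shows "\<exists>\<A>. finite \<A> \<and> (\<forall>A\<in>\<A>. irreducible_algebraic_set A) \<and> \<Union>\<A> = Z"
  using assms
proof (induction Z rule: wf_induct_rule[OF wf_real_algebraic_sets])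
  case (1 Z)
  show ?case
  proof (cases "Z = {} \<or> irreducible_algebraic_set Z")
    case True
    then show ?thesis
    proof
      assume "Z = {}"
      then show ?thesis by (intro exI[of _ "{}"]) simp
    next
      assume "irreducible_algebraic_set Z"
      then show ?thesis by (intro exI[of _ "{Z}"]) simp
    qed
  next
    case False
    then obtain A B where AB: "real_algebraic_set A" "real_algebraic_set B" "Z = A \<union> B" "Z \<noteq> A" "Z \<noteq> B"
      using 1(2) unfolding irreducible_algebraic_set_def by blast
    then have "A \<subset> Z" "B \<subset> Z" by auto
    then obtain \<A> \<B> where "finite \<A> \<and> (\<forall>A\<in>\<A>. irreducible_algebraic_set A) \<and> \<Union>\<A> = A"
      "finite \<B> \<and> (\<forall>A\<in>\<B>. irreducible_algebraic_set A) \<and> \<Union>\<B> = B"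
      using 1(1)[of A] 1(1)[of B] 1(2) AB(1,2) by auto
    then show ?thesis using AB by (intro exI[of _ "\<A> \<union> \<B>"]) auto
  qed
qed

lemma irreducible_subset_Union:
  assumes Z: "irreducible_algebraic_set Z" and fin: "finite \<A>"
    and alg: "\<And>A. A \<in> \<A> \<Longrightarrow> real_algebraic_set A" and sub: "Z \<subseteq> \<Union>\<A>"
  shows "\<exists>A\<in>\<A>. Z \<subseteq> A"
  using fin alg sub
proof (induction \<A> rule: finite_induct)
  case empty
  then show ?case using Z by (auto simp: irreducible_algebraic_set_def)
next
  case (insert A \<A>)
  have "real_algebraic_set Z" using Z by (simp add: irreducible_algebraic_set_def)
  have "finite (\<Union>((\<lambda>A. {A}) ` \<A>))" using insert by simp
  have U: "real_algebraic_set (\<Union>\<A>)" if "finite \<A>" "\<forall>A\<in>\<A>. real_algebraic_set A" for \<A> :: "(real^'a) set set"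
    using that
  proof (induction \<A> rule: finite_induct)
    case empty
    have "real_algebraic_set {x::real^'a. (\<lambda>_. 1::real) x = 0}"
      unfolding real_algebraic_set_iff by blast
    then show ?case by simp
  qed (auto intro: real_algebraic_set_Un)
  have "real_algebraic_set (Z \<inter> A)" "real_algebraic_set (Z \<inter> \<Union>\<A>)"
    using insert \<open>real_algebraic_set Z\<close> U[of \<A>] by (auto intro!: real_algebraic_set_Int)
  moreover have "Z = (Z \<inter> A) \<union> (Z \<inter> \<Union>\<A>)" using insert.prems by auto
  ultimately have "Z = Z \<inter> A \<or> Z = Z \<inter> \<Union>\<A>"
    using Z unfolding irreducible_algebraic_set_def by blast
  then show ?case using insert by (metis Int_lower2 insertCI)
qed

lemma irreducible_componentsD:
  assumes "Z \<in> irreducible_components X"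
  shows "irreducible_algebraic_set Z" "Z \<subseteq> X"
  using assms by (auto simp: irreducible_components_def)

lemma finite_irreducible_components:
  assumes "real_algebraic_set X"
  shows "finite (irreducible_components X)"
proof -
  obtain \<A> where A: "finite \<A>" "\<forall>A\<in>\<A>. irreducible_algebraic_set A" "\<Union>\<A> = X"
    using irreducible_decomposition[OF assms] by blast
  have "irreducible_components X \<subseteq> \<A>"
  proof
    fix Z assume Z: "Z \<in> irreducible_components X"
    then obtain A where "A \<in> \<A>" "Z \<subseteq> A"
      using irreducible_subset_Union[of Z \<A>] irreducible_componentsD[OF Z] A
      by (auto simp: irreducible_algebraic_set_def)
    then have "A = Z" using Z A unfolding irreducible_components_def by blast
    then show "Z \<in> \<A>" using \<open>A \<in> \<A>\<close> by simp
  qed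
  then show ?thesis using A(1) finite_subset by blast
qed

lemma Union_irreducible_components:
  assumes "real_algebraic_set X"
  shows "\<Union>(irreducible_components X) = X"
proof -
  obtain \<A> where A: "finite \<A>" "\<forall>A\<in>\<A>. irreducible_algebraic_set A" "\<Union>\<A> = X"
    using irreducible_decomposition[OF assms] by blast
  have "x \<in> \<Union>(irreducible_components X)" if "x \<in> X" for x
  proof -
    from that have "x \<in> \<Union>\<A>" unfolding A(3) .
    then obtain A where Ax: "A \<in> \<A>" "x \<in> A" by (rule UnionE)
    obtain M where M: "M \<in> \<A>" "A \<subseteq> M" "\<forall>B\<in>\<A>. M \<subseteq> B \<longrightarrow> B = M"
      using finite_has_maximal2[OF A(1) Ax(1)] by blast
    have "M \<in> irreducible_components X"
      unfolding irreducible_components_def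
    proof (intro CollectI conjI allI impI)
      show "irreducible_algebraic_set M" "M \<subseteq> X" using A M by auto
      fix Z assume Z: "irreducible_algebraic_set Z \<and> M \<subseteq> Z \<and> Z \<subseteq> X"
      then obtain B where "B \<in> \<A>" "Z \<subseteq> B"
        using irreducible_subset_Union[of Z \<A>] A by (auto simp: irreducible_algebraic_set_def)
      then show "Z = M" using M Z by blast
    qed
    then show ?thesis using Ax M by blast
  qed
  then show ?thesis using irreducible_componentsD by blast
qed

lemma component_separating_polynomial:
  assumes X: "real_algebraic_set X" and Z: "Z \<in> irreducible_components X"
  obtains q where "real_polynomial_function q" "q \<notin> vanishing Z"
    "\<And>x. x \<in> X \<Longrightarrow> x \<notin> Z \<Longrightarrow> q x = 0"
proof -
  interpret prime_of_subring polynomials "vanishing Z"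
    by (rule prime_vanishing[OF irreducible_componentsD(1)[OF Z]])
  let ?I = "irreducible_components X - {Z}"
  have "\<forall>B. \<exists>q. B \<in> ?I \<longrightarrow> q \<in> vanishing B \<and> q \<notin> vanishing Z"
  proof
    fix B
    show "\<exists>q. B \<in> ?I \<longrightarrow> q \<in> vanishing B \<and> q \<notin> vanishing Z"
    proof (cases "B \<in> ?I")
      case True
      then have "\<not> Z \<subseteq> B" using Z unfolding irreducible_components_def by blast
      then obtain x where x: "x \<in> Z" "x \<notin> B" by blast
      have "real_algebraic_set B"
        using True irreducible_componentsD(1)[of B X] by (auto simp: irreducible_algebraic_set_def)
      then obtain q where "q \<in> vanishing B" "q x \<noteq> 0"
        using x algebraic_eq_zeros_of_vanishing by blast
      then show ?thesis using x by (intro exI[of _ q]) (auto simp: vanishing_def)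
    qed blast
  qed
  from choice[OF this] obtain q where
    q: "\<And>B. B \<in> ?I \<Longrightarrow> q B \<in> vanishing B \<and> q B \<notin> vanishing Z" by blast
  have "finite ?I" using finite_irreducible_components[OF X] by simp
  have "\<exists>f. real_polynomial_function f \<and> f \<notin> vanishing Z \<and> (\<forall>B\<in>J. \<forall>x\<in>B. f x = 0)"
    if "finite J" "J \<subseteq> ?I" for J
    using that
  proof (induction J rule: finite_induct)
    case empty
    then show ?case using P_proper by (intro exI[of _ 1]) (auto simp: one_fun_def)
  next
    case (insert B J)
    then obtain f where f: "real_polynomial_function f" "f \<notin> vanishing Z" "\<forall>B\<in>J. \<forall>x\<in>B. f x = 0"
      by auto
    have "q B \<in> vanishing B" "q B \<notin> vanishing Z" using q insert by auto
    then have "real_polynomial_function (q B)" "\<forall>x\<in>B. q B x = 0" by (auto simp: vanishing_def)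
    then have "f * q B \<notin> vanishing Z"
      using f P_prime[of f "q B"] \<open>q B \<notin> vanishing Z\<close> unfolding polynomials_iff by blast
    moreover have "(f * q B) x = 0" if "B' \<in> insert B J" "x \<in> B'" for B' x
      using that f(3) \<open>\<forall>x\<in>B. q B x = 0\<close> by auto
    ultimately show ?case
      using rpf_times[OF f(1) \<open>real_polynomial_function (q B)\<close>] by blast
  qed
  from this[OF \<open>finite ?I\<close>] obtain f where
    f: "real_polynomial_function f" "f \<notin> vanishing Z" "\<forall>B\<in>?I. \<forall>x\<in>B. f x = 0" by blast
  have "f x = 0" if "x \<in> X" "x \<notin> Z" for x
    using that f(3) Union_irreducible_components[OF X] by blast
  then show ?thesis using that f by blast
qed

section \<open>Algebraic independence of coordinates\<close>

definition alg_independent :: "(real^'n \<Rightarrow> real) set \<Rightarrow> 'n set \<Rightarrow> bool" where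
  "alg_independent P S \<longleftrightarrow> polys_in S \<inter> P \<subseteq> {0}"

text \<open>Every further coordinate is algebraic over the coordinates \<open>S\<close> modulo \<open>P\<close>.\<close>

definition spanning_coords :: "(real^'n \<Rightarrow> real) set \<Rightarrow> 'n set \<Rightarrow> bool" where
  "spanning_coords P S \<longleftrightarrow> (\<forall>j. j \<notin> S \<longrightarrow> (\<exists>F. algebraic_relation (polys_in S) P (coord j) F))"

lemma algebraic_relation_mono:
  "A \<subseteq> B \<Longrightarrow> algebraic_relation A P y F \<Longrightarrow> algebraic_relation B P y F"
  unfolding algebraic_relation_def polys_over_def by blast

lemma alg_independent_antimono: "alg_independent Q S \<Longrightarrow> P \<subseteq> Q \<Longrightarrow> alg_independent P S"
  unfolding alg_independent_def by blast

lemma maximal_independent_spanning: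
  assumes S: "alg_independent P S" and max: "\<And>j. j \<notin> S \<Longrightarrow> \<not> alg_independent P (insert j S)"
  shows "spanning_coords P S"
  unfolding spanning_coords_def
proof (intro allI impI)
  fix j assume j: "j \<notin> S"
  obtain p where p: "p \<in> polys_in (insert j S)" "p \<in> P" "p \<noteq> 0"
    using max[OF j] unfolding alg_independent_def by blast
  obtain F where F: "F \<in> polys_over (polys_in S)" "p = poly F (coord j)"
    using p(1) unfolding polys_in_insert[OF j] adjoin_def by blast
  have "F \<noteq> 0" using F(2) p(3) by auto
  then have lc: "lead_coeff F \<notin> P"
    using S polys_overD[OF F(1), of "degree F"] unfolding alg_independent_def
    by (metis IntI leading_coeff_0_iff singletonD subsetD)
  moreover have "degree F \<ge> 1"
  proof (rule ccontr)
    assume "\<not> ?thesis"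
    then have "degree F = 0" by simp
    then obtain c where "F = [:c:]" by (rule degree_eq_zeroE)
    then show False using lc p(2) F(2) by simp
  qed
  ultimately show "\<exists>F. algebraic_relation (polys_in S) P (coord j) F"
    using F p(2) unfolding algebraic_relation_def by blast
qed

lemma extend_alg_independent:
  assumes "alg_independent P (S :: 'n::finite set)"
  obtains T where "S \<subseteq> T" "alg_independent P T" "spanning_coords P T"
proof -
  have "finite {T. alg_independent P T}" by simp
  moreover have "S \<in> {T. alg_independent P T}" using assms by simp
  ultimately obtain T where T: "alg_independent P T" "S \<subseteq> T"
    "\<And>U. alg_independent P U \<Longrightarrow> T \<subseteq> U \<Longrightarrow> T = U"
    using finite_has_maximal2[of "{T. alg_independent P T}" S] by auto
  have "\<not> alg_independent P (insert j T)" if "j \<notin> T" for j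
    using T(3)[of "insert j T"] that by blast
  from maximal_independent_spanning[OF T(1) this] show ?thesis using that T by blast
qed

lemma coord_polynomial: "coord j \<in> polynomials"
  by (simp add: coord_def rpf_coord)

lemma of_nat_mult_mem_iff:
  assumes P: "ideal_of_subring polynomials P" and n: "n \<ge> 1" and mem: "of_nat n * a \<in> P"
  shows "a \<in> P"
proof -
  interpret ideal_of_subring polynomials P by fact
  have "(\<lambda>x. 1 / real n) * (of_nat n * a) \<in> P"
    by (rule P_mult[OF _ mem]) (simp add: rpf_const)
  moreover have "(\<lambda>x. 1 / real n) * (of_nat n * a) = a"
    using n by (intro ext) simp
  ultimately show ?thesis by simp
qed

text \<open>Incomparability along the tower of all coordinates: if a transcendence basis \<open>S\<close> modulo \<open>P\<close> stays
  independent modulo a larger ideal \<open>Q\<close>, then \<open>Q\<close> cannot be larger.\<close>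

lemma ideal_eq_prime_if_independent:
  fixes S :: "'n::finite set"
  assumes P: "prime_of_subring polynomials P" and Q: "ideal_of_subring polynomials Q"
    and PQ: "P \<subseteq> Q" and span: "spanning_coords P S" and ind: "alg_independent Q S"
  shows "Q \<subseteq> P"
proof -
  interpret P: prime_of_subring polynomials P by fact
  have "Q \<inter> polys_in (S \<union> U) \<subseteq> P" if "U \<subseteq> - S" for U
    using finite[of U] that
  proof (induction U rule: finite_induct)
    case empty
    then show ?case using ind P.P_zero unfolding alg_independent_def by auto
  next
    case (insert j U)
    then have j: "j \<notin> S \<union> U" "j \<notin> S" by auto
    obtain G where "algebraic_relation (polys_in S) P (coord j) G"
      using span j(2) unfolding spanning_coords_def by blast
    then have "algebraic_relation (polys_in (S \<union> U)) P (coord j) G"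
      by (rule algebraic_relation_mono[rotated]) (rule polys_in_mono, simp)
    then obtain F where F: "minimal_relation (polys_in (S \<union> U)) P (coord j) F"
      using minimal_relation_exists by blast
    have "Q \<inter> adjoin (polys_in (S \<union> U)) (coord j) \<subseteq> P"
      using insert
      by (intro P.prime_tower_step[OF unital_subring_polys_in polys_in_polynomials
            coord_polynomial F Q PQ]) auto
    then show ?case using polys_in_insert[OF j(1)] by simp
  qed
  from this[of "- S"] show ?thesis
    using Q[THEN ideal_of_subring.P_sub] by (auto simp: Un_commute)
qed

section \<open>Generic tangent vectors\<close>

text \<open>The chain rule for a derivation that kills the coefficients.\<close>

lemma dderiv_poly_coeffs_zero:
  assumes F: "\<And>k. real_polynomial_function (coeff F k)" and y: "real_polynomial_function y"
    and d0: "\<And>k. dderiv (coeff F k) x v = 0"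
  shows "dderiv (poly F y) x v = poly (formal_deriv F) y x * dderiv y x v"
proof -
  have "dderiv (poly F y) x v = dderiv (\<Sum>k\<le>degree F. coeff F k * y ^ k) x v"
    by (simp only: poly_altdef)
  also have "\<dots> = (\<Sum>k\<le>degree F. dderiv (coeff F k * y ^ k) x v)"
    by (intro dderiv_sum rpf_times rpf_power F y)
  also have "\<dots> = (\<Sum>k\<le>degree F. of_nat k * coeff F k x * y x ^ (k - 1) * dderiv y x v)"
  proof (intro sum.cong refl)
    fix k
    show "dderiv (coeff F k * y ^ k) x v = of_nat k * coeff F k x * y x ^ (k - 1) * dderiv y x v"
      unfolding dderiv_times[OF F rpf_power[OF y]] dderiv_power[OF y] d0 by simp
  qed
  also have "\<dots> = poly (formal_deriv F) y x * dderiv y x v"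
    unfolding poly_formal_deriv sum_fun_apply sum_distrib_right
    by (intro sum.cong refl) (simp add: power_fun_apply)
  finally show ?thesis .
qed

lemma dderiv_poly_coeffs_vanish:
  assumes F: "\<And>k. real_polynomial_function (coeff F k)" and y: "real_polynomial_function y"
    and 0: "\<And>k. coeff F k x = 0" and d0: "\<And>k. dderiv (coeff F k) x v = 0"
  shows "dderiv (poly F y) x v = 0"
proof -
  have "poly (formal_deriv F) y x = 0"
    unfolding poly_formal_deriv sum_fun_apply using 0 by (intro sum.neutral) simp
  then show ?thesis using dderiv_poly_coeffs_zero[OF F y d0] by simp
qed

text \<open>A vector with prescribed components in the independent coordinates is extended to the other
  coordinates one at a time.  At the coordinate \<open>j\<close> the new component is dictated by the minimal
  relation \<open>F\<close> of that coordinate, provided that its derivative is nonzero; pseudo-division by \<open>F\<close>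
  shows that all other relations are then respected as well.  The polynomial \<open>\<delta>\<close> collects the
  denominators.\<close>

lemma generic_tangent_vectors:
  fixes Z :: "(real^'n) set"
  assumes P: "prime_of_subring polynomials (vanishing Z)"
    and ind: "alg_independent (vanishing Z) S" and span: "spanning_coords (vanishing Z) S"
  obtains \<delta> where "real_polynomial_function \<delta>" "\<delta> \<notin> vanishing Z"
    "\<And>x w. x \<in> Z \<Longrightarrow> \<delta> x \<noteq> 0 \<Longrightarrow>
       \<exists>v\<in>zariski_tangent_space Z x. \<forall>i\<in>S. v $ i = w $ i"
proof -
  let ?P = "vanishing Z"
  interpret P: prime_of_subring polynomials "vanishing Z" by fact
  have Z0: "p x = 0" if "p \<in> ?P" "x \<in> Z" for p x using that by (simp add: vanishing_def)
  have "\<exists>\<delta>. real_polynomial_function \<delta> \<and> \<delta> \<notin> ?P \<and>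
    (\<forall>x\<in>Z. \<delta> x \<noteq> 0 \<longrightarrow>
       (\<forall>w. \<exists>v. (\<forall>i\<in>S. v $ i = w $ i) \<and> (\<forall>p\<in>?P \<inter> polys_in (S \<union> U). dderiv p x v = 0)))"
    if "U \<subseteq> - S" for U
    using finite[of U] that
  proof (induction U rule: finite_induct)
    case empty
    have d0: "dderiv 0 x v = 0" for x v :: "real^'n"
      unfolding zero_fun_def by (rule dderiv_const)
    have "dderiv p x v = 0" if "p \<in> ?P \<inter> polys_in (S \<union> {})" for p and x v :: "real^'n"
    proof -
      have "p = 0" using that ind unfolding alg_independent_def by auto
      then show ?thesis using d0 by simp
    qed
    then show ?case using P.P_proper polynomials.one_closed unfolding polynomials_iff
      by (intro exI[of _ 1]) blast
  next
    case (insert j U)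
    then obtain \<delta> where \<delta>: "real_polynomial_function \<delta>" "\<delta> \<notin> ?P"
      "\<And>x w. x \<in> Z \<Longrightarrow> \<delta> x \<noteq> 0 \<Longrightarrow> \<exists>v. (\<forall>i\<in>S. v $ i = w $ i) \<and>
          (\<forall>p\<in>?P \<inter> polys_in (S \<union> U). dderiv p x v = 0)" by auto
    let ?A = "polys_in (S \<union> U)" and ?y = "coord j"
    interpret A: unital_subring ?A by (rule unital_subring_polys_in)
    have j: "j \<notin> S \<union> U" "j \<notin> S" using insert by auto
    have y: "real_polynomial_function ?y" using coord_polynomial by simp
    have A_rpf: "real_polynomial_function p" if "p \<in> ?A" for p
      using that by (simp add: polys_in_def)
    obtain G where "algebraic_relation (polys_in S) ?P ?y G"
      using span j(2) unfolding spanning_coords_def by blast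
    then have "algebraic_relation ?A ?P ?y G"
      by (rule algebraic_relation_mono[rotated]) (rule polys_in_mono, simp)
    then obtain F where F: "minimal_relation ?A ?P ?y F"
      using minimal_relation_exists by blast
    note Fctx = unital_subring_polys_in polys_in_polynomials coord_polynomial F
    note F_rel = P.minimal_relationD[OF Fctx]
    have lc_rpf: "real_polynomial_function (lead_coeff F)"
      using polys_overD[OF F_rel(1)] A_rpf by blast
    define F' where "F' = poly (formal_deriv F) ?y"
    have F'P: "F' \<notin> ?P"
      unfolding F'_def using of_nat_mult_mem_iff[OF P.ideal_of_subring_axioms]
      by (intro P.minimal_relation_formal_deriv[OF Fctx]) blast
    have F'_rpf: "real_polynomial_function F'"
    proof -
      have "real_polynomial_function (of_nat k * coeff F k * ?y ^ (k - 1))" for k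
        using A_rpf[OF polys_overD[OF F_rel(1)]] y
        by (intro rpf_times rpf_power) (auto simp: of_nat_fun intro: rpf_const)
      then show ?thesis
        unfolding F'_def poly_formal_deriv
        by (rule polynomials.sum_closed[unfolded polynomials_iff])
    qed
    define \<epsilon> where "\<epsilon> = \<delta> * (lead_coeff F * F')"
    have "\<epsilon> \<notin> ?P"
      unfolding \<epsilon>_def using P.P_prime \<delta>(1,2) F_rel(3) F'P lc_rpf F'_rpf rpf_times
      unfolding polynomials_iff by metis
    moreover have "real_polynomial_function \<epsilon>"
      unfolding \<epsilon>_def by (intro rpf_times \<delta> lc_rpf F'_rpf)
    moreover have "\<exists>v. (\<forall>i\<in>S. v $ i = w $ i) \<and>
        (\<forall>p\<in>?P \<inter> polys_in (S \<union> insert j U). dderiv p x v = 0)"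
      if x: "x \<in> Z" "\<epsilon> x \<noteq> 0" for x w
    proof -
      have nz: "\<delta> x \<noteq> 0" "lead_coeff F x \<noteq> 0" "F' x \<noteq> 0" using x(2) by (auto simp: \<epsilon>_def)
      obtain u where u: "\<forall>i\<in>S. u $ i = w $ i" "\<forall>p\<in>?P \<inter> ?A. dderiv p x u = 0"
        using \<delta>(3)[OF x(1) nz(1)] by blast
      let ?e = "axis j 1 :: real^'n"
      have F_rpf: "real_polynomial_function (poly H ?y)" if "H \<in> polys_over ?A" for H
        using A.poly_closed[OF polynomials.unital_subring_axioms polys_in_polynomials coord_polynomial that]
        by simp
      \<comment> \<open>The component for which the derivative of the minimal relation vanishes.\<close>
      define t where "t = - dderiv (poly F ?y) x u / F' x"
      define v where "v = u + t *\<^sub>R ?e"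
      have dv: "dderiv p x v = dderiv p x u + t * dderiv p x ?e"
        if "real_polynomial_function p" for p
        unfolding v_def using linear_add[OF linear_dderiv[OF that]]
          linear_scale[OF linear_dderiv[OF that]] by simp
      have A_e: "dderiv p x ?e = 0" if "p \<in> ?A" for p
      proof -
        have "dderiv p x ?e = dderiv p x 0"
          using j(1) by (intro dderiv_polys_in_cong[OF that]) (auto simp: axis_def)
        also have "\<dots> = 0" using linear_0[OF linear_dderiv[OF A_rpf[OF that]]] .
        finally show ?thesis .
      qed
      have A_v: "dderiv p x v = dderiv p x u" if "p \<in> ?A" for p
        using dv[OF A_rpf[OF that]] A_e[OF that] by simp
      have "dderiv (poly F ?y) x ?e = F' x * dderiv ?y x ?e"
        unfolding F'_def
        by (intro dderiv_poly_coeffs_zero A_rpf[OF polys_overD[OF F_rel(1)]] y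
            A_e[OF polys_overD[OF F_rel(1)]])
      then have dFv: "dderiv (poly F ?y) x v = 0"
        unfolding dv[OF F_rpf[OF F_rel(1)]] t_def using nz(3) by (simp add: dderiv_coord)
      have "dderiv p x v = 0" if p: "p \<in> ?P" "p \<in> polys_in (S \<union> insert j U)" for p
      proof -
        have "p \<in> adjoin ?A ?y" using p(2) polys_in_insert[OF j(1)] by simp
        then obtain H where H: "H \<in> polys_over ?A" "p = poly H ?y" unfolding adjoin_def by blast
        obtain q r n where q: "q \<in> polys_over ?A" "r \<in> polys_over ?A"
          "smult (lead_coeff F ^ n) H = q * F + r" "degree r < degree F"
          using A.pseudo_division[OF F_rel(1,2) H(1)] by blast
        define c where "c = lead_coeff F ^ n"
        have c: "real_polynomial_function c" "c x \<noteq> 0"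
          unfolding c_def using rpf_power[OF lc_rpf] nz(2) by (auto simp: power_fun_apply)
        have eq: "c * p = poly q ?y * poly F ?y + poly r ?y"
          using arg_cong[OF q(3), of "\<lambda>h. poly h ?y"] H(2) by (simp add: c_def)
        have "poly r ?y = c * p - poly q ?y * poly F ?y" using eq by simp
        moreover have "c * p - poly q ?y * poly F ?y \<in> ?P"
          using p(1) F_rel(4) c(1) F_rpf[OF q(1)] by (intro P.P_diff P.P_mult) auto
        ultimately have "poly r ?y \<in> ?P" by simp
        then have rk: "coeff r k \<in> ?P" for k
          using P.minimal_relation_low_degree[OF Fctx q(2,4)] by blast
        have "dderiv (poly r ?y) x v = 0"
          using u(2) rk polys_overD[OF q(2)] A_v Z0[OF _ x(1)]
          by (intro dderiv_poly_coeffs_vanish A_rpf y) auto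
        moreover have "dderiv (poly q ?y * poly F ?y) x v = 0"
          unfolding dderiv_times[OF F_rpf[OF q(1)] F_rpf[OF F_rel(1)]] dFv Z0[OF F_rel(4) x(1)]
          by simp
        ultimately have "dderiv (c * p) x v = 0"
          unfolding eq by (subst dderiv_plus) (auto intro!: rpf_times F_rpf q F_rel)
        moreover have "dderiv (c * p) x v = c x * dderiv p x v"
          using p(1) Z0[OF p(1) x(1)] c(1) by (subst dderiv_times) (auto simp: vanishing_def)
        ultimately show ?thesis using c(2) by simp
      qed
      moreover have "\<forall>i\<in>S. v $ i = w $ i"
        using u(1) j(2) by (auto simp: v_def axis_def)
      ultimately show ?thesis by blast
    qed
    ultimately show ?case by blast
  qed
  from this[of "- S"] obtain \<delta> where \<delta>: "real_polynomial_function \<delta>" "\<delta> \<notin> ?P"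
    "\<forall>x\<in>Z. \<delta> x \<noteq> 0 \<longrightarrow>
       (\<forall>w. \<exists>v. (\<forall>i\<in>S. v $ i = w $ i) \<and> (\<forall>p\<in>?P \<inter> polys_in UNIV. dderiv p x v = 0))"
    by (auto simp: Compl_partition)
  show ?thesis
  proof (rule that[OF \<delta>(1,2)])
    fix x w assume "x \<in> Z" "\<delta> x \<noteq> 0"
    then obtain v where v: "\<forall>i\<in>S. v $ i = w $ i" "\<forall>p\<in>?P \<inter> polys_in UNIV. dderiv p x v = 0"
      using \<delta>(3) by blast
    have "v \<in> zariski_tangent_space Z x"
      using v(2) unfolding zariski_tangent_space_def vanishing_def polys_in_UNIV by auto
    then show "\<exists>v\<in>zariski_tangent_space Z x. \<forall>i\<in>S. v $ i = w $ i" using v(1) by blast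
  qed
qed

lemma subspace_zariski_tangent_space: "subspace (zariski_tangent_space Z x)"
proof -
  have lin: "linear (dderiv p x)" if "real_polynomial_function p" for p :: "real^'a \<Rightarrow> real"
    by (rule linear_dderiv[OF that])
  show ?thesis
    unfolding subspace_def zariski_tangent_space_def
    by (auto simp: lin[THEN linear_0] lin[THEN linear_add] lin[THEN linear_scale])
qed

lemma linear_coord_proj: "linear (coord_proj T)"
  by (rule linearI) (auto simp: vec_eq_iff)

lemma dim_coord_subspace: "dim {w :: real^'n. \<forall>i. i \<notin> S \<longrightarrow> w $ i = 0} = card S"
  using dim_substandard_cart[where 'a=real, of S] by (simp add: dim_vec_eq)

lemma card_le_dim_if_coords_free:
  fixes L :: "(real^'n) set"
  assumes "\<And>w. \<exists>v\<in>L. \<forall>i\<in>S. v $ i = w $ i"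
  shows "card S \<le> dim L"
proof -
  have "{w :: real^'n. \<forall>i. i \<notin> S \<longrightarrow> w $ i = 0} \<subseteq> coord_proj S ` L"
  proof
    fix w :: "real^'n" assume w: "w \<in> {w. \<forall>i. i \<notin> S \<longrightarrow> w $ i = 0}"
    obtain v where v: "v \<in> L" "\<forall>i\<in>S. v $ i = w $ i" using assms by blast
    then have "w = coord_proj S v" using w by (auto simp: vec_eq_iff)
    then show "w \<in> coord_proj S ` L" using v by blast
  qed
  from dim_subset[OF this] have "card S \<le> dim (coord_proj S ` L)" by (simp add: dim_coord_subspace)
  also have "\<dots> \<le> dim L" by (rule dim_image_le[OF linear_coord_proj])
  finally show ?thesis .
qed

lemma dim_le_card_if_coords_determine:
  fixes L :: "(real^'n) set"
  assumes "subspace L" "\<And>v. v \<in> L \<Longrightarrow> (\<forall>i\<in>S. v $ i = 0) \<Longrightarrow> v = 0"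
  shows "dim L \<le> card S"
proof -
  have "inj_on (coord_proj S) L"
  proof (rule inj_onI)
    fix u v assume uv: "u \<in> L" "v \<in> L" "coord_proj S u = coord_proj S v"
    have "\<forall>i\<in>S. (u - v) $ i = 0"
    proof
      fix i assume "i \<in> S"
      then show "(u - v) $ i = 0" using arg_cong[OF uv(3), of "\<lambda>z. z $ i"] by simp
    qed
    then show "u = v" using assms uv subspace_diff by (metis eq_iff_diff_eq_0)
  qed
  then have "dim (coord_proj S ` L) = dim L"
    using assms(1) by (intro dim_image_eq linear_coord_proj) (simp add: span_eq_iff[THEN iffD2])
  moreover have "dim (coord_proj S ` L) \<le> dim {w :: real^'n. \<forall>i. i \<notin> S \<longrightarrow> w $ i = 0}"
    by (intro dim_subset) auto
  ultimately show ?thesis by (simp add: dim_coord_subspace)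
qed

section \<open>Charts at points of minimal tangent dimension\<close>

lemma tangent_spaceD: "v \<in> zariski_tangent_space Z x \<Longrightarrow> p \<in> vanishing Z \<Longrightarrow> dderiv p x v = 0"
  by (auto simp: zariski_tangent_space_def vanishing_def)

lemma tangent_spaceI: "(\<And>p. p \<in> vanishing Z \<Longrightarrow> dderiv p x v = 0) \<Longrightarrow> v \<in> zariski_tangent_space Z x"
  by (auto simp: zariski_tangent_space_def vanishing_def)

lemma dderiv_expand:
  assumes "real_polynomial_function p"
  shows "dderiv p x v = (\<Sum>i\<in>UNIV. v $ i * dderiv p x (axis i 1))"
  by (rule linear_functional_expand[OF linear_dderiv[OF assms]])

text \<open>A maximal set \<open>E\<close> of coordinates such that no nonzero differential of an element of the ideal is
  supported in \<open>E\<close>.  By maximality, each \<open>j\<close> outside \<open>E\<close> has an element of the ideal whose differential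
  is the differential of the \<open>j\<close>-th coordinate up to terms in \<open>E\<close>; so tangent vectors are the graph
  of a linear function of their \<open>E\<close>-components.\<close>

lemma tangent_coordinates:
  fixes Z :: "(real^'n) set"
  obtains E f where "card E = dim (zariski_tangent_space Z x)"
    "\<And>j. j \<notin> E \<Longrightarrow> f j \<in> vanishing Z"
    "\<And>j v. j \<notin> E \<Longrightarrow> (\<forall>i\<in>E. v $ i = 0) \<Longrightarrow> dderiv (f j) x v = v $ j"
proof -
  let ?P = "vanishing Z" and ?T = "zariski_tangent_space Z x"
  interpret P: ideal_of_subring polynomials "vanishing Z" by (rule ideal_vanishing)
  have Pr: "real_polynomial_function p" if "p \<in> ?P" for p using that by (simp add: vanishing_def)
  define good where "good E \<longleftrightarrow> (\<forall>p\<in>?P. (\<forall>i. i \<notin> E \<longrightarrow> dderiv p x (axis i 1) = 0) \<longrightarrow>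
      (\<forall>i. dderiv p x (axis i 1) = 0))" for E
  have "{} \<in> {E. good E}" by (simp add: good_def)
  then obtain E where E: "good E" "\<And>F. good F \<Longrightarrow> E \<subseteq> F \<Longrightarrow> E = F"
    using finite_has_maximal2[of "{E. good E}" "{}"] by auto
  have "\<exists>f. f \<in> ?P \<and> (\<forall>v. (\<forall>i\<in>E. v $ i = 0) \<longrightarrow> dderiv f x v = v $ j)" if j: "j \<notin> E" for j
  proof -
    have "\<not> good (insert j E)" using E(2)[of "insert j E"] j by blast
    then obtain p k where p: "p \<in> ?P" "\<forall>i. i \<notin> insert j E \<longrightarrow> dderiv p x (axis i 1) = 0"
      "dderiv p x (axis k 1) \<noteq> 0" unfolding good_def by blast
    define c where "c = dderiv p x (axis j 1)"
    have "c \<noteq> 0"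
    proof
      assume "c = 0"
      then have "\<forall>i. i \<notin> E \<longrightarrow> dderiv p x (axis i 1) = 0" using p(2) unfolding c_def by auto
      then show False using E(1) p(1,3) unfolding good_def by blast
    qed
    have cP: "(\<lambda>_. 1 / c) * p \<in> ?P" by (rule P.P_mult[OF _ p(1)]) (simp add: rpf_const)
    have "dderiv ((\<lambda>_. 1 / c) * p) x v = v $ j" if v: "\<forall>i\<in>E. v $ i = 0" for v
    proof -
      have "dderiv p x v = (\<Sum>i\<in>UNIV. v $ i * dderiv p x (axis i 1))"
        by (rule dderiv_expand[OF Pr[OF p(1)]])
      also have "\<dots> = (\<Sum>i\<in>UNIV. if i = j then v $ j * c else 0)"
        using p(2) v by (intro sum.cong refl) (auto simp: c_def)
      finally have "dderiv p x v = v $ j * c" by simp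
      then show ?thesis
        unfolding dderiv_times[OF rpf_const Pr[OF p(1)]] dderiv_const using \<open>c \<noteq> 0\<close> by simp
    qed
    then show ?thesis using cP by blast
  qed
  then have "\<forall>j. \<exists>f. j \<notin> E \<longrightarrow> f \<in> ?P \<and> (\<forall>v. (\<forall>i\<in>E. v $ i = 0) \<longrightarrow> dderiv f x v = v $ j)"
    by blast
  from choice[OF this] obtain f where
    f: "\<forall>j. j \<notin> E \<longrightarrow> f j \<in> ?P \<and> (\<forall>v. (\<forall>i\<in>E. v $ i = 0) \<longrightarrow> dderiv (f j) x v = v $ j)" ..
  have fP: "f j \<in> ?P" if "j \<notin> E" for j using f that by blast
  have fv: "dderiv (f j) x v = v $ j" if "j \<notin> E" "\<forall>i\<in>E. v $ i = 0" for j v using f that by blast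
  have "dim ?T \<le> card E"
  proof (rule dim_le_card_if_coords_determine[OF subspace_zariski_tangent_space])
    fix v assume v: "v \<in> ?T" "\<forall>i\<in>E. v $ i = 0"
    have "v $ j = 0" for j
      using v fv[of j v] tangent_spaceD[OF v(1) fP[of j]] by (cases "j \<in> E") auto
    then show "v = 0" by (simp add: vec_eq_iff)
  qed
  moreover have "card E \<le> dim ?T"
  proof (rule card_le_dim_if_coords_free)
    fix w :: "real^'n"
    define w0 where "w0 = coord_proj E w"
    define v where "v = (\<chi> j. if j \<in> E then w $ j else - dderiv (f j) x w0)"
    have fj0: "dderiv (f j) x v = 0" if j: "j \<notin> E" for j
    proof -
      have "dderiv (f j) x (w0 + (v - w0)) = dderiv (f j) x w0 + dderiv (f j) x (v - w0)"
        by (rule linear_add[OF linear_dderiv[OF Pr[OF fP[OF j]]]])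
      also have "dderiv (f j) x (v - w0) = (v - w0) $ j"
        by (rule fv[OF j]) (simp add: v_def w0_def)
      finally show ?thesis using j by (simp add: v_def w0_def)
    qed
    have "v \<in> ?T"
    proof (rule tangent_spaceI)
      fix p assume p: "p \<in> ?P"
      \<comment> \<open>Subtracting \<open>h\<close> from \<open>p\<close> leaves a differential supported in \<open>E\<close>, which is zero.\<close>
      define h where "h = (\<Sum>j\<in>- E. (\<lambda>_. dderiv p x (axis j 1)) * f j)"
      have h: "h \<in> ?P"
        unfolding h_def using fP by (intro P.P_sum P.P_mult) (auto intro: rpf_const)
      have dh: "dderiv h x u = (\<Sum>j\<in>- E. dderiv p x (axis j 1) * dderiv (f j) x u)" for u
      proof -
        have "dderiv h x u = (\<Sum>j\<in>- E. dderiv ((\<lambda>_. dderiv p x (axis j 1)) * f j) x u)"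
          unfolding h_def using Pr fP by (intro dderiv_sum rpf_times rpf_const) auto
        also have "\<dots> = (\<Sum>j\<in>- E. dderiv p x (axis j 1) * dderiv (f j) x u)"
        proof (intro sum.cong refl)
          fix j assume "j \<in> - E"
          then have "real_polynomial_function (f j)" using Pr fP by simp
          then show "dderiv ((\<lambda>_. dderiv p x (axis j 1)) * f j) x u =
              dderiv p x (axis j 1) * dderiv (f j) x u"
            unfolding dderiv_times[OF rpf_const \<open>real_polynomial_function (f j)\<close>] dderiv_const by simp
        qed
        finally show ?thesis .
      qed
      define q where "q = p - h"
      have q: "q \<in> ?P" unfolding q_def by (rule P.P_diff[OF p h])
      have "p = q + h" by (simp add: q_def)
      then have dp: "dderiv p x u = dderiv q x u + dderiv h x u" for u
        using dderiv_plus[OF Pr[OF q] Pr[OF h]] by metis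
      have "dderiv q x (axis i 1) = 0" if i: "i \<notin> E" for i
      proof -
        have "dderiv h x (axis i 1) = (\<Sum>j\<in>- E. if j = i then dderiv p x (axis i 1) else 0)"
          unfolding dh
        proof (intro sum.cong refl)
          fix j assume "j \<in> - E"
          then have "dderiv (f j) x (axis i 1) = axis i 1 $ j"
            using i by (intro fv) (auto simp: axis_def)
          then show "dderiv p x (axis j 1) * dderiv (f j) x (axis i 1) =
              (if j = i then dderiv p x (axis i 1) else 0)" by (simp add: axis_def)
        qed
        then show ?thesis using i dp[of "axis i 1"] by simp
      qed
      then have "\<forall>i. dderiv q x (axis i 1) = 0" using E(1) q unfolding good_def by blast
      then have "(\<Sum>i\<in>UNIV. v $ i * dderiv q x (axis i 1)) = 0" by simp
      then have "dderiv q x v = 0" unfolding dderiv_expand[OF Pr[OF q], of x v] .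
      moreover have "dderiv h x v = 0" unfolding dh using fj0 by (intro sum.neutral) simp
      ultimately show "dderiv p x v = 0" using dp by simp
    qed
    then show "\<exists>v\<in>?T. \<forall>i\<in>E. v $ i = w $ i" by (intro bexI[of _ v]) (auto simp: v_def)
  qed
  ultimately have "card E = dim ?T" by simp
  from that[OF this fP fv] show ?thesis by blast
qed

text \<open>Multiply by the integrating factor \<open>exp (- K * s)\<close>.\<close>

lemma gronwall_zero:
  fixes N :: "real \<Rightarrow> real"
  assumes deriv: "\<And>s. 0 \<le> s \<Longrightarrow> s \<le> 1 \<Longrightarrow> (N has_real_derivative N' s) (at s)"
    and le: "\<And>s. 0 \<le> s \<Longrightarrow> s \<le> 1 \<Longrightarrow> N' s \<le> K * N s"
    and nonneg: "N 1 \<ge> 0" and init: "N 0 = 0"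
  shows "N 1 = 0"
proof -
  have "N 1 * exp (- K * 1) \<le> N 0 * exp (- K * 0)"
  proof (rule DERIV_nonpos_imp_nonincreasing[of 0 1])
    fix s :: real assume s: "0 \<le> s" "s \<le> 1"
    have "((\<lambda>s. N s * exp (- K * s)) has_real_derivative
        (N' s * exp (- K * s) + N s * (exp (- K * s) * (- K)))) (at s)"
      by (auto intro!: derivative_eq_intros deriv s)
    moreover have "N' s * exp (- K * s) + N s * (exp (- K * s) * (- K)) = (N' s - K * N s) * exp (- K * s)"
      by (simp add: algebra_simps)
    moreover have "(N' s - K * N s) * exp (- K * s) \<le> 0"
      using le[OF s] by (intro mult_nonpos_nonneg) auto
    ultimately show "\<exists>y. ((\<lambda>s. N s * exp (- K * s)) has_real_derivative y) (at s) \<and> y \<le> 0" by metis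
  qed simp
  then have "N 1 \<le> 0" using init by (simp add: mult_le_0_iff)
  then show ?thesis using nonneg by simp
qed

text \<open>The functions \<open>f j\<close>, together with the coordinates in \<open>E\<close>, form a chart of the ambient space at
  \<open>x\<close>; \<open>Z\<close> lies in the slice on which all \<open>f j\<close> vanish.  The aim is to show that near \<open>x\<close> it fills
  that slice.\<close>

locale tangent_chart =
  fixes Z :: "(real^'n) set" and x :: "real^'n" and E :: "'n set" and f :: "'n \<Rightarrow> real^'n \<Rightarrow> real"
  assumes algZ: "real_algebraic_set Z" and xZ: "x \<in> Z"
    and minimal: "\<And>z. z \<in> Z \<Longrightarrow> dim (zariski_tangent_space Z x) \<le> dim (zariski_tangent_space Z z)"
    and card_E: "card E = dim (zariski_tangent_space Z x)"
    and fP: "\<And>j. j \<notin> E \<Longrightarrow> f j \<in> vanishing Z"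
    and f_x: "\<And>j v. j \<notin> E \<Longrightarrow> (\<forall>i\<in>E. v $ i = 0) \<Longrightarrow> dderiv (f j) x v = v $ j"
begin

definition chart :: "real^'n \<Rightarrow> real^'n" where
  "chart z = (\<chi> j. if j \<in> E then z $ j else f j z)"

definition chart_deriv :: "real^'n \<Rightarrow> real^'n \<Rightarrow> real^'n" where
  "chart_deriv z v = (\<chi> j. if j \<in> E then v $ j else dderiv (f j) z v)"

definition jacobian :: "real^'n \<Rightarrow> real^'n^'n" where
  "jacobian z = matrix (chart_deriv z)"

text \<open>By Cramer's rule this is the polynomial vector field \<open>det (jacobian z) *\<^sub>R v\<close>, where \<open>v\<close> solves
  \<open>chart_deriv z v = w\<close>.\<close>

definition cramer_field :: "real^'n \<Rightarrow> real^'n \<Rightarrow> real^'n" where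
  "cramer_field w z = (\<chi> k. det (\<chi> i j. if j = k then w $ i else jacobian z $ i $ j))"

lemma f_rpf: "j \<notin> E \<Longrightarrow> real_polynomial_function (f j)"
  using fP by (auto simp: vanishing_def)

lemma linear_chart_deriv: "linear (chart_deriv z)"
proof (rule linearI)
  show "chart_deriv z (u + v) = chart_deriv z u + chart_deriv z v" for u v
    unfolding chart_deriv_def vec_eq_iff
    using linear_add[OF linear_dderiv[OF f_rpf]] by simp
  show "chart_deriv z (c *\<^sub>R u) = c *\<^sub>R chart_deriv z u" for c u
    unfolding chart_deriv_def vec_eq_iff
    using linear_scale[OF linear_dderiv[OF f_rpf]] by simp
qed

lemma jacobian_mult: "jacobian z *v v = chart_deriv z v"
  unfolding jacobian_def using matrix_vector_mul(2)[OF linear_chart_deriv] by metis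

lemma jacobian_nth: "jacobian z $ i $ j = chart_deriv z (axis j 1) $ i"
  by (simp add: jacobian_def matrix_def)

lemma jacobian_rpf: "real_polynomial_function (\<lambda>z. jacobian z $ i $ j)"
  unfolding jacobian_nth chart_deriv_def
  by (cases "i \<in> E") (auto intro: rpf_const rpf_dderiv[OF f_rpf])

lemma rpf_det:
  fixes M :: "real^'n \<Rightarrow> real^'n^'n"
  assumes "\<And>i j. real_polynomial_function (\<lambda>z. M z $ i $ j)"
  shows "real_polynomial_function (\<lambda>z. det (M z))"
  unfolding det_def
  by (intro real_polynomial_function_sum rpf_mult rpf_const real_polynomial_function_prod assms)
     (auto intro: finite_permutations)

lemma det_jacobian_rpf: "real_polynomial_function (\<lambda>z. det (jacobian z))"
  by (rule rpf_det[OF jacobian_rpf])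

lemma cramer_field_polynomial: "polynomial_function (cramer_field w)"
proof (rule polynomial_function_vecI)
  fix k
  have "real_polynomial_function (\<lambda>z. (\<chi> i j. if j = k then w $ i else jacobian z $ i $ j) $ i $ j)" for i j
    by (cases "j = k") (auto intro: rpf_const jacobian_rpf)
  then show "real_polynomial_function (\<lambda>z. cramer_field w z $ k)"
    unfolding cramer_field_def by (auto intro: rpf_det)
qed

lemma det_nz_chart_deriv_inj: "det (jacobian z) \<noteq> 0 \<Longrightarrow> chart_deriv z v = 0 \<Longrightarrow> v = 0"
  using matrix_left_invertible_ker[of "jacobian z"] invertible_left_inverse[of "jacobian z"]
    invertible_det_nz[of "jacobian z"] by (simp add: jacobian_mult)

lemma det_jacobian_x: "det (jacobian x) \<noteq> 0"
proof -
  have "v = 0" if "chart_deriv x v = 0" for v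
  proof -
    have c: "(if j \<in> E then v $ j else dderiv (f j) x v) = 0" for j
      using that by (simp add: chart_deriv_def vec_eq_iff)
    then have "\<forall>i\<in>E. v $ i = 0" by (metis (full_types))
    then have "v $ j = 0" for j using c[of j] f_x[of j v] by (cases "j \<in> E") auto
    then show ?thesis by (simp add: vec_eq_iff)
  qed
  then show ?thesis
    using matrix_left_invertible_ker[of "jacobian x"] invertible_left_inverse[of "jacobian x"]
      invertible_det_nz[of "jacobian x"] by (simp add: jacobian_mult)
qed

lemma cramer_field_solves:
  assumes "det (jacobian z) \<noteq> 0" "chart_deriv z v = w"
  shows "cramer_field w z = det (jacobian z) *\<^sub>R v"
proof -
  have "jacobian z *v v = w" using assms(2) by (simp add: jacobian_mult)
  then have "v = (\<chi> k. det (\<chi> i j. if j = k then w $ i else jacobian z $ i $ j) / det (jacobian z))"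
    by (rule iffD1[OF cramer[OF assms(1)]])
  then have "v $ k = det (\<chi> i j. if j = k then w $ i else jacobian z $ i $ j) / det (jacobian z)" for k
    by (metis (no_types, lifting) vec_lambda_beta)
  then show ?thesis
    unfolding cramer_field_def vec_eq_iff using assms(1) by (simp del: vec_lambda_unique)
qed

lemma tangent_dim_eq:
  assumes z: "z \<in> Z" "det (jacobian z) \<noteq> 0"
  shows "dim (zariski_tangent_space Z z) = dim (zariski_tangent_space Z x)"
proof (rule antisym)
  have "dim (zariski_tangent_space Z z) \<le> card E"
  proof (rule dim_le_card_if_coords_determine[OF subspace_zariski_tangent_space])
    fix v assume v: "v \<in> zariski_tangent_space Z z" "\<forall>i\<in>E. v $ i = 0"
    have "chart_deriv z v = 0"
      unfolding chart_deriv_def vec_eq_iff using v(2) tangent_spaceD[OF v(1) fP] by simp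
    then show "v = 0" by (rule det_nz_chart_deriv_inj[OF z(2)])
  qed
  then show "dim (zariski_tangent_space Z z) \<le> dim (zariski_tangent_space Z x)" by (simp add: card_E)
qed (rule minimal[OF z(1)])

text \<open>The kernel of the differentials of the \<open>f j\<close> contains the tangent space of \<open>Z\<close>, and both have
  dimension \<open>card E\<close>, because the tangent dimension at \<open>x\<close> is minimal.\<close>

lemma chart_deriv_tangent:
  assumes z: "z \<in> Z" "det (jacobian z) \<noteq> 0" and w: "\<And>i. i \<notin> E \<Longrightarrow> w $ i = 0"
    and v: "chart_deriv z v = w"
  shows "v \<in> zariski_tangent_space Z z"
proof -
  let ?T = "zariski_tangent_space Z z" and ?S = "{w :: real^'n. \<forall>i. i \<notin> E \<longrightarrow> w $ i = 0}"
  have inj: "inj (chart_deriv z)"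
    using det_nz_chart_deriv_inj[OF z(2)] linear_chart_deriv[of z]
    by (simp add: linear_injective_0)
  have "chart_deriv z ` ?T \<subseteq> ?S"
    using tangent_spaceD[OF _ fP] by (auto simp: chart_deriv_def)
  moreover have "dim (chart_deriv z ` ?T) = dim ?T"
    by (rule dim_image_eq[OF linear_chart_deriv]) (use inj in \<open>auto intro: inj_on_subset\<close>)
  moreover have "dim ?T = dim ?S"
    using tangent_dim_eq[OF z] card_E dim_coord_subspace[of E] by simp
  moreover have "subspace (chart_deriv z ` ?T)"
    by (rule linear_subspace_image[OF linear_chart_deriv subspace_zariski_tangent_space])
  moreover have "subspace ?S" by (auto simp: subspace_def)
  ultimately have "chart_deriv z ` ?T = ?S"
    by (intro subspace_dim_equal) auto
  then obtain u where "u \<in> ?T" "chart_deriv z u = w" using w by (auto simp: set_eq_iff image_iff) metis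
  then show ?thesis using v inj by (metis injD)
qed

text \<open>The Cramer fields are tangent to \<open>Z\<close> wherever the determinant is nonzero; the factor
  \<open>det (jacobian z)\<close> takes care of the other points of \<open>Z\<close>.\<close>

lemma cramer_field_preserves_vanishing:
  assumes p: "p \<in> vanishing Z" and w: "\<And>i. i \<notin> E \<Longrightarrow> w $ i = 0"
  shows "(\<lambda>z. det (jacobian z) * dderiv p z (cramer_field w z)) \<in> vanishing Z"
proof -
  have pr: "real_polynomial_function p" using p by (simp add: vanishing_def)
  have "det (jacobian z) * dderiv p z (cramer_field w z) = 0" if z: "z \<in> Z" for z
  proof (cases "det (jacobian z) = 0")
    case False
    have "surj (chart_deriv z)"
      using det_nz_chart_deriv_inj[OF False] linear_chart_deriv[of z]
      by (intro linear_injective_imp_surjective) (simp_all add: linear_injective_0)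
    then obtain v where v: "chart_deriv z v = w" by (metis surjD)
    have "dderiv p z v = 0"
      by (rule tangent_spaceD[OF chart_deriv_tangent[OF z False w v] p])
    then have "dderiv p z (cramer_field w z) = 0"
      unfolding cramer_field_solves[OF False v] linear_scale[OF linear_dderiv[OF pr]] by simp
    then show ?thesis by simp
  qed simp
  moreover have "real_polynomial_function (\<lambda>z. det (jacobian z) * dderiv p z (cramer_field w z))"
    by (intro rpf_mult det_jacobian_rpf rpf_dderiv pr cramer_field_polynomial)
  ultimately show ?thesis by (simp add: vanishing_def)
qed

text \<open>Let \<open>G\<close> be a finite set of generators of the ideal of \<open>Z\<close>.  The derivatives of the functions in
  \<open>G\<close> along the path are linear combinations of these functions with bounded coefficients, so the
  sum of their squares satisfies a Gronwall inequality.\<close>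

lemma path_stays_in_Z:
  fixes \<gamma> :: "real \<Rightarrow> real^'n"
  assumes w: "\<And>i. i \<notin> E \<Longrightarrow> w $ i = 0"
    and start: "\<gamma> 0 = x"
    and nz: "\<And>s. 0 \<le> s \<Longrightarrow> s \<le> 1 \<Longrightarrow> det (jacobian (\<gamma> s)) \<noteq> 0"
    and deriv: "\<And>s. 0 \<le> s \<Longrightarrow> s \<le> 1 \<Longrightarrow> (\<gamma> has_vector_derivative v s) (at s)"
    and chart_v: "\<And>s. 0 \<le> s \<Longrightarrow> s \<le> 1 \<Longrightarrow> chart_deriv (\<gamma> s) (v s) = w"
  shows "\<gamma> 1 \<in> Z"
proof -
  obtain G where G: "finite G" "G \<subseteq> vanishing Z" "vanishing Z \<subseteq> linear_hull polynomials G"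
    by (rule vanishing_generators)
  have Gr: "real_polynomial_function p" if "p \<in> G" for p using G(2) that by (auto simp: vanishing_def)
  have "\<exists>a. (\<forall>r. real_polynomial_function (a r)) \<and>
      (\<lambda>z. det (jacobian z) * dderiv p z (cramer_field w z)) = (\<Sum>r\<in>G. a r * r)" if "p \<in> G" for p
  proof -
    have "(\<lambda>z. det (jacobian z) * dderiv p z (cramer_field w z)) \<in> vanishing Z"
      using that G(2) w by (intro cramer_field_preserves_vanishing) auto
    then have "(\<lambda>z. det (jacobian z) * dderiv p z (cramer_field w z)) \<in> linear_hull polynomials ((\<lambda>r. r) ` G)"
      using G(3) by auto
    from polynomials.linear_hull_finite_sumE[OF this G(1)] obtain c where
      c: "\<And>r. c r \<in> polynomials"
        "(\<lambda>z. det (jacobian z) * dderiv p z (cramer_field w z)) = (\<Sum>r\<in>G. c r * r)"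
      by blast
    then show ?thesis unfolding polynomials_iff by blast
  qed
  then have "\<forall>p. \<exists>a. p \<in> G \<longrightarrow> (\<forall>r. real_polynomial_function (a r)) \<and>
      (\<lambda>z. det (jacobian z) * dderiv p z (cramer_field w z)) = (\<Sum>r\<in>G. a r * r)" by blast
  from choice[OF this] obtain a where a: "\<forall>p. p \<in> G \<longrightarrow> (\<forall>r. real_polynomial_function (a p r)) \<and>
      (\<lambda>z. det (jacobian z) * dderiv p z (cramer_field w z)) = (\<Sum>r\<in>G. a p r * r)" ..
  define D where "D s = det (jacobian (\<gamma> s))" for s
  have key: "D s * D s * dderiv p (\<gamma> s) (v s) = (\<Sum>r\<in>G. a p r (\<gamma> s) * r (\<gamma> s))"
    if p: "p \<in> G" and s: "0 \<le> s" "s \<le> 1" for p s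
  proof -
    have "D s * dderiv p (\<gamma> s) (cramer_field w (\<gamma> s)) = (\<Sum>r\<in>G. a p r * r) (\<gamma> s)"
      unfolding D_def using a p by (metis (no_types, lifting))
    moreover have "dderiv p (\<gamma> s) (cramer_field w (\<gamma> s)) = D s * dderiv p (\<gamma> s) (v s)"
      unfolding cramer_field_solves[OF nz[OF s] chart_v[OF s]] D_def
        linear_scale[OF linear_dderiv[OF Gr[OF p]]] by simp
    ultimately show ?thesis by (simp add: sum_fun_apply)
  qed
  have cont_\<gamma>: "continuous_on {0..1} \<gamma>"
  proof (intro continuous_at_imp_continuous_on ballI)
    fix s :: real assume "s \<in> {0..1}"
    then show "isCont \<gamma> s" using has_vector_derivative_continuous[OF deriv[of s]] by simp
  qed
  have cont_poly: "continuous_on {0..1} (\<lambda>s. p (\<gamma> s))" if "real_polynomial_function p" for p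
    using continuous_on_compose2[OF _ cont_\<gamma>, of UNIV p] that
      continuous_on_polymonial_function[of p UNIV] by (simp add: real_polynomial_function_eq)
  define \<kappa> where "\<kappa> s = (\<Sum>p\<in>G. \<Sum>r\<in>G. 2 * \<bar>a p r (\<gamma> s)\<bar> / (D s * D s))" for s
  have "continuous_on {0..1} \<kappa>"
    unfolding \<kappa>_def D_def using a nz
    by (intro continuous_intros cont_poly det_jacobian_rpf) auto
  then have "bounded (\<kappa> ` {0..1})"
    by (intro compact_imp_bounded compact_continuous_image) auto
  obtain K where K: "\<And>s. 0 \<le> s \<Longrightarrow> s \<le> 1 \<Longrightarrow> \<kappa> s \<le> K"
  proof -
    obtain B where "\<forall>y\<in>\<kappa> ` {0..1}. norm y \<le> B" using \<open>bounded (\<kappa> ` {0..1})\<close> bounded_iff by blast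
    then have "\<kappa> s \<le> B" if "0 \<le> s" "s \<le> 1" for s
      using that by (auto intro: abs_le_D1)
    then show ?thesis using that by blast
  qed
  define N where "N s = (\<Sum>p\<in>G. (p (\<gamma> s))\<^sup>2)" for s
  define N' where "N' s = (\<Sum>p\<in>G. 2 * p (\<gamma> s) * dderiv p (\<gamma> s) (v s))" for s
  have N_ge: "(p (\<gamma> s))\<^sup>2 \<le> N s" if "p \<in> G" for p s
    unfolding N_def using G(1) that by (intro member_le_sum) auto
  have N_nonneg: "N s \<ge> 0" for s unfolding N_def by (intro sum_nonneg) simp
  have "N 1 = 0"
  proof (rule gronwall_zero[of N N' K])
    fix s :: real assume s: "0 \<le> s" "s \<le> 1"
    have dp: "((\<lambda>s. p (\<gamma> s)) has_real_derivative dderiv p (\<gamma> s) (v s)) (at s)" if p: "p \<in> G" for p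
    proof -
      have "(p \<circ> \<gamma> has_derivative dderiv p (\<gamma> s) \<circ> (\<lambda>t. t *\<^sub>R v s)) (at s)"
        using deriv[OF s] polynomial_has_derivative[OF Gr[OF p], of "\<gamma> s"]
        unfolding has_vector_derivative_def by (intro diff_chain_at) auto
      moreover have "dderiv p (\<gamma> s) \<circ> (\<lambda>t. t *\<^sub>R v s) = (*) (dderiv p (\<gamma> s) (v s))"
        using linear_scale[OF linear_dderiv[OF Gr[OF p]]] by (auto simp: fun_eq_iff)
      ultimately show ?thesis unfolding has_field_derivative_def by (simp add: o_def)
    qed
    show "(N has_real_derivative N' s) (at s)"
      unfolding N_def N'_def
      by (rule DERIV_sum) (auto intro!: derivative_eq_intros dp)
    have Dnz: "D s * D s > 0" using nz[OF s] by (auto simp: D_def zero_less_mult_iff linorder_neq_iff)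
    have "N' s \<le> (\<Sum>p\<in>G. \<Sum>r\<in>G. 2 * \<bar>a p r (\<gamma> s)\<bar> / (D s * D s) * N s)"
      unfolding N'_def
    proof (rule sum_mono)
      fix p assume p: "p \<in> G"
      have "dderiv p (\<gamma> s) (v s) = (\<Sum>r\<in>G. a p r (\<gamma> s) * r (\<gamma> s)) / (D s * D s)"
        using key[OF p s] Dnz
        by (metis less_irrefl nonzero_mult_div_cancel_left)
      then have "2 * p (\<gamma> s) * dderiv p (\<gamma> s) (v s) =
          (\<Sum>r\<in>G. a p r (\<gamma> s) / (D s * D s) * (2 * p (\<gamma> s) * r (\<gamma> s)))"
        by (simp add: sum_divide_distrib sum_distrib_left algebra_simps)
      also have "\<dots> \<le> (\<Sum>r\<in>G. 2 * \<bar>a p r (\<gamma> s)\<bar> / (D s * D s) * N s)"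
      proof (rule sum_mono)
        fix r assume r: "r \<in> G"
        have "\<bar>2 * p (\<gamma> s) * r (\<gamma> s)\<bar> \<le> (p (\<gamma> s))\<^sup>2 + (r (\<gamma> s))\<^sup>2"
          using sum_squares_bound[of "\<bar>p (\<gamma> s)\<bar>" "\<bar>r (\<gamma> s)\<bar>"] by (simp add: abs_mult)
        also have "\<dots> \<le> 2 * N s" using N_ge[OF p, of s] N_ge[OF r, of s] by simp
        finally have le: "\<bar>2 * p (\<gamma> s) * r (\<gamma> s)\<bar> \<le> 2 * N s" .
        have "a p r (\<gamma> s) / (D s * D s) * (2 * p (\<gamma> s) * r (\<gamma> s)) \<le>
            \<bar>a p r (\<gamma> s) / (D s * D s)\<bar> * \<bar>2 * p (\<gamma> s) * r (\<gamma> s)\<bar>"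
          by (metis abs_ge_self abs_mult)
        also have "\<dots> \<le> \<bar>a p r (\<gamma> s) / (D s * D s)\<bar> * (2 * N s)"
          using le by (intro mult_left_mono) auto
        also have "\<dots> = 2 * \<bar>a p r (\<gamma> s)\<bar> / (D s * D s) * N s"
          using Dnz by (simp add: abs_divide)
        finally show "a p r (\<gamma> s) / (D s * D s) * (2 * p (\<gamma> s) * r (\<gamma> s)) \<le>
            2 * \<bar>a p r (\<gamma> s)\<bar> / (D s * D s) * N s" .
      qed
      finally show "2 * p (\<gamma> s) * dderiv p (\<gamma> s) (v s) \<le>
          (\<Sum>r\<in>G. 2 * \<bar>a p r (\<gamma> s)\<bar> / (D s * D s) * N s)" .
    qed
    also have "\<dots> = \<kappa> s * N s" unfolding \<kappa>_def by (simp add: sum_distrib_right)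
    also have "\<dots> \<le> K * N s" using K[OF s] N_nonneg by (intro mult_right_mono) auto
    finally show "N' s \<le> K * N s" .
  next
    show "N 1 \<ge> 0" by (rule N_nonneg)
    show "N 0 = 0"
      unfolding N_def start using G(2) xZ by (intro sum.neutral) (auto simp: vanishing_def)
  qed
  then have "\<forall>p\<in>G. p (\<gamma> 1) = 0" using N_ge[of _ 1] by auto
  then have "p (\<gamma> 1) = 0" if "p \<in> vanishing Z" for p
    using that G(3) linear_hull_vanishing[of p polynomials G "\<gamma> 1"] by auto
  then show ?thesis using algebraic_eq_zeros_of_vanishing[OF algZ] by auto
qed

text \<open>Straight segments in the chart lift to curves in the ambient space by the inverse function theorem;
  if the segment starts at the image of \<open>x\<close> and stays in the slice, its lift stays in \<open>Z\<close>.\<close>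

lemma chart_covers:
  assumes "\<epsilon> > 0"
  obtains \<rho> where "\<rho> > 0"
    "\<And>w. (\<And>i. i \<notin> E \<Longrightarrow> w $ i = 0) \<Longrightarrow> norm w < \<rho> \<Longrightarrow>
       \<exists>z\<in>Z. dist x z < \<epsilon> \<and> (\<forall>i\<in>E. z $ i = (x + w) $ i)"
proof -
  define U where "U = ball x \<epsilon> \<inter> {z. det (jacobian z) \<noteq> 0}"
  have cont_det: "continuous_on UNIV (\<lambda>z. det (jacobian z))"
    using det_jacobian_rpf continuous_on_polymonial_function
    by (simp add: real_polynomial_function_eq)
  have "open {z. det (jacobian z) \<noteq> 0}"
    by (intro open_Collect_neq cont_det continuous_on_const)
  then have U: "open U" "x \<in> U" unfolding U_def using assms det_jacobian_x by auto
  have bl: "bounded_linear (chart_deriv z)" for z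
    using linear_chart_deriv linear_conv_bounded_linear by blast
  define \<Phi>' where "\<Phi>' z = Blinfun (chart_deriv z)" for z
  have \<Phi>': "blinfun_apply (\<Phi>' z) = chart_deriv z" for z
    unfolding \<Phi>'_def by (rule bounded_linear_Blinfun_apply[OF bl])
  have der: "(chart has_derivative blinfun_apply (\<Phi>' z)) (at z)" for z
    unfolding \<Phi>'
  proof (subst has_derivative_componentwise_within, intro ballI)
    fix b :: "real^'n" assume "b \<in> Basis"
    then obtain j where b: "b = axis j 1" by (auto simp: Basis_vec_def)
    have "((\<lambda>z. if j \<in> E then z $ j else f j z) has_derivative
        (\<lambda>v. if j \<in> E then v $ j else dderiv (f j) z v)) (at z)"
      using bounded_linear_imp_has_derivative[OF bounded_linear_vec_nth, of j]
        polynomial_has_derivative[OF f_rpf, of j z] by (cases "j \<in> E") auto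
    then show "((\<lambda>z. chart z \<bullet> b) has_derivative (\<lambda>v. chart_deriv z v \<bullet> b)) (at z)"
      by (simp add: b inner_axis chart_def chart_deriv_def)
  qed
  have cont: "continuous_on U \<Phi>'"
  proof (rule continuous_on_blinfun_componentwise)
    fix i :: "real^'n"
    have "real_polynomial_function (\<lambda>z. chart_deriv z i $ j)" for j
      unfolding chart_deriv_def by (cases "j \<in> E") (auto intro: rpf_const rpf_dderiv[OF f_rpf])
    then have "polynomial_function (\<lambda>z. chart_deriv z i)" by (rule polynomial_function_vecI)
    then show "continuous_on U (\<lambda>z. blinfun_apply (\<Phi>' z) i)"
      unfolding \<Phi>' by (rule continuous_on_polymonial_function)
  qed
  obtain B where B: "B ** jacobian x = mat 1"
    using det_jacobian_x invertible_left_inverse[of "jacobian x"] invertible_det_nz by blast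
  define inv\<Phi> where "inv\<Phi> = Blinfun (\<lambda>v. B *v v)"
  have blB: "bounded_linear (\<lambda>v. B *v v)" by (rule matrix_vector_mul_bounded_linear)
  have "inv\<Phi> o\<^sub>L \<Phi>' x = id_blinfun"
  proof (rule blinfun_eqI)
    fix v
    have "B *v (jacobian x *v v) = v" by (simp add: matrix_vector_mul_assoc B)
    then show "blinfun_apply (inv\<Phi> o\<^sub>L \<Phi>' x) v = blinfun_apply id_blinfun v"
      by (simp add: inv\<Phi>_def bounded_linear_Blinfun_apply[OF blB] \<Phi>' jacobian_mult)
  qed
  from inverse_function_theorem[OF U(1) der cont U(2) this]
  obtain U' V g g' where iv: "open U'" "U' \<subseteq> U" "x \<in> U'" "open V" "chart x \<in> V"
    "homeomorphism U' V chart g"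
    "\<And>y. y \<in> V \<Longrightarrow> (g has_derivative g' y) (at y)"
    "\<And>y. y \<in> V \<Longrightarrow> g' y = inv_into UNIV (blinfun_apply (\<Phi>' (g y)))"
    "\<And>y. y \<in> V \<Longrightarrow> bij (blinfun_apply (\<Phi>' (g y)))"
    by blast
  obtain \<rho> where \<rho>: "\<rho> > 0" "ball (chart x) \<rho> \<subseteq> V"
    using openE[OF iv(4,5)] by blast
  show ?thesis
  proof (rule that[OF \<rho>(1)])
    fix w :: "real^'n" assume w: "\<And>i. i \<notin> E \<Longrightarrow> w $ i = 0" and small: "norm w < \<rho>"
    have inV: "chart x + s *\<^sub>R w \<in> V" if s: "0 \<le> s" "s \<le> 1" for s
    proof -
      have "norm (s *\<^sub>R w) \<le> norm w" using s by (simp add: mult_left_le_one_le)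
      then have "chart x + s *\<^sub>R w \<in> ball (chart x) \<rho>" using small by (simp add: dist_norm)
      then show ?thesis using \<rho>(2) by blast
    qed
    define \<gamma> where "\<gamma> s = g (chart x + s *\<^sub>R w)" for s
    define v where "v s = g' (chart x + s *\<^sub>R w) w" for s
    have gU: "g y \<in> U'" "chart (g y) = y" if "y \<in> V" for y
      using iv(6) that by (auto simp: homeomorphism_def)
    have "\<gamma> 1 \<in> Z"
    proof (rule path_stays_in_Z[OF w, of \<gamma> v])
      show "\<gamma> 0 = x" using iv(3,6) by (simp add: \<gamma>_def homeomorphism_def)
      fix s :: real assume s: "0 \<le> s" "s \<le> 1"
      show "det (jacobian (\<gamma> s)) \<noteq> 0"
        using gU(1)[OF inV[OF s]] iv(2) unfolding U_def \<gamma>_def by blast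
      have gd: "(g has_derivative g' (chart x + s *\<^sub>R w)) (at (chart x + s *\<^sub>R w))"
        by (rule iv(7)[OF inV[OF s]])
      have "((\<lambda>s. chart x + s *\<^sub>R w) has_derivative (\<lambda>t. t *\<^sub>R w)) (at s)"
        by (auto intro!: derivative_eq_intros)
      from diff_chain_at[OF this gd]
      have "(g \<circ> (\<lambda>s. chart x + s *\<^sub>R w) has_derivative
          g' (chart x + s *\<^sub>R w) \<circ> (\<lambda>t. t *\<^sub>R w)) (at s)" .
      moreover have "g' (chart x + s *\<^sub>R w) \<circ> (\<lambda>t. t *\<^sub>R w) = (\<lambda>t. t *\<^sub>R v s)"
        using linear_scale[OF has_derivative_linear[OF gd]] by (auto simp: v_def fun_eq_iff)
      ultimately show "(\<gamma> has_vector_derivative v s) (at s)"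
        unfolding has_vector_derivative_def \<gamma>_def by (simp add: o_def)
      have "bij (chart_deriv (\<gamma> s))" "v s = inv_into UNIV (chart_deriv (\<gamma> s)) w"
        using iv(8,9)[OF inV[OF s]] by (simp_all add: \<Phi>' \<gamma>_def v_def)
      then show "chart_deriv (\<gamma> s) (v s) = w" by (simp add: bij_is_surj surj_f_inv_f)
    qed
    moreover have "dist x (\<gamma> 1) < \<epsilon>"
      using gU(1)[OF inV[of 1]] iv(2) unfolding U_def \<gamma>_def by auto
    moreover have "\<gamma> 1 $ i = (x + w) $ i" if "i \<in> E" for i
    proof -
      have "chart (\<gamma> 1) = chart x + w" using gU(2)[OF inV[of 1]] by (simp add: \<gamma>_def)
      from arg_cong[OF this, of "\<lambda>z. z $ i"] show ?thesis using that by (simp add: chart_def)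
    qed
    ultimately show "\<exists>z\<in>Z. dist x z < \<epsilon> \<and> (\<forall>i\<in>E. z $ i = (x + w) $ i)" by blast
  qed
qed

text \<open>By \<open>chart_covers\<close>, the \<open>E\<close>-coordinates of the points of \<open>Z\<close> near \<open>x\<close> fill a neighbourhood.\<close>

lemma independent_near:
  assumes "\<epsilon> > 0"
  shows "alg_independent (vanishing (Z \<inter> ball x \<epsilon>)) E"
  unfolding alg_independent_def
proof
  fix p assume p: "p \<in> polys_in E \<inter> vanishing (Z \<inter> ball x \<epsilon>)"
  obtain \<rho> where \<rho>: "\<rho> > 0"
    "\<And>w. (\<And>i. i \<notin> E \<Longrightarrow> w $ i = 0) \<Longrightarrow> norm w < \<rho> \<Longrightarrow>
       \<exists>z\<in>Z. dist x z < \<epsilon> \<and> (\<forall>i\<in>E. z $ i = (x + w) $ i)"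
    using chart_covers[OF assms] by blast
  have "p = 0"
  proof (rule polys_in_vanishing_near[OF _ \<rho>(1)])
    show "p \<in> polys_in E" using p by simp
    fix w :: "real^'n" assume "\<And>i. i \<notin> E \<Longrightarrow> w $ i = 0" "norm w < \<rho>"
    then obtain z where z: "z \<in> Z" "dist x z < \<epsilon>" "\<forall>i\<in>E. z $ i = (x + w) $ i"
      using \<rho>(2)[of w] by blast
    have "p z = p (x + w)" using p z(3) unfolding polys_in_def depends_on_def by blast
    moreover have "p z = 0" using p z(1,2) by (simp add: vanishing_def)
    ultimately show "p (x + w) = 0" by simp
  qed
  then show "p \<in> {0}" by simp
qed

end

lemma tangent_chart_exists:
  assumes "real_algebraic_set Z" "x \<in> Z"
    "\<And>z. z \<in> Z \<Longrightarrow> dim (zariski_tangent_space Z x) \<le> dim (zariski_tangent_space Z z)"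
  obtains E f where "tangent_chart Z x E f"
  using tangent_coordinates[of Z x] assms unfolding tangent_chart_def by metis

section \<open>Krull dimension and generic tangent dimension\<close>

definition generic_dim :: "(real^'n) set \<Rightarrow> nat" where
  "generic_dim Z = (LEAST d. \<exists>x\<in>Z. dim (zariski_tangent_space Z x) = d)"

lemma generic_dim_attained: "Z \<noteq> {} \<Longrightarrow> \<exists>x\<in>Z. dim (zariski_tangent_space Z x) = generic_dim Z"
  unfolding generic_dim_def by (rule LeastI_ex) blast

lemma generic_dim_le: "x \<in> Z \<Longrightarrow> generic_dim Z \<le> dim (zariski_tangent_space Z x)"
  unfolding generic_dim_def by (rule Least_le) blast

lemma generic_chart:
  assumes "real_algebraic_set Z" "x \<in> Z" "dim (zariski_tangent_space Z x) = generic_dim Z"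
  obtains E f where "tangent_chart Z x E f"
  using tangent_chart_exists[OF assms(1,2)] generic_dim_le assms(3) by metis

lemma irreducible_algebraicD:
  "irreducible_algebraic_set Z \<Longrightarrow> real_algebraic_set Z"
  "irreducible_algebraic_set Z \<Longrightarrow> Z \<noteq> {}"
  by (auto simp: irreducible_algebraic_set_def)

text \<open>Extend \<open>S\<close> to a transcendence basis.  A generic point can be chosen where tangent vectors with
  arbitrary components in the basis exist and where the tangent dimension is minimal: both conditions
  are given by the nonvanishing of a polynomial on the irreducible set \<open>Z\<close>.\<close>

lemma independent_card_le:
  assumes Z: "irreducible_algebraic_set Z" and S: "alg_independent (vanishing Z) S"
  shows "card S \<le> generic_dim Z"
proof -
  interpret prime_of_subring polynomials "vanishing Z" by (rule prime_vanishing[OF Z])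
  obtain T where T: "S \<subseteq> T" "alg_independent (vanishing Z) T" "spanning_coords (vanishing Z) T"
    using extend_alg_independent[OF S] .
  obtain \<delta> where \<delta>: "real_polynomial_function \<delta>" "\<delta> \<notin> vanishing Z"
    "\<And>x w. x \<in> Z \<Longrightarrow> \<delta> x \<noteq> 0 \<Longrightarrow>
       \<exists>v\<in>zariski_tangent_space Z x. \<forall>i\<in>T. v $ i = w $ i"
    using generic_tangent_vectors[OF prime_of_subring_axioms T(2,3)] by blast
  obtain x where x: "x \<in> Z" "dim (zariski_tangent_space Z x) = generic_dim Z"
    using generic_dim_attained irreducible_algebraicD(2)[OF Z] by blast
  obtain E f where "tangent_chart Z x E f"
    using generic_chart[OF irreducible_algebraicD(1)[OF Z] x] .
  then interpret tangent_chart Z x E f .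
  define s where "s = (\<lambda>z. det (jacobian z))"
  have s: "real_polynomial_function s" "s \<notin> vanishing Z"
    using det_jacobian_rpf det_jacobian_x xZ by (auto simp: s_def vanishing_def)
  have "\<delta> * s \<notin> vanishing Z"
    using P_prime[of \<delta> s] \<delta>(1,2) s unfolding polynomials_iff by blast
  moreover have "real_polynomial_function (\<delta> * s)" by (intro rpf_times \<delta> s)
  ultimately obtain z where z: "z \<in> Z" "\<delta> z \<noteq> 0" "det (jacobian z) \<noteq> 0"
    unfolding s_def by (auto simp: vanishing_def)
  have "card S \<le> card T" using T(1) by (intro card_mono) auto
  also have "\<dots> \<le> dim (zariski_tangent_space Z z)"
    by (rule card_le_dim_if_coords_free) (rule \<delta>(3)[OF z(1,2)])
  also have "\<dots> = generic_dim Z" using tangent_dim_eq[OF z(1,3)] x(2) by simp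
  finally show ?thesis .
qed

text \<open>Near \<open>x\<close> there are \<open>generic_dim Z\<close> independent coordinates, and there cannot be more on \<open>Z\<close>; so
  they form a transcendence basis for \<open>Z\<close> that stays independent modulo the ideal of the ball.\<close>

lemma ball_zariski_dense:
  assumes Z: "irreducible_algebraic_set Z" and x: "x \<in> Z" "dim (zariski_tangent_space Z x) = generic_dim Z"
    and \<epsilon>: "\<epsilon> > 0"
  shows "vanishing (Z \<inter> ball x \<epsilon>) \<subseteq> vanishing Z"
proof -
  obtain E f where "tangent_chart Z x E f"
    using generic_chart[OF irreducible_algebraicD(1)[OF Z] x] .
  then interpret tangent_chart Z x E f .
  have sub: "vanishing Z \<subseteq> vanishing (Z \<inter> ball x \<epsilon>)" by (rule vanishing_mono) simp
  have near: "alg_independent (vanishing (Z \<inter> ball x \<epsilon>)) E" by (rule independent_near[OF \<epsilon>])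
  then have ind: "alg_independent (vanishing Z) E" using sub by (rule alg_independent_antimono)
  have "\<not> alg_independent (vanishing Z) (insert j E)" if "j \<notin> E" for j
    using independent_card_le[OF Z, of "insert j E"] that card_E x(2) by auto
  then have "spanning_coords (vanishing Z) E" by (rule maximal_independent_spanning[OF ind])
  from ideal_eq_prime_if_independent[OF prime_vanishing[OF Z] ideal_vanishing sub this near]
  show ?thesis .
qed

text \<open>Fixing one of the \<open>d\<close> chart coordinates at its value in \<open>x\<close> leaves \<open>d - 1\<close> coordinates that fill a
  neighbourhood.  If they were dependent on each of the finitely many components of the section, the
  product of the dependencies would vanish on that neighbourhood.\<close>

lemma hyperplane_section:
  assumes Z: "irreducible_algebraic_set Z" and pos: "generic_dim Z \<ge> 1"
  obtains A where "irreducible_algebraic_set A" "A \<subset> Z" "generic_dim Z \<le> Suc (generic_dim A)"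
proof -
  obtain x where x: "x \<in> Z" "dim (zariski_tangent_space Z x) = generic_dim Z"
    using generic_dim_attained irreducible_algebraicD(2)[OF Z] by blast
  obtain E f where "tangent_chart Z x E f"
    using generic_chart[OF irreducible_algebraicD(1)[OF Z] x] .
  then interpret tangent_chart Z x E f .
  have "E \<noteq> {}" using card_E x(2) pos by auto
  then obtain i where i: "i \<in> E" by blast
  define h where "h = (\<lambda>z::real^'a. z $ i - x $ i)"
  have h: "real_polynomial_function h"
    unfolding h_def by (intro real_polynomial_function_diff rpf_coord rpf_const)
  define H where "H = Z \<inter> {z. h z = 0}"
  have "real_algebraic_set H"
    unfolding H_def using h
    by (intro real_algebraic_set_Int algZ) (auto simp: real_algebraic_set_iff)
  then obtain \<A> where \<A>: "finite \<A>" "\<forall>A\<in>\<A>. irreducible_algebraic_set A" "\<Union>\<A> = H"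
    using irreducible_decomposition by blast
  interpret PE: unital_subring "polys_in (E - {i})" by (rule unital_subring_polys_in)
  have indH: "p = 0" if p: "p \<in> polys_in (E - {i})" "\<forall>z\<in>H. p z = 0" for p
  proof -
    obtain \<rho> where \<rho>: "\<rho> > 0"
      "\<And>w. (\<And>i. i \<notin> E \<Longrightarrow> w $ i = 0) \<Longrightarrow> norm w < \<rho> \<Longrightarrow>
         \<exists>z\<in>Z. dist x z < 1 \<and> (\<forall>i\<in>E. z $ i = (x + w) $ i)"
      using chart_covers[of 1] by auto
    show ?thesis
    proof (rule polys_in_vanishing_near[OF p(1) \<rho>(1)])
      fix w :: "real^'a" assume w: "\<And>j. j \<notin> E - {i} \<Longrightarrow> w $ j = 0" "norm w < \<rho>"
      then obtain z where z: "z \<in> Z" "\<forall>i\<in>E. z $ i = (x + w) $ i" using \<rho>(2)[of w] by blast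
      have "w $ i = 0" using w(1)[of i] by simp
      then have "z \<in> H" using z i by (simp add: H_def h_def)
      moreover have "p z = p (x + w)" using p(1) z(2) unfolding polys_in_def depends_on_def by blast
      ultimately show "p (x + w) = 0" using p(2) by simp
    qed
  qed
  have "\<exists>A\<in>\<A>. alg_independent (vanishing A) (E - {i})"
  proof (rule ccontr)
    assume none: "\<not> ?thesis"
    have "\<exists>p\<in>polys_in (E - {i}). p \<noteq> 0 \<and> (\<forall>z\<in>\<Union>\<B>. p z = 0)" if "finite \<B>" "\<B> \<subseteq> \<A>" for \<B>
      using that
    proof (induction \<B> rule: finite_induct)
      case empty
      then show ?case using PE.one_closed by (intro bexI[of _ 1]) (auto simp: fun_eq_iff)
    next
      case (insert A \<B>)
      then have "\<B> \<subseteq> \<A>" by blast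
      from insert.IH[OF this] obtain p where
        p: "p \<in> polys_in (E - {i})" "p \<noteq> 0" "\<forall>z\<in>\<Union>\<B>. p z = 0" by blast
      have "\<not> alg_independent (vanishing A) (E - {i})" using none insert by auto
      then obtain q where q: "q \<in> polys_in (E - {i})" "q \<in> vanishing A" "q \<noteq> 0"
        unfolding alg_independent_def by blast
      have "p * q \<noteq> 0"
      proof
        assume "p * q = 0"
        then have "p z * q z = 0" for z by (metis times_fun_apply zero_fun_apply)
        then have "(\<forall>z. p z = 0) \<or> (\<forall>z. q z = 0)"
          using p(1) q(1) by (intro polynomial_mult_eq_0) (auto simp: polys_in_def)
        then show False using p(2) q(3) by (metis ext zero_fun_apply)
      qed
      moreover have "\<forall>z\<in>\<Union>(insert A \<B>). (p * q) z = 0"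
        using p(3) q(2) by (auto simp: vanishing_def)
      ultimately show ?case using PE.mult_closed[OF p(1) q(1)] by blast
    qed
    from this[OF \<A>(1)] show False using indH \<A>(3) by blast
  qed
  then obtain A where A: "A \<in> \<A>" "alg_independent (vanishing A) (E - {i})" by blast
  have irr: "irreducible_algebraic_set A" using A \<A> by blast
  have AH: "A \<subseteq> H" using A \<A> by blast
  have "A \<noteq> Z"
  proof
    assume "A = Z"
    then have "h \<in> vanishing Z" using AH h by (auto simp: vanishing_def H_def)
    moreover have "h \<in> polys_in E" using h i by (auto simp: polys_in_def depends_on_def h_def)
    moreover have "alg_independent (vanishing Z) E"
      using alg_independent_antimono[OF independent_near[of 1] vanishing_mono] by auto
    ultimately have "h = 0" unfolding alg_independent_def by blast
    then have "h (x + axis i 1) = 0" by simp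
    then show False by (simp add: h_def axis_def)
  qed
  then have "A \<subset> Z" using AH H_def by blast
  moreover have "generic_dim Z \<le> Suc (generic_dim A)"
    using independent_card_le[OF irr A(2)] i card_E x(2) by simp
  ultimately show ?thesis using that irr by blast
qed

lemma irreducible_chain:
  assumes "irreducible_algebraic_set Z" "k \<le> generic_dim Z"
  shows "\<exists>C. C 0 = Z \<and> (\<forall>i\<le>k. irreducible_algebraic_set (C i)) \<and> (\<forall>i<k. C (Suc i) \<subset> C i)"
  using assms
proof (induction k arbitrary: Z)
  case 0
  then show ?case by (intro exI[of _ "\<lambda>_. Z"]) auto
next
  case (Suc k)
  obtain A where A: "irreducible_algebraic_set A" "A \<subset> Z" "generic_dim Z \<le> Suc (generic_dim A)"
    using hyperplane_section[of Z] Suc.prems by auto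
  have "k \<le> generic_dim A" using A(3) Suc.prems(2) by simp
  then obtain C where C: "C 0 = A" "\<forall>i\<le>k. irreducible_algebraic_set (C i)" "\<forall>i<k. C (Suc i) \<subset> C i"
    using Suc.IH[OF A(1)] by blast
  define D where "D i = (case i of 0 \<Rightarrow> Z | Suc j \<Rightarrow> C j)" for i
  have "irreducible_algebraic_set (D i)" if "i \<le> Suc k" for i
    using that C(2) Suc.prems(1) by (cases i) (auto simp: D_def)
  moreover have "D (Suc i) \<subset> D i" if "i < Suc k" for i
    using that C(1,3) A(2) by (cases i) (auto simp: D_def)
  moreover have "D 0 = Z" by (simp add: D_def)
  ultimately show ?case by blast
qed

text \<open>Read downwards, each step to a strictly smaller prime allows one more independent coordinate, since
  otherwise incomparability would make the two primes equal.\<close>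

lemma prime_chain_independent:
  fixes P :: "nat \<Rightarrow> (real^'n \<Rightarrow> real) set"
  assumes prime: "\<And>i. i \<le> n \<Longrightarrow> prime_of_subring polynomials (P i)"
    and strict: "\<And>i. i < n \<Longrightarrow> P i \<subset> P (Suc i)"
  shows "k \<le> n \<Longrightarrow> \<exists>S. alg_independent (P (n - k)) S \<and> k \<le> card S"
proof (induction k)
  case 0
  have "p = 0" if p: "p \<in> polys_in {}" "p \<in> P n" for p
  proof (rule ccontr)
    interpret prime_of_subring polynomials "P n" by (rule prime) simp
    assume "p \<noteq> 0"
    have const: "p x = p 0" for x using p(1) by (simp add: polys_in_def depends_on_def)
    then have "p 0 \<noteq> 0" using \<open>p \<noteq> 0\<close> by (metis ext zero_fun_apply)
    have "(\<lambda>_. 1 / p 0) * p \<in> P n" by (rule P_mult[OF _ p(2)]) (simp add: rpf_const)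
    moreover have "((\<lambda>_. 1 / p 0) * p) x = 1 x" for x
      unfolding times_fun_apply const[of x] using \<open>p 0 \<noteq> 0\<close> by simp
    then have "(\<lambda>_. 1 / p 0) * p = 1" by (rule ext)
    ultimately show False using P_proper by simp
  qed
  then show ?case by (intro exI[of _ "{}"]) (auto simp: alg_independent_def)
next
  case (Suc k)
  define i where "i = n - Suc k"
  have i: "i < n" "n - k = Suc i" using Suc.prems by (auto simp: i_def)
  obtain S where S: "alg_independent (P (Suc i)) S" "k \<le> card S" using Suc i by auto
  have "\<exists>j. j \<notin> S \<and> alg_independent (P i) (insert j S)"
  proof (rule ccontr)
    assume "\<not> ?thesis"
    then have "spanning_coords (P i) S"
      using alg_independent_antimono[OF S(1)] strict[OF i(1)]
      by (intro maximal_independent_spanning) auto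
    moreover have "prime_of_subring polynomials (P i)" "prime_of_subring polynomials (P (Suc i))"
      using i(1) by (intro prime; simp)+
    ultimately have "P (Suc i) \<subseteq> P i"
      using strict[OF i(1)] S(1) prime_of_subring.axioms(1)
      by (intro ideal_eq_prime_if_independent[of "P i" "P (Suc i)" S]) auto
    then show False using strict[OF i(1)] by blast
  qed
  then obtain j where "j \<notin> S" "alg_independent (P i) (insert j S)" by blast
  moreover have "Suc k \<le> card (insert j S)" using \<open>j \<notin> S\<close> S(2) by simp
  ultimately show ?case unfolding i_def by blast
qed

section \<open>Rings of functions\<close>

locale function_subring =
  fixes D :: "'a set" and F :: "('a \<Rightarrow> real) set"
  assumes ext: "F \<subseteq> extensional D"
    and const_mem: "(\<lambda>x\<in>D. c) \<in> F"
    and add_mem: "f \<in> F \<Longrightarrow> g \<in> F \<Longrightarrow> (\<lambda>x\<in>D. f x + g x) \<in> F"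
    and mult_mem: "f \<in> F \<Longrightarrow> g \<in> F \<Longrightarrow> (\<lambda>x\<in>D. f x * g x) \<in> F"
begin

abbreviation "R \<equiv> function_ring D F"

lemma R_simps [simp]:
  "carrier R = F" "f \<otimes>\<^bsub>R\<^esub> g = (\<lambda>x\<in>D. f x * g x)" "f \<oplus>\<^bsub>R\<^esub> g = (\<lambda>x\<in>D. f x + g x)"
  "\<one>\<^bsub>R\<^esub> = (\<lambda>x\<in>D. 1)" "\<zero>\<^bsub>R\<^esub> = (\<lambda>x\<in>D. 0)"
  by (simp_all add: function_ring_def)

lemma neg_mem: "f \<in> F \<Longrightarrow> (\<lambda>x\<in>D. - f x) \<in> F"
proof -
  assume "f \<in> F"
  then have "(\<lambda>x\<in>D. (\<lambda>x\<in>D. -1) x * f x) \<in> F" by (intro mult_mem const_mem)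
  moreover have "(\<lambda>x\<in>D. (\<lambda>x\<in>D. -1) x * f x) = (\<lambda>x\<in>D. - f x)" by (auto simp: restrict_def)
  ultimately show ?thesis by simp
qed

lemma cring_R: "cring R"
proof (rule cringI)
  have l_zero: "(\<lambda>x\<in>D. (\<lambda>x\<in>D. 0) x + f x) = f" "(\<lambda>x\<in>D. (\<lambda>x\<in>D. 1) x * f x) = f" if "f \<in> F" for f
    using subsetD[OF ext that] by (auto simp: restrict_def fun_eq_iff extensional_def)
  show "abelian_group R"
  proof (rule abelian_groupI)
    fix f assume f: "f \<in> carrier R"
    then have "(\<lambda>x\<in>D. - f x) \<in> F" using neg_mem by simp
    then show "\<exists>y\<in>carrier R. y \<oplus>\<^bsub>R\<^esub> f = \<zero>\<^bsub>R\<^esub>"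
      by (intro bexI[of _ "\<lambda>x\<in>D. - f x"]) (auto simp: restrict_def)
  next
    fix f assume "f \<in> carrier R"
    then show "\<zero>\<^bsub>R\<^esub> \<oplus>\<^bsub>R\<^esub> f = f" unfolding R_simps by (rule l_zero(1))
  qed (auto simp: const_mem add_mem fun_eq_iff algebra_simps)
  show "comm_monoid R"
  proof (rule comm_monoidI)
    fix f assume "f \<in> carrier R"
    then show "\<one>\<^bsub>R\<^esub> \<otimes>\<^bsub>R\<^esub> f = f" unfolding R_simps by (rule l_zero(2))
  qed (auto simp: const_mem mult_mem fun_eq_iff algebra_simps)
qed (auto simp: restrict_def algebra_simps)

lemma a_inv_R: "f \<in> F \<Longrightarrow> \<ominus>\<^bsub>R\<^esub> f = (\<lambda>x\<in>D. - f x)"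
proof -
  assume f: "f \<in> F"
  interpret cring R by (rule cring_R)
  show ?thesis
    using f neg_mem by (intro minus_equality) (auto simp: restrict_def)
qed

end

lemma function_subring_polys_on: "function_subring D (polys_on D)"
proof
  show "polys_on D \<subseteq> extensional D" by (auto simp: polys_on_def)
  show "(\<lambda>x\<in>D. c) \<in> polys_on D" for c
    unfolding polys_on_def using rpf_const[of c] by blast
next
  fix f g assume "f \<in> polys_on D" "g \<in> polys_on D"
  then obtain p q where pq: "real_polynomial_function p" "real_polynomial_function q"
    "f = restrict p D" "g = restrict q D" unfolding polys_on_def by blast
  then have "(\<lambda>x\<in>D. f x + g x) = restrict (\<lambda>x. p x + q x) D"
    "(\<lambda>x\<in>D. f x * g x) = restrict (\<lambda>x. p x * q x) D" by (auto simp: restrict_def)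
  then show "(\<lambda>x\<in>D. f x + g x) \<in> polys_on D" "(\<lambda>x\<in>D. f x * g x) \<in> polys_on D"
    unfolding polys_on_def using rpf_add[OF pq(1,2)] rpf_mult[OF pq(1,2)] by blast+
qed

lemma restrict_eq_iff: "restrict f D = restrict g D \<longleftrightarrow> (\<forall>x\<in>D. f x = g x)"
  by (metis restrict_apply' restrict_ext)

lemma polys_onI: "real_polynomial_function p \<Longrightarrow> restrict p D \<in> polys_on D"
  unfolding polys_on_def by blast

lemma polys_onE:
  assumes "f \<in> polys_on D"
  obtains p where "real_polynomial_function p" "f = restrict p D"
  using assms unfolding polys_on_def by blast

lemma primeideal_of_subvariety:
  assumes A: "irreducible_algebraic_set A" and AZ: "A \<subseteq> Z"
  shows "primeideal ((\<lambda>p. restrict p Z) ` vanishing A) (poly_fun_ring Z)"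
proof -
  interpret function_subring Z "polys_on Z" by (rule function_subring_polys_on)
  interpret P: prime_of_subring polynomials "vanishing A" by (rule prime_vanishing[OF A])
  interpret cring R by (rule cring_R)
  let ?I = "(\<lambda>p. restrict p Z) ` vanishing A"
  have mem: "restrict p Z \<in> ?I \<longleftrightarrow> p \<in> vanishing A" if "real_polynomial_function p" for p
  proof
    assume "restrict p Z \<in> ?I"
    then obtain q where "q \<in> vanishing A" "\<forall>x\<in>Z. p x = q x" by (auto simp: restrict_eq_iff)
    then show "p \<in> vanishing A" using that AZ by (auto simp: vanishing_def)
  qed blast
  have I_sub: "?I \<subseteq> polys_on Z" by (auto simp: polys_on_def vanishing_def)
  have "ideal ?I R"
  proof (rule idealI)
    show "ring R" by (rule ring_axioms)
    show "subgroup ?I (add_monoid R)"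
    proof
      show "?I \<subseteq> carrier (add_monoid R)" using I_sub by simp
      have "restrict 0 Z \<in> ?I" using P.P_zero by blast
      then show "\<one>\<^bsub>add_monoid R\<^esub> \<in> ?I" by (simp add: zero_fun_def)
    next
      fix f g assume "f \<in> ?I" "g \<in> ?I"
      then obtain p q where pq: "p \<in> vanishing A" "q \<in> vanishing A" "f = restrict p Z" "g = restrict q Z"
        by blast
      have "restrict (p + q) Z \<in> ?I" using P.P_add[OF pq(1,2)] by blast
      moreover have "restrict (p + q) Z = (\<lambda>x\<in>Z. f x + g x)" using pq by (auto simp: restrict_def)
      ultimately show "f \<otimes>\<^bsub>add_monoid R\<^esub> g \<in> ?I" by simp
    next
      fix f assume "f \<in> ?I"
      then obtain p where p: "p \<in> vanishing A" "f = restrict p Z" by blast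
      have "restrict (- p) Z \<in> ?I" using P.P_minus[OF p(1)] by blast
      moreover have "restrict (- p) Z = (\<lambda>x\<in>Z. - f x)" using p by (auto simp: restrict_def)
      moreover have "\<ominus>\<^bsub>R\<^esub> f = (\<lambda>x\<in>Z. - f x)"
        using \<open>f \<in> ?I\<close> I_sub by (intro a_inv_R) auto
      ultimately show "inv\<^bsub>add_monoid R\<^esub> f \<in> ?I" by (simp add: a_inv_def)
    qed
    fix f g assume f: "f \<in> ?I" and g: "g \<in> carrier R"
    obtain p where p: "p \<in> vanishing A" "f = restrict p Z" using f by blast
    obtain q where q: "real_polynomial_function q" "g = restrict q Z" using g polys_onE by auto
    have "restrict (q * p) Z \<in> ?I" using P.P_mult[of q p] p q by simp
    moreover have "restrict (q * p) Z = (\<lambda>x\<in>Z. g x * f x)" "restrict (q * p) Z = (\<lambda>x\<in>Z. f x * g x)"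
      using p q by (auto simp: restrict_def)
    ultimately show "g \<otimes>\<^bsub>R\<^esub> f \<in> ?I" "f \<otimes>\<^bsub>R\<^esub> g \<in> ?I" by simp_all
  qed
  then have "primeideal ?I R"
  proof (rule primeidealI)
    show "cring R" by (rule cring_R)
    have "restrict 1 Z \<notin> ?I" using mem[of 1] P.P_proper polynomials.one_closed by simp
    moreover have "restrict 1 Z \<in> carrier R"
      using polys_onI[of 1 Z] polynomials.one_closed by simp
    ultimately show "carrier R \<noteq> ?I" by blast
    fix f g assume "f \<in> carrier R" "g \<in> carrier R" and fg: "f \<otimes>\<^bsub>R\<^esub> g \<in> ?I"
    then obtain p q where pq: "real_polynomial_function p" "f = restrict p Z"
      "real_polynomial_function q" "g = restrict q Z" using polys_onE by (metis R_simps(1))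
    have "restrict (p * q) Z = f \<otimes>\<^bsub>R\<^esub> g" using pq by (auto simp: restrict_def)
    then have "p * q \<in> vanishing A" using fg mem[OF rpf_times[OF pq(1,3)]] by metis
    then have "p \<in> vanishing A \<or> q \<in> vanishing A" using P.P_prime pq by simp
    then show "f \<in> ?I \<or> g \<in> ?I" using pq by blast
  qed
  then show ?thesis by (simp add: poly_fun_ring_def)
qed

text \<open>Primes of the coordinate ring are pulled back to primes of the polynomial ring, where algebraic
  independence of coordinates is formulated.\<close>

lemma prime_of_primeideal:
  assumes "primeideal I (poly_fun_ring Z)"
  shows "prime_of_subring polynomials {p. real_polynomial_function p \<and> restrict p Z \<in> I}"
proof -
  interpret function_subring Z "polys_on Z" by (rule function_subring_polys_on)
  interpret primeideal I R using assms by (simp add: poly_fun_ring_def)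
  have sum: "restrict (p + q) Z = restrict p Z \<oplus>\<^bsub>R\<^esub> restrict q Z"
    and prod: "restrict (p * q) Z = restrict p Z \<otimes>\<^bsub>R\<^esub> restrict q Z" for p q
    by (auto simp: restrict_def)
  show ?thesis
  proof
    show "{p. real_polynomial_function p \<and> restrict p Z \<in> I} \<subseteq> polynomials" by auto
    have "restrict 0 Z = \<zero>\<^bsub>R\<^esub>" by (simp add: zero_fun_def)
    then show "0 \<in> {p. real_polynomial_function p \<and> restrict p Z \<in> I}"
      using polynomials.zero_closed
        additive_subgroup.zero_closed[OF ideal.axioms(1)[OF primeideal.axioms(1)[OF assms]]]
      by (simp add: poly_fun_ring_def)
  next
    fix p q assume "p \<in> {p. real_polynomial_function p \<and> restrict p Z \<in> I}"
      "q \<in> {p. real_polynomial_function p \<and> restrict p Z \<in> I}"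
    then show "p + q \<in> {p. real_polynomial_function p \<and> restrict p Z \<in> I}"
      unfolding mem_Collect_eq sum using a_closed by (blast intro: rpf_plus)
  next
    fix p q :: "real^'a \<Rightarrow> real" assume "p \<in> polynomials"
      "q \<in> {p. real_polynomial_function p \<and> restrict p Z \<in> I}"
    then show "p * q \<in> {p. real_polynomial_function p \<and> restrict p Z \<in> I}"
      unfolding mem_Collect_eq prod polynomials_iff
      by (auto simp del: R_simps(2) intro!: rpf_times I_l_closed polys_onI)
  next
    fix p q :: "real^'a \<Rightarrow> real" assume "p \<in> polynomials" "q \<in> polynomials"
      "p * q \<in> {p. real_polynomial_function p \<and> restrict p Z \<in> I}"
    then show "p \<in> {p. real_polynomial_function p \<and> restrict p Z \<in> I} \<or>
        q \<in> {p. real_polynomial_function p \<and> restrict p Z \<in> I}"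
      unfolding mem_Collect_eq prod polynomials_iff
      using I_prime[of "restrict p Z" "restrict q Z"] polys_onI[of p Z] polys_onI[of q Z] by simp
  next
    have "\<one>\<^bsub>R\<^esub> \<notin> I" using one_imp_carrier I_notcarr by auto
    then show "1 \<notin> {p. real_polynomial_function p \<and> restrict p Z \<in> I}"
      by (simp add: one_fun_def)
  qed
qed

text \<open>Prime chains give independent coordinates, whose number is at most the minimal tangent dimension;
  chains of irreducible subsets give prime chains of that length.\<close>

theorem krull_dim_eq_generic_dim:
  assumes Z: "irreducible_algebraic_set Z"
  shows "krull_dim (poly_fun_ring Z) = enat (generic_dim Z)"
proof (rule antisym)
  show "krull_dim (poly_fun_ring Z) \<le> enat (generic_dim Z)"
    unfolding krull_dim_def
  proof (rule Sup_least)
    fix m assume "m \<in> {enat n |n. \<exists>I. (\<forall>i\<le>n. primeideal (I i) (poly_fun_ring Z)) \<and> (\<forall>i<n. I i \<subset> I (Suc i))}"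
    then obtain n I where m: "m = enat n" and I: "\<forall>i\<le>n. primeideal (I i) (poly_fun_ring Z)"
      "\<forall>i<n. I i \<subset> I (Suc i)" by blast
    define P where "P i = {p. real_polynomial_function p \<and> restrict p Z \<in> I i}" for i
    have prime: "prime_of_subring polynomials (P i)" if "i \<le> n" for i
      unfolding P_def using that I(1) by (intro prime_of_primeideal) blast
    have car: "carrier (poly_fun_ring Z) = polys_on Z"
      by (simp add: poly_fun_ring_def function_ring_def)
    have strict: "P i \<subset> P (Suc i)" if i: "i < n" for i
    proof -
      obtain f where f: "f \<in> I (Suc i)" "f \<notin> I i" using I(2) i by blast
      have "primeideal (I (Suc i)) (poly_fun_ring Z)" using I(1) i by simp
      then have "f \<in> polys_on Z"
        using f(1) car ideal.Icarr primeideal.axioms(1) by metis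
      then obtain p where "real_polynomial_function p" "f = restrict p Z" by (rule polys_onE)
      then have "p \<in> P (Suc i)" "p \<notin> P i" using f by (auto simp: P_def)
      moreover have "P i \<subseteq> P (Suc i)" using I(2) i unfolding P_def by blast
      ultimately show ?thesis by blast
    qed
    obtain S where S: "alg_independent (P 0) S" "n \<le> card S"
      using prime_chain_independent[of n P n, OF prime strict] by auto
    have "vanishing Z \<subseteq> P 0"
    proof
      fix p assume p: "p \<in> vanishing Z"
      have "restrict p Z = \<zero>\<^bsub>poly_fun_ring Z\<^esub>"
        using p by (auto simp: vanishing_def poly_fun_ring_def function_ring_def restrict_def)
      moreover have "\<zero>\<^bsub>poly_fun_ring Z\<^esub> \<in> I 0"
        using I(1) by (metis additive_subgroup.zero_closed ideal.axioms(1) le0 primeideal.axioms(1))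
      ultimately show "p \<in> P 0" using p by (simp add: P_def vanishing_def)
    qed
    then have "card S \<le> generic_dim Z"
      by (intro independent_card_le[OF Z] alg_independent_antimono[OF S(1)])
    then show "m \<le> enat (generic_dim Z)" using S(2) m by simp
  qed
next
  obtain C where C: "C 0 = Z" "\<forall>i\<le>generic_dim Z. irreducible_algebraic_set (C i)"
    "\<forall>i<generic_dim Z. C (Suc i) \<subset> C i"
    using irreducible_chain[OF Z order.refl] by blast
  have CZ: "C i \<subseteq> Z" if "i \<le> generic_dim Z" for i
    using that
  proof (induction i)
    case (Suc i)
    then show ?case using C(3) by (metis Suc_leD Suc_le_eq order.trans psubsetE)
  qed (simp add: C(1))
  define I where "I i = (\<lambda>p. restrict p Z) ` vanishing (C i)" for i
  have "primeideal (I i) (poly_fun_ring Z)" if "i \<le> generic_dim Z" for i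
    unfolding I_def using that C(2) CZ by (intro primeideal_of_subvariety) auto
  moreover have "I i \<subset> I (Suc i)" if i: "i < generic_dim Z" for i
  proof -
    have sub: "C (Suc i) \<subset> C i" using C(3) i by blast
    then have le: "I i \<subseteq> I (Suc i)" unfolding I_def using vanishing_mono by blast
    obtain x where x: "x \<in> C i" "x \<notin> C (Suc i)" using sub by blast
    have "irreducible_algebraic_set (C (Suc i))" using C(2) i by simp
    then have "real_algebraic_set (C (Suc i))" by (rule irreducible_algebraicD)
    then obtain p where p: "p \<in> vanishing (C (Suc i))" "p x \<noteq> 0"
      using x(2) algebraic_eq_zeros_of_vanishing by blast
    have "restrict p Z \<notin> I i"
    proof
      assume "restrict p Z \<in> I i"
      then obtain q where q: "q \<in> vanishing (C i)" "\<forall>z\<in>Z. p z = q z"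
        unfolding I_def by (auto simp: restrict_eq_iff)
      have "x \<in> Z" using x(1) CZ[of i] i by auto
      then show False using q p(2) x(1) by (auto simp: vanishing_def)
    qed
    then show ?thesis using le p(1) unfolding I_def by blast
  qed
  ultimately show "enat (generic_dim Z) \<le> krull_dim (poly_fun_ring Z)"
    unfolding krull_dim_def by (intro Sup_upper) blast
qed

lemma nonsingular_points_eq:
  assumes "irreducible_algebraic_set Z"
  shows "nonsingular_points Z = {x \<in> Z. dim (zariski_tangent_space Z x) = generic_dim Z}"
  unfolding nonsingular_points_def krull_dim_eq_generic_dim[OF assms] by simp

lemma nonsingular_points_open:
  assumes Z: "irreducible_algebraic_set Z"
  obtains s where "real_polynomial_function s" "s \<notin> vanishing Z"
    "\<And>z. z \<in> Z \<Longrightarrow> s z \<noteq> 0 \<Longrightarrow> z \<in> nonsingular_points Z"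
proof -
  obtain x where x: "x \<in> Z" "dim (zariski_tangent_space Z x) = generic_dim Z"
    using generic_dim_attained irreducible_algebraicD(2)[OF Z] by blast
  obtain E f where "tangent_chart Z x E f"
    using generic_chart[OF irreducible_algebraicD(1)[OF Z] x] .
  then interpret tangent_chart Z x E f .
  show ?thesis
  proof (rule that[of "\<lambda>z. det (jacobian z)"])
    show "(\<lambda>z. det (jacobian z)) \<notin> vanishing Z"
      using det_jacobian_x x(1) by (auto simp: vanishing_def)
  qed (use det_jacobian_rpf tangent_dim_eq x(2) in \<open>auto simp: nonsingular_points_eq[OF Z]\<close>)
qed

section \<open>The central locus\<close>

text \<open>The condition on \<open>h\<close> says that the Zariski closure of \<open>X \<inter> ball x \<epsilon>\<close> contains the nonempty open
  subset of \<open>X\<close> where \<open>h\<close> does not vanish.  Unlike the definition through components and nonsingular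
  points, it is visibly compatible with isomorphisms between dense open subsets.\<close>

definition central :: "(real^'n) set \<Rightarrow> real^'n \<Rightarrow> bool" where
  "central X x \<longleftrightarrow> x \<in> X \<and> (\<forall>\<epsilon>>0. \<exists>h. real_polynomial_function h \<and> h \<notin> vanishing X \<and>
     (\<forall>p\<in>vanishing (X \<inter> ball x \<epsilon>). p * h \<in> vanishing X))"

text \<open>A nonsingular point of \<open>Z\<close> near \<open>x\<close> makes the Zariski closure of the ball contain \<open>Z\<close>, hence the
  complement of the other components.\<close>

lemma nonsingular_central:
  assumes X: "real_algebraic_set X" and Z: "Z \<in> irreducible_components X"
    and x: "x \<in> Z" "x \<in> closure (nonsingular_points Z)"
  shows "central X x"
  unfolding central_def
proof (intro conjI allI impI)
  have irr: "irreducible_algebraic_set Z" and ZX: "Z \<subseteq> X" using irreducible_componentsD[OF Z] by auto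
  show "x \<in> X" using x ZX by blast
  fix \<epsilon> :: real assume "\<epsilon> > 0"
  then obtain y where y: "y \<in> nonsingular_points Z" "dist y x < \<epsilon> / 2"
    using x(2) unfolding closure_approachable by (metis half_gt_zero)
  obtain q where q: "real_polynomial_function q" "q \<notin> vanishing Z" "\<And>x. x \<in> X \<Longrightarrow> x \<notin> Z \<Longrightarrow> q x = 0"
    using component_separating_polynomial[OF X Z] by blast
  have "p * q \<in> vanishing X" if p: "p \<in> vanishing (X \<inter> ball x \<epsilon>)" for p
  proof -
    have "Z \<inter> ball y (\<epsilon> / 2) \<subseteq> X \<inter> ball x \<epsilon>"
    proof
      fix z assume z: "z \<in> Z \<inter> ball y (\<epsilon> / 2)"
      have "dist x z \<le> dist y x + dist y z" by (rule dist_triangle3)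
      then show "z \<in> X \<inter> ball x \<epsilon>" using z y(2) ZX by auto
    qed
    then have "p \<in> vanishing (Z \<inter> ball y (\<epsilon> / 2))" using p vanishing_mono by blast
    then have "p \<in> vanishing Z"
      using ball_zariski_dense[OF irr, of y "\<epsilon> / 2"] y(1) \<open>\<epsilon> > 0\<close>
      unfolding nonsingular_points_eq[OF irr] by auto
    then have "(p * q) z = 0" if "z \<in> X" for z
      using that q(3) by (cases "z \<in> Z") (auto simp: vanishing_def)
    then show ?thesis
      using p q(1) rpf_times[of p q] unfolding vanishing_def by blast
  qed
  moreover have "q \<notin> vanishing X" using q(2) vanishing_mono[OF ZX] by blast
  ultimately show "\<exists>h. real_polynomial_function h \<and> h \<notin> vanishing X \<and>
     (\<forall>p\<in>vanishing (X \<inter> ball x \<epsilon>). p * h \<in> vanishing X)" using q(1) by blast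
qed

text \<open>If \<open>x\<close> is not in the central locus, some ball around \<open>x\<close> avoids the nonsingular points of all of the
  finitely many components.  Take a component on which the witness \<open>h\<close> for this ball is nonzero, and
  let \<open>s\<close> vanish at its singular points and \<open>q\<close> on the other components, both without vanishing on
  the component itself.  Then \<open>s * q\<close> vanishes on the ball, so \<open>s * q * h\<close> vanishes on the component,
  whose ideal is prime.\<close>

theorem Cent_eq_central:
  assumes X: "real_algebraic_set X"
  shows "Cent X = {x. central X x}"
proof (intro subset_antisym subsetI CollectI)
  fix x assume "x \<in> Cent X"
  then show "central X x" unfolding Cent_def using nonsingular_central[OF X] by blast
next
  fix x assume "x \<in> {x. central X x}"
  then have x: "x \<in> X" and cen: "\<And>\<epsilon>. \<epsilon> > 0 \<Longrightarrow> \<exists>h. real_polynomial_function h \<and> h \<notin> vanishing X \<and>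
     (\<forall>p\<in>vanishing (X \<inter> ball x \<epsilon>). p * h \<in> vanishing X)" unfolding central_def by auto
  let ?C = "irreducible_components X"
  show "x \<in> Cent X"
  proof (rule ccontr)
    assume no: "x \<notin> Cent X"
    have "\<exists>\<epsilon>>0. nonsingular_points Z \<inter> ball x \<epsilon> = {}" if Z: "Z \<in> ?C" for Z
    proof (cases "x \<in> Z")
      case True
      then have "x \<notin> closure (nonsingular_points Z)" using no Z unfolding Cent_def by blast
      then obtain \<epsilon> where "\<epsilon> > 0" "\<forall>y\<in>nonsingular_points Z. \<not> dist y x < \<epsilon>"
        unfolding closure_approachable by blast
      then show ?thesis by (intro exI[of _ \<epsilon>]) (auto simp: dist_commute)
    next
      case False
      have "open (- Z)" using irreducible_componentsD(1)[OF Z] irreducible_algebraicD(1)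
          closed_real_algebraic_set by blast
      then obtain \<epsilon> where "\<epsilon> > 0" "ball x \<epsilon> \<subseteq> - Z" using False openE[of "- Z" x] by blast
      then show ?thesis
        by (intro exI[of _ \<epsilon>]) (auto simp: nonsingular_points_eq[OF irreducible_componentsD(1)[OF Z]])
    qed
    then have "\<forall>Z. \<exists>\<epsilon>. Z \<in> ?C \<longrightarrow> \<epsilon> > 0 \<and> nonsingular_points Z \<inter> ball x \<epsilon> = {}" by blast
    from choice[OF this] obtain e where
      e: "\<forall>Z. Z \<in> ?C \<longrightarrow> e Z > 0 \<and> nonsingular_points Z \<inter> ball x (e Z) = {}" ..
    define \<epsilon> where "\<epsilon> = Min (insert 1 (e ` ?C))"
    have fin: "finite (insert 1 (e ` ?C))" using finite_irreducible_components[OF X] by simp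
    have "\<epsilon> > 0" unfolding \<epsilon>_def using e fin by (subst Min_gr_iff) auto
    have \<epsilon>_le: "\<epsilon> \<le> e Z" if "Z \<in> ?C" for Z
      unfolding \<epsilon>_def using that fin by (intro Min_le) auto
    obtain h where h: "real_polynomial_function h" "h \<notin> vanishing X"
      "\<forall>p\<in>vanishing (X \<inter> ball x \<epsilon>). p * h \<in> vanishing X" using cen[OF \<open>\<epsilon> > 0\<close>] by blast
    then obtain z where z: "z \<in> X" "h z \<noteq> 0" by (auto simp: vanishing_def)
    then obtain Z where Z: "Z \<in> ?C" "z \<in> Z" using Union_irreducible_components[OF X] by blast
    have irr: "irreducible_algebraic_set Z" and ZX: "Z \<subseteq> X" using irreducible_componentsD[OF Z(1)] by auto
    interpret prime_of_subring polynomials "vanishing Z" by (rule prime_vanishing[OF irr])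
    have hZ: "h \<notin> vanishing Z" using z Z by (auto simp: vanishing_def)
    obtain q where q: "real_polynomial_function q" "q \<notin> vanishing Z" "\<And>x. x \<in> X \<Longrightarrow> x \<notin> Z \<Longrightarrow> q x = 0"
      using component_separating_polynomial[OF X Z(1)] by blast
    obtain s where s: "real_polynomial_function s" "s \<notin> vanishing Z"
      "\<And>z. z \<in> Z \<Longrightarrow> s z \<noteq> 0 \<Longrightarrow> z \<in> nonsingular_points Z"
      using nonsingular_points_open[OF irr] by blast
    have "(s * q) y = 0" if y: "y \<in> X \<inter> ball x \<epsilon>" for y
    proof (cases "y \<in> Z \<and> s y \<noteq> 0")
      case True
      then have "y \<in> nonsingular_points Z" using s(3) by blast
      moreover have "y \<in> ball x (e Z)" using y \<epsilon>_le[OF Z(1)] by auto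
      ultimately show ?thesis using e Z(1) by blast
    next
      case False
      then show ?thesis using q(3) y by auto
    qed
    then have "s * q \<in> vanishing (X \<inter> ball x \<epsilon>)"
      using rpf_times[OF s(1) q(1)] unfolding vanishing_def by blast
    then have "s * q * h \<in> vanishing X" using h(3) by blast
    then have "s * q * h \<in> vanishing Z" using vanishing_mono[OF ZX] by blast
    moreover have "s * q \<notin> vanishing Z" using P_prime[of s q] s q unfolding polynomials_iff by blast
    ultimately show False
      using P_prime[of "s * q" h] hZ h(1) rpf_times[OF s(1) q(1)] unfolding polynomials_iff by blast
  qed
qed

lemma closed_Cent:
  assumes X: "real_algebraic_set X"
  shows "closed (Cent X)"
proof -
  have "Cent X = (\<Union>Z\<in>irreducible_components X. Z \<inter> closure (nonsingular_points Z))"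
    by (rule Cent_def)
  moreover have "closed (Z \<inter> closure (nonsingular_points Z))" if "Z \<in> irreducible_components X" for Z
    using irreducible_algebraicD(1)[OF irreducible_componentsD(1)[OF that]]
    by (intro closed_Int closed_real_algebraic_set closed_closure)
  ultimately show ?thesis
    using finite_irreducible_components[OF X] by (metis (no_types, lifting) closed_UN)
qed

lemma Cent_subset: "Cent X \<subseteq> X"
  unfolding Cent_def using irreducible_componentsD(2) by blast

text \<open>Equivalently, the set of points of \<open>X\<close> where \<open>h\<close> does not vanish is Zariski dense in \<open>X\<close>.\<close>

definition nonzerodivisor_on :: "(real^'n) set \<Rightarrow> (real^'n \<Rightarrow> real) \<Rightarrow> bool" where
  "nonzerodivisor_on X h \<longleftrightarrow> real_polynomial_function h \<and>
     (\<forall>p. real_polynomial_function p \<longrightarrow> (\<forall>x\<in>X. p x * h x = 0) \<longrightarrow> (\<forall>x\<in>X. p x = 0))"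

text \<open>Near a point of the central locus there is a nonsingular point of a component \<open>Z\<close>, and the ball
  around it is Zariski dense in \<open>Z\<close>; so it contains a nonsingular point where \<open>H\<close> does not vanish.\<close>

lemma Cent_dense_off_zeros:
  assumes X: "real_algebraic_set X" and H: "nonzerodivisor_on X H"
  shows "Cent X \<subseteq> closure (Cent X \<inter> {x. H x \<noteq> 0})"
proof
  fix x assume "x \<in> Cent X"
  then obtain Z where Z: "Z \<in> irreducible_components X" "x \<in> Z" "x \<in> closure (nonsingular_points Z)"
    unfolding Cent_def by blast
  have irr: "irreducible_algebraic_set Z" and ZX: "Z \<subseteq> X" using irreducible_componentsD[OF Z(1)] by auto
  interpret prime_of_subring polynomials "vanishing Z" by (rule prime_vanishing[OF irr])
  have Hr: "real_polynomial_function H" using H by (simp add: nonzerodivisor_on_def)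
  obtain q where q: "real_polynomial_function q" "q \<notin> vanishing Z" "\<And>x. x \<in> X \<Longrightarrow> x \<notin> Z \<Longrightarrow> q x = 0"
    using component_separating_polynomial[OF X Z(1)] by blast
  have HZ: "H \<notin> vanishing Z"
  proof
    assume "H \<in> vanishing Z"
    then have "\<forall>x\<in>X. q x * H x = 0" using q(3) by (auto simp: vanishing_def)
    then have "\<forall>x\<in>X. q x = 0" using H q(1) unfolding nonzerodivisor_on_def by blast
    then show False using q(1,2) ZX by (auto simp: vanishing_def)
  qed
  obtain s where s: "real_polynomial_function s" "s \<notin> vanishing Z"
    "\<And>z. z \<in> Z \<Longrightarrow> s z \<noteq> 0 \<Longrightarrow> z \<in> nonsingular_points Z"
    using nonsingular_points_open[OF irr] by blast
  have Hs: "H * s \<notin> vanishing Z" "real_polynomial_function (H * s)"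
    using P_prime[of H s] HZ s Hr rpf_times unfolding polynomials_iff by blast+
  show "x \<in> closure (Cent X \<inter> {x. H x \<noteq> 0})"
    unfolding closure_approachable
  proof (intro allI impI)
    fix \<epsilon> :: real assume "\<epsilon> > 0"
    then obtain y where y: "y \<in> nonsingular_points Z" "dist y x < \<epsilon> / 2"
      using Z(3) unfolding closure_approachable by (metis half_gt_zero)
    have "H * s \<notin> vanishing (Z \<inter> ball y (\<epsilon> / 2))"
      using ball_zariski_dense[OF irr, of y "\<epsilon> / 2"] y(1) \<open>\<epsilon> > 0\<close> Hs(1)
      unfolding nonsingular_points_eq[OF irr] by auto
    then obtain z where z: "z \<in> Z" "dist y z < \<epsilon> / 2" "H z \<noteq> 0" "s z \<noteq> 0"
      using Hs(2) by (auto simp: vanishing_def)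
    have "z \<in> Cent X"
      unfolding Cent_def using Z(1) z(1) s(3)[OF z(1,4)] closure_subset by blast
    moreover have "dist z x < \<epsilon>"
      using dist_triangle[of z x y] z(2) y(2) by (simp add: dist_commute)
    ultimately show "\<exists>y\<in>Cent X \<inter> {x. H x \<noteq> 0}. dist y x < \<epsilon>" using z(3) by blast
  qed
qed

section \<open>Integral elements\<close>

definition integral_over :: "'a::comm_ring_1 set \<Rightarrow> 'a \<Rightarrow> bool" where
  "integral_over A x \<longleftrightarrow> (\<exists>n. x ^ n \<in> linear_hull A ((\<lambda>i. x ^ i) ` {..<n}))"

context unital_subring
begin

lemma integral_over_if_module:
  assumes N: "noetherian A" and B: "finite B" "1 \<in> linear_hull A B"
    and stable: "\<And>b. b \<in> B \<Longrightarrow> x * b \<in> linear_hull A B"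
  shows "integral_over A x"
proof -
  have mult: "x * y \<in> linear_hull A B" if "y \<in> linear_hull A B" for y
    using that
  proof induction
    case (step a b y)
    have "a * (x * b) + x * y \<in> linear_hull A B"
      by (rule linear_hull_add[OF linear_hull_scale[OF stable[OF \<open>b \<in> B\<close>] \<open>a \<in> A\<close>]
            \<open>x * y \<in> linear_hull A B\<close>])
    then show ?case by (simp add: algebra_simps)
  qed (simp add: linear_hull.zero)
  have "x ^ k \<in> linear_hull A B" for k
    by (induction k) (auto intro: B(2) mult)
  from noetherian_module[OF N B(1), of "\<lambda>k. x ^ k", OF this]
  show ?thesis unfolding integral_over_def .
qed

text \<open>Sums and products act on the finite module spanned by the monomials \<open>x ^ i * y ^ j\<close> of bounded
  degrees.\<close>

lemma integral_over_add_mult: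
  assumes N: "noetherian A" and x: "integral_over A x" and y: "integral_over A y"
  shows "integral_over A (x + y)" "integral_over A (x * y)"
proof -
  obtain n where n: "x ^ n \<in> linear_hull A ((\<lambda>i. x ^ i) ` {..<n})"
    using x unfolding integral_over_def by blast
  obtain m where m: "y ^ m \<in> linear_hull A ((\<lambda>i. y ^ i) ` {..<m})"
    using y unfolding integral_over_def by blast
  define B where "B = (\<lambda>(i, j). x ^ i * y ^ j) ` ({..<n} \<times> {..<m})"
  let ?M = "linear_hull A B"
  have shift: "z * c \<in> linear_hull A T"
    if "z \<in> linear_hull A S" "\<And>s. s \<in> S \<Longrightarrow> s * c \<in> linear_hull A T" for z c S T
    using that(1)
  proof induction
    case (step a s z)
    have "a * (s * c) + z * c \<in> linear_hull A T"
      by (rule linear_hull_add[OF linear_hull_scale[OF that(2)[OF \<open>s \<in> S\<close>] \<open>a \<in> A\<close>]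
            \<open>z * c \<in> linear_hull A T\<close>])
    then show ?case by (simp add: algebra_simps)
  qed (simp add: linear_hull.zero)
  have base: "x ^ i * y ^ j \<in> ?M" if "i < n" "j < m" for i j
    using that unfolding B_def by (intro linear_hull_base) auto
  have left: "x ^ Suc i * y ^ j \<in> ?M" if ij: "i < n" "j < m" for i j
  proof (cases "Suc i = n")
    case True
    have "x ^ n * y ^ j \<in> ?M" by (rule shift[OF n]) (use base ij in auto)
    then show ?thesis using True by simp
  next
    case False
    then show ?thesis using ij by (intro base) auto
  qed
  have right: "x ^ i * y ^ Suc j \<in> ?M" if ij: "i < n" "j < m" for i j
  proof (cases "Suc j = m")
    case True
    have "y ^ m * x ^ i \<in> ?M" by (rule shift[OF m]) (use base ij in \<open>auto simp: mult.commute\<close>)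
    then show ?thesis using True by (simp add: mult.commute)
  next
    case False
    then show ?thesis using ij by (intro base) auto
  qed
  have one: "1 \<in> ?M"
  proof (cases "n = 0 \<or> m = 0")
    case True
    have "(1 :: 'a) = 0"
    proof -
      have "linear_hull A {} = {0}" by (auto intro: linear_hull.zero elim: linear_hull.cases)
      then have "x ^ n = 0 \<and> n = 0 \<or> y ^ m = 0 \<and> m = 0"
        using True n m by (elim disjE) (simp_all del: power_eq_0_iff)
      then show ?thesis by (elim disjE conjE) simp_all
    qed
    then show ?thesis using linear_hull.zero[of A B] by (simp only:)
  next
    case False
    then show ?thesis using base[of 0 0] by simp
  qed
  have finB: "finite B" unfolding B_def by simp
  have xB: "x * b \<in> ?M" if "b \<in> B" for b
    using that left unfolding B_def by (auto simp: mult.assoc)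
  have yB: "y * b \<in> ?M" if b: "b \<in> B" for b
  proof -
    obtain i j where ij: "b = x ^ i * y ^ j" "i < n" "j < m" using b unfolding B_def by auto
    have "y * b = x ^ i * y ^ Suc j" unfolding ij(1) by (simp add: algebra_simps)
    then show ?thesis using right[OF ij(2,3)] by simp
  qed
  show "integral_over A (x + y)"
    by (rule integral_over_if_module[OF N finB one])
       (use linear_hull_add[OF xB yB] in \<open>simp add: distrib_right\<close>)
  have xM: "x * z \<in> ?M" if "z \<in> ?M" for z
    using shift[OF that, of x B] xB by (simp add: mult.commute)
  show "integral_over A (x * y)"
    by (rule integral_over_if_module[OF N finB one]) (use xM[OF yB] in \<open>simp add: mult.assoc\<close>)
qed

end

lemma noetherian_image:
  fixes h :: "'a::comm_ring_1 \<Rightarrow> 'b::comm_ring_1"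
  assumes N: "noetherian A" and add: "\<And>x y. h (x + y) = h x + h y"
    and mult: "\<And>x y. h (x * y) = h x * h y"
  shows "noetherian (h ` A)"
  unfolding noetherian_def
proof (intro allI impI)
  fix s :: "nat \<Rightarrow> 'b" assume "\<forall>k. s k \<in> h ` A"
  then have "\<forall>k. \<exists>x. x \<in> A \<and> s k = h x" by blast
  from choice[OF this] obtain t where t: "\<forall>k. t k \<in> A \<and> s k = h (t k)" ..
  from noetherianD[OF N, of t] t obtain k where "t k \<in> linear_hull A (t ` {..<k})" by blast
  then have "h (t k) \<in> linear_hull (h ` A) (s ` {..<k})"
  proof induction
    case zero
    have "h 0 = 0" using add[of 0 0] by simp
    then show ?case by (simp add: linear_hull.zero)
  next
    case (step a b x)
    then show ?case using t by (auto simp: add mult intro!: linear_hull.step)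
  qed
  then show "\<exists>k. s k \<in> linear_hull (h ` A) (s ` {..<k})" using t by auto
qed

text \<open>Integrality over the polynomial functions pulled back along \<open>\<pi>\<close>, as an identity of functions on
  \<open>D\<close>.\<close>

definition integral_on :: "'a set \<Rightarrow> ('a \<Rightarrow> real^'n) \<Rightarrow> ('a \<Rightarrow> real) \<Rightarrow> bool" where
  "integral_on D \<pi> f \<longleftrightarrow> (\<exists>n a. (\<forall>i. real_polynomial_function (a i)) \<and>
     (\<forall>x\<in>D. f x ^ n = (\<Sum>i<n. a i (\<pi> x) * f x ^ i)))"

text \<open>Functions on \<open>D\<close> are extended to the whole type by composition with a retraction \<open>\<rho>\<close> onto \<open>D\<close>.
  This identifies the ring of functions on \<open>D\<close> with a subring of all functions that has the same
  unit, so that the results about subrings apply.\<close>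

locale pulled_back_polynomials =
  fixes D :: "'a set" and \<pi> :: "'a \<Rightarrow> real^'n" and \<rho> :: "'a \<Rightarrow> 'a"
  assumes \<rho>: "\<And>x. \<rho> x \<in> D" "\<And>x. x \<in> D \<Longrightarrow> \<rho> x = x"
begin

definition pull :: "(real^'n \<Rightarrow> real) \<Rightarrow> 'a \<Rightarrow> real" where
  "pull p = (\<lambda>x. p (\<pi> (\<rho> x)))"

definition scalars :: "('a \<Rightarrow> real) set" where
  "scalars = pull ` polynomials"

lemma noetherian_scalars: "noetherian scalars"
  unfolding scalars_def by (rule noetherian_image[OF noetherian_polynomials]) (auto simp: pull_def)

sublocale unital_subring scalars
proof
  show "1 \<in> scalars"
    unfolding scalars_def
    by (rule image_eqI[OF _ polynomials.one_closed]) (auto simp: pull_def)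
next
  fix a b assume "a \<in> scalars" "b \<in> scalars"
  then obtain p q where pq: "a = pull p" "b = pull q" "p \<in> polynomials" "q \<in> polynomials"
    unfolding scalars_def by blast
  have "a - b = pull (p - q)" "a * b = pull (p * q)" unfolding pq by (auto simp: pull_def)
  then show "a - b \<in> scalars" "a * b \<in> scalars"
    unfolding scalars_def using polynomials.diff_closed[OF pq(3,4)] polynomials.mult_closed[OF pq(3,4)]
    by blast+
qed

lemma integral_on_iff: "integral_on D \<pi> f \<longleftrightarrow> integral_over scalars (\<lambda>x. f (\<rho> x))"
proof
  let ?f = "\<lambda>x. f (\<rho> x)"
  assume "integral_on D \<pi> f"
  then obtain n a where a: "\<And>i. real_polynomial_function (a i)"
    "\<And>x. x \<in> D \<Longrightarrow> f x ^ n = (\<Sum>i<n. a i (\<pi> x) * f x ^ i)" unfolding integral_on_def by blast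
  have "?f ^ n = (\<Sum>i<n. pull (a i) * ?f ^ i)"
    by (rule ext) (simp add: power_fun_apply sum_fun_apply pull_def a(2) \<rho>(1))
  moreover have "(\<Sum>i<n. pull (a i) * ?f ^ i) \<in> linear_hull scalars ((\<lambda>i. ?f ^ i) ` {..<n})"
    using a(1) by (intro linear_hull_sum linear_hull_scale linear_hull_base) (auto simp: scalars_def)
  ultimately show "integral_over scalars ?f" unfolding integral_over_def by metis
next
  let ?f = "\<lambda>x. f (\<rho> x)"
  assume "integral_over scalars ?f"
  then obtain n where n: "?f ^ n \<in> linear_hull scalars ((\<lambda>i. ?f ^ i) ` {..<n})"
    unfolding integral_over_def by blast
  from linear_hull_finite_sumE[OF n finite_lessThan] obtain c where
    c: "\<And>i. c i \<in> scalars" "?f ^ n = (\<Sum>i<n. c i * ?f ^ i)" by blast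
  have "\<forall>i. \<exists>p. real_polynomial_function p \<and> c i = pull p" using c(1) unfolding scalars_def
    by (metis imageE polynomials_iff)
  from choice[OF this] obtain a where a: "\<forall>i. real_polynomial_function (a i) \<and> c i = pull (a i)" ..
  have "f x ^ n = (\<Sum>i<n. a i (\<pi> x) * f x ^ i)" if "x \<in> D" for x
    using fun_cong[OF c(2), of x] a \<rho>(2)[OF that]
    by (simp add: power_fun_apply sum_fun_apply pull_def)
  then show "integral_on D \<pi> f" unfolding integral_on_def using a by blast
qed

end

lemma retraction_exists:
  assumes "D \<noteq> {}"
  shows "\<exists>\<rho>. pulled_back_polynomials D \<rho>"
proof -
  obtain d where "d \<in> D" using assms by blast
  then have "pulled_back_polynomials D (\<lambda>x. if x \<in> D then x else d)" by unfold_locales auto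
  then show ?thesis by (rule exI[of "pulled_back_polynomials D"])
qed

lemma integral_on_empty: "integral_on {} \<pi> f"
  unfolding integral_on_def by (rule exI, rule exI[of _ "\<lambda>_ _. 0"]) (simp add: rpf_const)

lemma integral_on_add_mult:
  assumes "integral_on D \<pi> f" "integral_on D \<pi> g"
  shows "integral_on D \<pi> (\<lambda>x. f x + g x)" "integral_on D \<pi> (\<lambda>x. f x * g x)"
proof -
  have "integral_on D \<pi> (\<lambda>x. f x + g x) \<and> integral_on D \<pi> (\<lambda>x. f x * g x)"
  proof (cases "D = {}")
    case False
    from retraction_exists[OF this] obtain \<rho> where "pulled_back_polynomials D \<rho>" ..
    then interpret pulled_back_polynomials D \<pi> \<rho> .
    show ?thesis
      using integral_over_add_mult[OF noetherian_scalars, of "\<lambda>x. f (\<rho> x)" "\<lambda>x. g (\<rho> x)"] assms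
      unfolding integral_on_iff plus_fun_def times_fun_def by blast
  qed (simp add: integral_on_empty)
  then show "integral_on D \<pi> (\<lambda>x. f x + g x)" "integral_on D \<pi> (\<lambda>x. f x * g x)" by auto
qed

lemma integral_on_polynomial:
  assumes "real_polynomial_function p"
  shows "integral_on D \<pi> (\<lambda>x. p (\<pi> x))"
  unfolding integral_on_def
  by (rule exI[of _ 1], rule exI[of _ "\<lambda>_. p"]) (simp add: assms)

text \<open>The restrictions of polynomials to \<open>Y\<close> form a finite module over the polynomials on \<open>X\<close>, stable
  under multiplication by \<open>p\<close>.\<close>

lemma finite_map_integral:
  assumes fin: "finite_map Y X \<pi>" and \<pi>: "\<pi> \<in> Y \<rightarrow> X" and p: "real_polynomial_function p"
  shows "integral_on Y \<pi> p"
proof (cases "Y = {}")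
  case False
  from retraction_exists[OF this] obtain \<rho> where "pulled_back_polynomials Y \<rho>" ..
  then interpret pulled_back_polynomials Y \<pi> \<rho> .
  obtain B where B: "finite B" "B \<subseteq> polys_on Y"
    "\<And>f. f \<in> polys_on Y \<Longrightarrow> \<exists>a. (\<forall>b\<in>B. a b \<in> polys_on X) \<and> (\<forall>y\<in>Y. f y = (\<Sum>b\<in>B. a b (\<pi> y) * b y))"
    using fin unfolding finite_map_def by blast
  define C where "C = (\<lambda>b x. b (\<rho> x)) ` B"
  have hull: "(\<lambda>x. q (\<rho> x)) \<in> linear_hull scalars C" if q: "real_polynomial_function q" for q
  proof -
    obtain a where a: "\<forall>b\<in>B. a b \<in> polys_on X"
      "\<forall>y\<in>Y. restrict q Y y = (\<Sum>b\<in>B. a b (\<pi> y) * b y)"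
      using B(3)[OF polys_onI[OF q]] by blast
    have "\<forall>b. \<exists>r. b \<in> B \<longrightarrow> real_polynomial_function r \<and> a b = restrict r X"
      using a(1) polys_onE by metis
    from choice[OF this] obtain r where
      r: "\<forall>b. b \<in> B \<longrightarrow> real_polynomial_function (r b) \<and> a b = restrict (r b) X" ..
    have "(\<lambda>x. q (\<rho> x)) = (\<Sum>b\<in>B. pull (r b) * (\<lambda>x. b (\<rho> x)))"
    proof
      fix x
      have "\<pi> (\<rho> x) \<in> X" using \<pi> \<rho>(1) by blast
      then have "(\<Sum>b\<in>B. a b (\<pi> (\<rho> x)) * b (\<rho> x)) = (\<Sum>b\<in>B. pull (r b) x * b (\<rho> x))"
        using r by (intro sum.cong) (auto simp: pull_def)
      then show "q (\<rho> x) = (\<Sum>b\<in>B. pull (r b) * (\<lambda>x. b (\<rho> x))) x"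
        using a(2) \<rho>(1)[of x] by (simp add: sum_fun_apply)
    qed
    moreover have "(\<Sum>b\<in>B. pull (r b) * (\<lambda>x. b (\<rho> x))) \<in> linear_hull scalars C"
      using r by (intro linear_hull_sum linear_hull_scale linear_hull_base)
        (auto simp: C_def scalars_def)
    ultimately show ?thesis by simp
  qed
  have "integral_over scalars (\<lambda>x. p (\<rho> x))"
  proof (rule integral_over_if_module[OF noetherian_scalars])
    show "finite C" using B(1) by (simp add: C_def)
    show "1 \<in> linear_hull scalars C" using hull[OF rpf_const[of 1]] by (simp add: one_fun_def)
    fix c assume "c \<in> C"
    then obtain b where b: "b \<in> B" "c = (\<lambda>x. b (\<rho> x))" unfolding C_def by blast
    obtain q where q: "real_polynomial_function q" "b = restrict q Y"
      using b(1) B(2) polys_onE by blast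
    have "(\<lambda>x. p (\<rho> x)) * c = (\<lambda>x. p (\<rho> x) * q (\<rho> x))"
      unfolding b(2) q(2) by (rule ext) (simp add: \<rho>(1))
    then show "(\<lambda>x. p (\<rho> x)) * c \<in> linear_hull scalars C"
      using hull[OF rpf_mult[OF p q(1)]] by simp
  qed
  then show ?thesis unfolding integral_on_iff .
qed (simp add: integral_on_empty)

section \<open>Dense open sets and birational maps\<close>

lemma topspace_zariski: "topspace (zariski :: (real^'n) topology) = UNIV"
proof -
  have "openin zariski (UNIV :: (real^'n) set)"
    unfolding openin_zariski real_algebraic_set_iff
    by (intro exI[of _ "\<lambda>_. 1"]) (simp add: rpf_const)
  then show ?thesis using openin_subset by blast
qed

lemma closedin_zariski: "closedin zariski A \<longleftrightarrow> real_algebraic_set A"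
  unfolding closedin_def topspace_zariski openin_zariski by (simp add: Compl_eq_Diff_UNIV[symmetric])

text \<open>Every closed subset is the zero set of a single polynomial, so every open subset is principal.\<close>

lemma zariski_dense_open_iff:
  "zariski_dense_open X U \<longleftrightarrow> (\<exists>h. nonzerodivisor_on X h \<and> U = {x \<in> X. h x \<noteq> 0})"
proof
  assume U: "zariski_dense_open X U"
  then obtain T where T: "openin zariski T" "U = T \<inter> X"
    unfolding zariski_dense_open_def openin_subtopology by blast
  obtain h where h: "real_polynomial_function h" "- T = {x. h x = 0}"
    using T(1) unfolding openin_zariski real_algebraic_set_iff by blast
  have Uh: "U = {x \<in> X. h x \<noteq> 0}" using T(2) h(2) by auto
  have "\<forall>x\<in>X. p x = 0" if p: "real_polynomial_function p" "\<forall>x\<in>X. p x * h x = 0" for p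
  proof -
    have "closedin (subtopology zariski X) ({x. p x = 0} \<inter> X)"
      unfolding closedin_subtopology closedin_zariski real_algebraic_set_iff using p(1) by blast
    moreover have "U \<subseteq> {x. p x = 0} \<inter> X" using p(2) Uh by auto
    ultimately have "subtopology zariski X closure_of U \<subseteq> {x. p x = 0} \<inter> X"
      by (intro closure_of_minimal)
    then show ?thesis using U unfolding zariski_dense_open_def by blast
  qed
  then have "nonzerodivisor_on X h" using h(1) unfolding nonzerodivisor_on_def by blast
  then show "\<exists>h. nonzerodivisor_on X h \<and> U = {x \<in> X. h x \<noteq> 0}" using Uh by blast
next
  assume "\<exists>h. nonzerodivisor_on X h \<and> U = {x \<in> X. h x \<noteq> 0}"
  then obtain h where h: "nonzerodivisor_on X h" "U = {x \<in> X. h x \<noteq> 0}" by blast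
  have hr: "real_polynomial_function h" using h(1) by (simp add: nonzerodivisor_on_def)
  let ?C = "subtopology zariski X closure_of U"
  have "openin zariski {x. h x \<noteq> 0}"
    unfolding openin_zariski real_algebraic_set_iff using hr by (intro exI[of _ h]) auto
  then have "openin (subtopology zariski X) U"
    unfolding openin_subtopology h(2) by blast
  moreover have "?C = X"
  proof
    show "?C \<subseteq> X" using closure_of_subset_topspace[of "subtopology zariski X" U]
      by (simp add: topspace_zariski)
    have "closedin (subtopology zariski X) ?C" by simp
    then obtain A where A: "real_algebraic_set A" "?C = A \<inter> X"
      unfolding closedin_subtopology closedin_zariski by blast
    obtain p where p: "real_polynomial_function p" "A = {x. p x = 0}"
      using A(1) real_algebraic_set_iff by blast
    have "U \<subseteq> ?C" by (intro closure_of_subset) (auto simp: h(2) topspace_zariski)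
    then have "\<forall>x\<in>X. p x * h x = 0" using A(2) p(2) h(2) by auto
    then have "\<forall>x\<in>X. p x = 0" using h(1) p(1) unfolding nonzerodivisor_on_def by blast
    then show "X \<subseteq> ?C" using A(2) p(2) by auto
  qed
  ultimately show "zariski_dense_open X U" unfolding zariski_dense_open_def by blast
qed

lemma nonzerodivisor_onD:
  assumes "nonzerodivisor_on X h"
  shows "real_polynomial_function h"
    "real_polynomial_function p \<Longrightarrow> (\<And>x. x \<in> X \<Longrightarrow> p x * h x = 0) \<Longrightarrow> x \<in> X \<Longrightarrow> p x = 0"
  using assms unfolding nonzerodivisor_on_def by blast+

lemma nonzerodivisor_on_mult:
  assumes f: "nonzerodivisor_on X f" and g: "nonzerodivisor_on X g"
  shows "nonzerodivisor_on X (\<lambda>x. f x * g x)"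
  unfolding nonzerodivisor_on_def
proof (intro conjI allI impI ballI)
  show "real_polynomial_function (\<lambda>x. f x * g x)"
    using nonzerodivisor_onD(1)[OF f] nonzerodivisor_onD(1)[OF g] by (rule rpf_mult)
  fix p x assume p: "real_polynomial_function p" "\<forall>x\<in>X. p x * (f x * g x) = 0" and x: "x \<in> X"
  have "p y * f y = 0" if "y \<in> X" for y
    using nonzerodivisor_onD(2)[OF g, of "\<lambda>x. p x * f x"] p that
      rpf_mult[OF p(1) nonzerodivisor_onD(1)[OF f]] by (simp add: mult.assoc)
  then show "p x = 0" using nonzerodivisor_onD(2)[OF f p(1)] x by blast
qed

text \<open>Functions that are quotients of polynomials with denominator nonzero wherever all \<open>Q i\<close> are nonzero
  are closed under sums and products.\<close>

lemma rational_composition: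
  fixes P Q :: "'m::finite \<Rightarrow> real^'n \<Rightarrow> real" and p :: "real^'m \<Rightarrow> real"
  assumes P: "\<And>i. real_polynomial_function (P i)" and Q: "\<And>i. real_polynomial_function (Q i)"
    and p: "real_polynomial_function p"
  obtains N D where "real_polynomial_function N" "real_polynomial_function D"
    "\<And>x. (\<forall>i. Q i x \<noteq> 0) \<Longrightarrow> D x \<noteq> 0 \<and> p (\<chi> i. P i x / Q i x) = N x / D x"
proof -
  let ?g = "\<lambda>x. (\<chi> i. P i x / Q i x)"
  define rat where "rat f \<longleftrightarrow> (\<exists>N D. real_polynomial_function N \<and> real_polynomial_function D \<and>
      (\<forall>x. (\<forall>i. Q i x \<noteq> 0) \<longrightarrow> D x \<noteq> 0 \<and> f x = N x / D x))" for f
  have add: "rat (\<lambda>x. f x + g x)" if fg: "rat f" "rat g" for f g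
  proof -
    obtain N D where 1: "real_polynomial_function N" "real_polynomial_function D"
      "\<forall>x. (\<forall>i. Q i x \<noteq> 0) \<longrightarrow> D x \<noteq> 0 \<and> f x = N x / D x" using fg(1) unfolding rat_def by blast
    obtain N' D' where 2: "real_polynomial_function N'" "real_polynomial_function D'"
      "\<forall>x. (\<forall>i. Q i x \<noteq> 0) \<longrightarrow> D' x \<noteq> 0 \<and> g x = N' x / D' x" using fg(2) unfolding rat_def by blast
    show ?thesis unfolding rat_def
      by (rule exI[of _ "\<lambda>x. N x * D' x + N' x * D x"], rule exI[of _ "\<lambda>x. D x * D' x"])
         (use 1 2 in \<open>auto intro!: rpf_add rpf_mult simp: add_frac_eq\<close>)
  qed
  have mult: "rat (\<lambda>x. f x * g x)" if fg: "rat f" "rat g" for f g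
  proof -
    obtain N D where 1: "real_polynomial_function N" "real_polynomial_function D"
      "\<forall>x. (\<forall>i. Q i x \<noteq> 0) \<longrightarrow> D x \<noteq> 0 \<and> f x = N x / D x" using fg(1) unfolding rat_def by blast
    obtain N' D' where 2: "real_polynomial_function N'" "real_polynomial_function D'"
      "\<forall>x. (\<forall>i. Q i x \<noteq> 0) \<longrightarrow> D' x \<noteq> 0 \<and> g x = N' x / D' x" using fg(2) unfolding rat_def by blast
    show ?thesis unfolding rat_def
      by (rule exI[of _ "\<lambda>x. N x * N' x"], rule exI[of _ "\<lambda>x. D x * D' x"])
         (use 1 2 in \<open>auto intro!: rpf_mult\<close>)
  qed
  have const: "rat (\<lambda>_. c)" for c
    unfolding rat_def by (rule exI[of _ "\<lambda>_. c"], rule exI[of _ "\<lambda>_. 1"]) (simp add: rpf_const)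
  have coord: "rat (\<lambda>x. ?g x $ i)" for i
    unfolding rat_def using P Q by (intro exI[of _ "P i"] exI[of _ "Q i"]) simp
  have sum: "rat (\<lambda>x. \<Sum>i\<in>I. f i x)" if "finite I" "\<And>i. i \<in> I \<Longrightarrow> rat (f i)" for f :: "'m \<Rightarrow> _" and I
    using that by (induction I rule: finite_induct) (auto intro: const add)
  from p have "rat (\<lambda>x. p (?g x))"
  proof induction
    case (linear L)
    have "L v = (\<Sum>i\<in>UNIV. v $ i * L (axis i 1))" for v
      by (rule linear_functional_expand[OF bounded_linear.linear[OF linear]])
    then have "(\<lambda>x. L (?g x)) = (\<lambda>x. \<Sum>i\<in>UNIV. ?g x $ i * L (axis i 1))" by (rule ext)
    moreover have "rat (\<lambda>x. \<Sum>i\<in>UNIV. ?g x $ i * L (axis i 1))"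
      by (intro sum mult coord const) simp
    ultimately show ?case by simp
  next
    case (const c)
    show ?case by (rule \<open>\<And>c. rat (\<lambda>_. c)\<close>)
  next
    case (add f g)
    then show ?case by (intro \<open>\<And>f g. rat f \<Longrightarrow> rat g \<Longrightarrow> rat (\<lambda>x. f x + g x)\<close>)
  next
    case (mult f g)
    then show ?case by (intro \<open>\<And>f g. rat f \<Longrightarrow> rat g \<Longrightarrow> rat (\<lambda>x. f x * g x)\<close>)
  qed
  then show ?thesis using that unfolding rat_def by blast
qed

text \<open>A finite map does not map the zeros of a nonzerodivisor \<open>h\<close> onto a set that is Zariski dense in a
  nonempty open subset of \<open>X\<close>.  Otherwise let \<open>u\<close> cut out such an open subset and take an algebraic relation
  of \<open>h\<close> over \<open>\<P>(X)\<close> on the part of \<open>Y\<close> over it, of minimal degree.  Its constant term vanishes on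
  the image of the zeros of \<open>h\<close>, hence is zero there, and the relation can be divided by \<open>h\<close>.\<close>

lemma image_zeros_nonzerodivisor:
  fixes X :: "(real^'n) set" and Y :: "(real^'m) set"
  assumes fin: "finite_map Y X \<pi>" and \<pi>: "\<pi> \<in> Y \<rightarrow> X"
    and F: "polynomial_function F" "\<And>y. y \<in> Y \<Longrightarrow> \<pi> y = F y"
    and h: "nonzerodivisor_on Y h"
  obtains a where "nonzerodivisor_on X a" "\<And>y. y \<in> Y \<Longrightarrow> h y = 0 \<Longrightarrow> a (\<pi> y) = 0"
proof -
  let ?T = "{y \<in> Y. h y = 0}"
  have hr: "real_polynomial_function h" using h by (rule nonzerodivisor_onD)
  obtain a where a: "real_polynomial_function a" "zariski_closure (\<pi> ` ?T) = {x. a x = 0}"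
    using real_algebraic_set_zariski_closure[of "\<pi> ` ?T"] unfolding real_algebraic_set_iff by blast
  have "\<forall>x\<in>X. u x = 0" if u: "real_polynomial_function u" and ua: "\<forall>x\<in>X. u x * a x = 0" for u
  proof (rule ccontr)
    assume nz: "\<not> (\<forall>x\<in>X. u x = 0)"
    have kill: "q x * u x = 0"
      if q: "real_polynomial_function q" "\<And>y. y \<in> ?T \<Longrightarrow> q (\<pi> y) = 0" and x: "x \<in> X" for q x
    proof (cases "u x = 0")
      case False
      then have "x \<in> zariski_closure (\<pi> ` ?T)" using ua x unfolding a(2) by auto
      moreover have "q \<in> vanishing (\<pi> ` ?T)" using q by (auto simp: vanishing_def)
      ultimately have "q x = 0" unfolding zariski_closure_def by blast
      then show ?thesis by simp
    qed simp
    define rel where "rel n c \<longleftrightarrow> (\<forall>i. real_polynomial_function (c i)) \<and>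
        (\<forall>y\<in>Y. (\<Sum>k\<le>n. c k (\<pi> y) * h y ^ k) * u (\<pi> y) = 0) \<and>
        (\<exists>k\<le>n. \<exists>x\<in>X. c k x * u x \<noteq> 0)" for n and c :: "nat \<Rightarrow> real^'n \<Rightarrow> real"
    have "\<exists>n c. rel n c"
    proof -
      obtain n b where b: "\<And>i. real_polynomial_function (b i)"
        "\<And>y. y \<in> Y \<Longrightarrow> h y ^ n = (\<Sum>i<n. b i (\<pi> y) * h y ^ i)"
        using finite_map_integral[OF fin \<pi> hr] unfolding integral_on_def by blast
      define c where "c i = (if i = n then (\<lambda>_. 1) else (\<lambda>x. - b i x))" for i
      have "real_polynomial_function (c i)" for i
        unfolding c_def using b(1) by (auto intro: rpf_const)
      moreover have "(\<Sum>k\<le>n. c k (\<pi> y) * h y ^ k) = 0" if "y \<in> Y" for y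
      proof -
        have "(\<Sum>k<n. c k (\<pi> y) * h y ^ k) = (\<Sum>k<n. - (b k (\<pi> y) * h y ^ k))"
          by (intro sum.cong refl) (simp add: c_def)
        then show ?thesis
          using b(2)[OF that] by (simp add: lessThan_Suc_atMost[symmetric] c_def sum_negf)
      qed
      moreover have "\<exists>k\<le>n. \<exists>x\<in>X. c k x * u x \<noteq> 0"
        using nz by (intro exI[of _ n]) (auto simp: c_def)
      ultimately have "rel n c" unfolding rel_def by simp
      then show ?thesis by blast
    qed
    define n where "n = (LEAST n. \<exists>c. rel n c)"
    have "\<exists>c. rel n c" unfolding n_def using \<open>\<exists>n c. rel n c\<close> by (rule LeastI_ex)
    then obtain c where c: "rel n c" ..
    have least: "n \<le> k" if "rel k d" for k d unfolding n_def using that by (intro Least_le) blast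
    have cr: "real_polynomial_function (c i)" for i using c by (simp add: rel_def)
    have eq: "(\<Sum>k\<le>n. c k (\<pi> y) * h y ^ k) * u (\<pi> y) = 0" if "y \<in> Y" for y
      using c that by (simp add: rel_def)
    have c0: "c 0 x * u x = 0" if x: "x \<in> X" for x
    proof -
      have "c 0 x * u x * u x = 0"
      proof (rule kill[OF _ _ x])
        show "real_polynomial_function (\<lambda>x. c 0 x * u x)" by (intro rpf_mult cr u)
        fix y assume y: "y \<in> ?T"
        have "(\<Sum>k\<le>n. c k (\<pi> y) * h y ^ k) = (\<Sum>k\<le>n. if k = 0 then c 0 (\<pi> y) else 0)"
          using y by (intro sum.cong refl) auto
        then show "c 0 (\<pi> y) * u (\<pi> y) = 0" using eq[of y] y by simp
      qed
      then show ?thesis by auto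
    qed
    show False
    proof (cases n)
      case 0
      then show ?thesis using c c0 unfolding rel_def by auto
    next
      case (Suc m)
      define r where "r y = (\<Sum>k\<le>m. c (Suc k) (F y) * h y ^ k) * u (F y)" for y
      have "real_polynomial_function r"
        unfolding r_def
        by (intro rpf_mult real_polynomial_function_sum finite_atMost real_polynomial_function_power
            rpf_compose[OF F(1)] cr hr u)
      moreover have "r y * h y = 0" if y: "y \<in> Y" for y
      proof -
        have z: "c 0 (\<pi> y) * u (\<pi> y) = 0" using c0 \<pi> y by blast
        have split: "(\<Sum>k\<le>n. c k (\<pi> y) * h y ^ k) =
            c 0 (\<pi> y) + (\<Sum>k\<le>m. c (Suc k) (\<pi> y) * h y ^ k) * h y"
          unfolding Suc sum.atMost_Suc_shift by (simp add: sum_distrib_left mult_ac)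
        have "(\<Sum>k\<le>m. c (Suc k) (\<pi> y) * h y ^ k) * h y * u (\<pi> y) = 0"
          using eq[OF y] unfolding split distrib_right z by simp
        then show ?thesis unfolding r_def F(2)[OF y, symmetric] by (simp add: mult_ac)
      qed
      ultimately have "r y = 0" if "y \<in> Y" for y using nonzerodivisor_onD(2)[OF h] that by blast
      then have "(\<Sum>k\<le>m. c (Suc k) (\<pi> y) * h y ^ k) * u (\<pi> y) = 0" if "y \<in> Y" for y
        using that F(2)[OF that] unfolding r_def by metis
      moreover have "\<exists>k\<le>m. \<exists>x\<in>X. c (Suc k) x * u x \<noteq> 0"
      proof -
        obtain k x where k: "k \<le> n" "x \<in> X" "c k x * u x \<noteq> 0" using c unfolding rel_def by blast
        then obtain l where "k = Suc l" using c0 by (cases k) auto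
        then show ?thesis using k Suc by auto
      qed
      ultimately have "rel m (\<lambda>k. c (Suc k))" unfolding rel_def using cr by blast
      then show False using least Suc by fastforce
    qed
  qed
  then have "nonzerodivisor_on X a" using a(1) unfolding nonzerodivisor_on_def by blast
  moreover have "a (\<pi> y) = 0" if "y \<in> Y" "h y = 0" for y
    using zariski_closure_subset[of "\<pi> ` ?T"] that unfolding a(2) by blast
  ultimately show ?thesis using that by blast
qed

text \<open>A finite birational map is an isomorphism over the principal dense open subset of \<open>X\<close> where \<open>H\<close>
  does not vanish, with inverse given by the quotients \<open>P i / Q i\<close>; moreover the full preimage of
  this set in \<open>Y\<close> is dense.\<close>

locale birational_chart =
  fixes X :: "(real^'n) set" and Y :: "(real^'m) set" and \<pi> F :: "real^'m \<Rightarrow> real^'n"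
    and H :: "real^'n \<Rightarrow> real" and P Q :: "'m \<Rightarrow> real^'n \<Rightarrow> real"
  assumes algX: "real_algebraic_set X" and algY: "real_algebraic_set Y"
    and \<pi>X: "\<And>y. y \<in> Y \<Longrightarrow> \<pi> y \<in> X"
    and F: "polynomial_function F" "\<And>y. y \<in> Y \<Longrightarrow> \<pi> y = F y"
    and HX: "nonzerodivisor_on X H"
    and P: "\<And>i. real_polynomial_function (P i)" and Q: "\<And>i. real_polynomial_function (Q i)"
    and Q_nz: "\<And>x i. x \<in> X \<Longrightarrow> H x \<noteq> 0 \<Longrightarrow> Q i x \<noteq> 0"
    and section_in: "\<And>x. x \<in> X \<Longrightarrow> H x \<noteq> 0 \<Longrightarrow> (\<chi> i. P i x / Q i x) \<in> Y"
    and \<pi>_section: "\<And>x. x \<in> X \<Longrightarrow> H x \<noteq> 0 \<Longrightarrow> \<pi> (\<chi> i. P i x / Q i x) = x"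
    and section_\<pi>: "\<And>y. y \<in> Y \<Longrightarrow> H (\<pi> y) \<noteq> 0 \<Longrightarrow> (\<chi> i. P i (\<pi> y) / Q i (\<pi> y)) = y"
    and HY: "nonzerodivisor_on Y (\<lambda>y. H (F y))"
begin

definition sect :: "real^'n \<Rightarrow> real^'m" where
  "sect x = (\<chi> i. P i x / Q i x)"

lemma sect_inverse:
  "x \<in> X \<Longrightarrow> H x \<noteq> 0 \<Longrightarrow> sect x \<in> Y"
  "x \<in> X \<Longrightarrow> H x \<noteq> 0 \<Longrightarrow> F (sect x) = x"
  "y \<in> Y \<Longrightarrow> H (F y) \<noteq> 0 \<Longrightarrow> sect (F y) = y"
proof -
  show Y: "x \<in> X \<Longrightarrow> H x \<noteq> 0 \<Longrightarrow> sect x \<in> Y" for x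
    unfolding sect_def by (rule section_in)
  show "x \<in> X \<Longrightarrow> H x \<noteq> 0 \<Longrightarrow> F (sect x) = x" for x
    using \<pi>_section[of x] F(2)[OF Y[of x]] by (simp add: sect_def)
  show "y \<in> Y \<Longrightarrow> H (F y) \<noteq> 0 \<Longrightarrow> sect (F y) = y" for y
    using section_\<pi>[of y] F(2)[of y] by (simp add: sect_def)
qed

lemma F_X: "y \<in> Y \<Longrightarrow> F y \<in> X" using \<pi>X F(2) by metis

lemma H_rpf: "real_polynomial_function H" using HX by (rule nonzerodivisor_onD)

lemma rational_pullback:
  assumes "real_polynomial_function p"
  obtains N D where "real_polynomial_function N" "real_polynomial_function D"
    "\<And>x. x \<in> X \<Longrightarrow> H x \<noteq> 0 \<Longrightarrow> D x \<noteq> 0 \<and> p (sect x) = N x / D x"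
proof -
  obtain N D where "real_polynomial_function N" "real_polynomial_function D"
    "\<And>x. (\<forall>i. Q i x \<noteq> 0) \<Longrightarrow> D x \<noteq> 0 \<and> p (\<chi> i. P i x / Q i x) = N x / D x"
    using rational_composition[of P Q p, OF P Q assms] by blast
  then show ?thesis using that[of N D] Q_nz unfolding sect_def by blast
qed

text \<open>If \<open>h\<close> witnesses that a small ball around \<open>y\<close> is large in \<open>Y\<close>, then the numerator of \<open>h\<close> composed
  with the inverse map, multiplied by \<open>H\<close>, is a witness for the ball around the image.\<close>

lemma central_image:
  assumes y: "central Y y"
  shows "central X (F y)"
  unfolding central_def
proof (intro conjI allI impI)
  have yY: "y \<in> Y" using y by (simp add: central_def)
  then show "F y \<in> X" by (rule F_X)
  fix \<epsilon> :: real assume "\<epsilon> > 0"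
  have "isCont F y"
    using continuous_on_polymonial_function[OF F(1), of UNIV]
    by (simp add: continuous_on_eq_continuous_at)
  then obtain \<delta> where \<delta>: "\<delta> > 0" "\<And>z. dist z y < \<delta> \<Longrightarrow> dist (F z) (F y) < \<epsilon>"
    using \<open>\<epsilon> > 0\<close> unfolding continuous_at_eps_delta by blast
  obtain h where h: "real_polynomial_function h" "h \<notin> vanishing Y"
    "\<forall>p\<in>vanishing (Y \<inter> ball y \<delta>). p * h \<in> vanishing Y"
    using y \<delta>(1) unfolding central_def by blast
  obtain N D where ND: "real_polynomial_function N" "real_polynomial_function D"
    "\<And>x. x \<in> X \<Longrightarrow> H x \<noteq> 0 \<Longrightarrow> D x \<noteq> 0 \<and> h (sect x) = N x / D x"
    using rational_pullback[OF h(1)] by blast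
  have NH: "real_polynomial_function (N * H)" by (rule rpf_times[OF ND(1) H_rpf])
  have "N * H \<notin> vanishing X"
  proof
    assume "N * H \<in> vanishing X"
    then have N0: "N x = 0" if "x \<in> X" for x
      using nonzerodivisor_onD(2)[OF HX ND(1)] that by (auto simp: vanishing_def)
    have "h z * H (F z) = 0" if z: "z \<in> Y" for z
    proof (cases "H (F z) = 0")
      case False
      have "h z = N (F z) / D (F z)" using ND(3)[OF F_X[OF z] False] sect_inverse(3)[OF z False] by simp
      then show ?thesis using N0[OF F_X[OF z]] by simp
    qed simp
    then have "h z = 0" if "z \<in> Y" for z using nonzerodivisor_onD(2)[OF HY h(1)] that by blast
    then show False using h(1,2) by (auto simp: vanishing_def)
  qed
  moreover have "p * (N * H) \<in> vanishing X" if p: "p \<in> vanishing (X \<inter> ball (F y) \<epsilon>)" for p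
  proof -
    have pr: "real_polynomial_function p" using p by (simp add: vanishing_def)
    have "(\<lambda>z. p (F z)) \<in> vanishing (Y \<inter> ball y \<delta>)"
      using p \<delta>(2) F_X rpf_compose[OF F(1) pr] by (auto simp: vanishing_def dist_commute)
    then have *: "p (F z) * h z = 0" if "z \<in> Y" for z
      using h(3) that by (fastforce simp: vanishing_def)
    have "(p * (N * H)) x = 0" if x: "x \<in> X" for x
    proof (cases "H x = 0")
      case False
      then have "p x * (N x / D x) = 0" "D x \<noteq> 0"
        using *[OF sect_inverse(1)[OF x False]] sect_inverse(2)[OF x False] ND(3)[OF x False] by auto
      then show ?thesis by auto
    qed simp
    then show ?thesis using rpf_times[OF pr NH] unfolding vanishing_def by blast
  qed
  ultimately show "\<exists>h. real_polynomial_function h \<and> h \<notin> vanishing X \<and>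
     (\<forall>p\<in>vanishing (X \<inter> ball (F y) \<epsilon>). p * h \<in> vanishing X)" using NH by blast
qed

text \<open>Here the witness on \<open>Y\<close> is the pullback of the witness on \<open>X\<close>.\<close>

lemma central_section:
  assumes x: "central X x" and Hx: "H x \<noteq> 0"
  shows "central Y (sect x)"
  unfolding central_def
proof (intro conjI allI impI)
  have xX: "x \<in> X" using x by (simp add: central_def)
  show "sect x \<in> Y" by (rule sect_inverse(1)[OF xX Hx])
  fix \<epsilon> :: real assume "\<epsilon> > 0"
  have cont_poly: "isCont p x" if "real_polynomial_function p" for p
    using continuous_on_polymonial_function[of p UNIV] that
    by (simp add: continuous_on_eq_continuous_at real_polynomial_function_eq)
  have "isCont sect x"
    unfolding sect_def isCont_def
    by (intro tendsto_vec_lambda tendsto_divide cont_poly[unfolded isCont_def] P Q Q_nz[OF xX Hx])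
  then obtain \<delta> where \<delta>: "\<delta> > 0" "\<And>z. dist z x < \<delta> \<Longrightarrow> dist (sect z) (sect x) < \<epsilon>"
    using \<open>\<epsilon> > 0\<close> unfolding continuous_at_eps_delta by blast
  obtain h where h: "real_polynomial_function h" "h \<notin> vanishing X"
    "\<forall>p\<in>vanishing (X \<inter> ball x \<delta>). p * h \<in> vanishing X"
    using x \<delta>(1) unfolding central_def by blast
  let ?h = "\<lambda>y. h (F y)"
  have hF: "real_polynomial_function ?h" by (rule rpf_compose[OF F(1) h(1)])
  have "?h \<notin> vanishing Y"
  proof
    assume h0: "?h \<in> vanishing Y"
    have "h z * H z = 0" if z: "z \<in> X" for z
    proof (cases "H z = 0")
      case False
      then show ?thesis using h0 sect_inverse(1,2)[OF z False] by (auto simp: vanishing_def)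
    qed simp
    then have "h z = 0" if "z \<in> X" for z using nonzerodivisor_onD(2)[OF HX h(1)] that by blast
    then show False using h(1,2) by (auto simp: vanishing_def)
  qed
  moreover have "p * ?h \<in> vanishing Y" if p: "p \<in> vanishing (Y \<inter> ball (sect x) \<epsilon>)" for p
  proof -
    have pr: "real_polynomial_function p" using p by (simp add: vanishing_def)
    obtain N D where ND: "real_polynomial_function N" "real_polynomial_function D"
      "\<And>x. x \<in> X \<Longrightarrow> H x \<noteq> 0 \<Longrightarrow> D x \<noteq> 0 \<and> p (sect x) = N x / D x"
      using rational_pullback[OF pr] by blast
    have "(N * H) z = 0" if z: "z \<in> X \<inter> ball x \<delta>" for z
    proof (cases "H z = 0")
      case False
      have "sect z \<in> Y \<inter> ball (sect x) \<epsilon>"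
        using sect_inverse(1)[of z] \<delta>(2)[of z] z False by (auto simp: dist_commute)
      then have "p (sect z) = 0" using p by (simp add: vanishing_def)
      then show ?thesis using ND(3)[of z] z False by auto
    qed simp
    then have "N * H \<in> vanishing (X \<inter> ball x \<delta>)"
      using rpf_times[OF ND(1) H_rpf] unfolding vanishing_def by blast
    then have "N * H * h \<in> vanishing X" using h(3) by blast
    then have *: "N z * H z * h z = 0" if "z \<in> X" for z using that by (auto simp: vanishing_def)
    have "p z * h (F z) * H (F z) = 0" if z: "z \<in> Y" for z
    proof (cases "H (F z) = 0")
      case False
      have "p z = N (F z) / D (F z)" using ND(3)[OF F_X[OF z] False] sect_inverse(3)[OF z False] by simp
      then show ?thesis using *[OF F_X[OF z]] by auto
    qed simp
    then have "p z * h (F z) = 0" if "z \<in> Y" for z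
      using nonzerodivisor_onD(2)[OF HY rpf_mult[OF pr hF]] that by blast
    then have "(p * ?h) z = 0" if "z \<in> Y" for z using that by simp
    then show ?thesis using rpf_times[OF pr hF] unfolding vanishing_def by blast
  qed
  ultimately show "\<exists>h. real_polynomial_function h \<and> h \<notin> vanishing Y \<and>
     (\<forall>p\<in>vanishing (Y \<inter> ball (sect x) \<epsilon>). p * h \<in> vanishing Y)" using hF by blast
qed

end

text \<open>The isomorphism between dense open subsets only becomes one over a full preimage after removing
  from \<open>X\<close> the closure of the image of the complement in \<open>Y\<close>; the polynomial \<open>a\<close> vanishes on this image.\<close>

lemma birational_chart_exists:
  fixes X :: "(real^'n) set" and Y :: "(real^'m) set"
  assumes algX: "real_algebraic_set X" and algY: "real_algebraic_set Y"
    and pm: "polynomial_map Y X \<pi>" and fin: "finite_map Y X \<pi>" and bir: "birational_map Y X \<pi>"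
  obtains F H P Q where "birational_chart X Y \<pi> F H P Q"
proof -
  have \<pi>: "\<pi> \<in> Y \<rightarrow> X" using pm by (simp add: polynomial_map_def)
  obtain F where F: "polynomial_function F" "\<And>y. y \<in> Y \<Longrightarrow> \<pi> y = F y"
    using pm unfolding polynomial_map_def by blast
  obtain V U where VU: "zariski_dense_open Y V" "zariski_dense_open X U" "bij_betw \<pi> V U"
    "\<forall>i. regular_on U (\<lambda>x. inv_into V \<pi> x $ i)" using bir unfolding birational_map_def by blast
  obtain hV where hV: "nonzerodivisor_on Y hV" "V = {y \<in> Y. hV y \<noteq> 0}"
    using VU(1) unfolding zariski_dense_open_iff by blast
  obtain hU where hU: "nonzerodivisor_on X hU" "U = {x \<in> X. hU x \<noteq> 0}"
    using VU(2) unfolding zariski_dense_open_iff by blast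
  have "\<forall>i. \<exists>pq. real_polynomial_function (fst pq) \<and> real_polynomial_function (snd pq) \<and>
      (\<forall>x\<in>U. snd pq x \<noteq> 0 \<and> inv_into V \<pi> x $ i = fst pq x / snd pq x)"
    using VU(4) unfolding regular_on_def by auto
  from choice[OF this] obtain pq where
    pq: "\<forall>i. real_polynomial_function (fst (pq i)) \<and> real_polynomial_function (snd (pq i)) \<and>
      (\<forall>x\<in>U. snd (pq i) x \<noteq> 0 \<and> inv_into V \<pi> x $ i = fst (pq i) x / snd (pq i) x)" ..
  define P where "P i = fst (pq i)" for i
  define Q where "Q i = snd (pq i)" for i
  have PQ: "real_polynomial_function (P i)" "real_polynomial_function (Q i)"
    "\<And>x. x \<in> U \<Longrightarrow> Q i x \<noteq> 0" for i
    using pq by (auto simp: P_def Q_def)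
  have inv: "(\<chi> i. P i x / Q i x) = inv_into V \<pi> x" if "x \<in> U" for x
    using pq that by (simp add: P_def Q_def vec_eq_iff)
  obtain a where a: "nonzerodivisor_on X a" "\<And>y. y \<in> Y \<Longrightarrow> hV y = 0 \<Longrightarrow> a (\<pi> y) = 0"
    using image_zeros_nonzerodivisor[OF fin \<pi> F hV(1)] by blast
  define H where "H = (\<lambda>x. a x * hU x)"
  have HX: "nonzerodivisor_on X H" unfolding H_def by (rule nonzerodivisor_on_mult[OF a(1) hU(1)])
  have HU: "x \<in> U" if "x \<in> X" "H x \<noteq> 0" for x using that unfolding hU(2) H_def by auto
  have HV: "y \<in> V" if "y \<in> Y" "H (\<pi> y) \<noteq> 0" for y using that a(2) unfolding hV(2) H_def by auto
  have sect_in: "inv_into V \<pi> x \<in> V" "\<pi> (inv_into V \<pi> x) = x" if "x \<in> U" for x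
    using VU(3) that by (auto simp: bij_betw_def intro: inv_into_into f_inv_into_f)
  have sect_\<pi>: "inv_into V \<pi> (\<pi> y) = y" if "y \<in> V" for y
    using VU(3) that by (auto simp: bij_betw_def)
  have HY: "nonzerodivisor_on Y (\<lambda>y. H (F y))"
    unfolding nonzerodivisor_on_def
  proof (intro conjI allI impI ballI)
    show "real_polynomial_function (\<lambda>y. H (F y))"
      by (rule rpf_compose[OF F(1) nonzerodivisor_onD(1)[OF HX]])
    fix p y assume p: "real_polynomial_function p" "\<forall>y\<in>Y. p y * H (F y) = 0" and y: "y \<in> Y"
    obtain N D where ND: "real_polynomial_function N" "real_polynomial_function D"
      "\<And>x. (\<forall>i. Q i x \<noteq> 0) \<Longrightarrow> D x \<noteq> 0 \<and> p (\<chi> i. P i x / Q i x) = N x / D x"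
      using rational_composition[of P Q p, OF PQ(1,2) p(1)] by blast
    have ND': "D x \<noteq> 0" "p (inv_into V \<pi> x) = N x / D x" if "x \<in> U" for x
      using ND(3)[of x] PQ(3)[OF that] inv[OF that] by auto
    have "N x * hU x * H x = 0" if x: "x \<in> X" for x
    proof (cases "x \<in> U")
      case True
      have "inv_into V \<pi> x \<in> Y" using sect_in(1)[OF True] hV(2) by blast
      then have "p (inv_into V \<pi> x) * H x = 0"
        using p(2) F(2) sect_in(2)[OF True] by metis
      then show ?thesis using ND'[OF True] by auto
    next
      case False
      then show ?thesis using x hU(2) by auto
    qed
    then have "N x * hU x = 0" if "x \<in> X" for x
      using nonzerodivisor_onD(2)[OF HX rpf_mult[OF ND(1) nonzerodivisor_onD(1)[OF hU(1)]]] that by blast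
    then have N0: "N x = 0" if "x \<in> X" for x using nonzerodivisor_onD(2)[OF hU(1) ND(1)] that by blast
    have "p z * hV z = 0" if z: "z \<in> Y" for z
    proof (cases "z \<in> V")
      case True
      then have "\<pi> z \<in> U" using VU(3) by (auto simp: bij_betw_def)
      then have "p z = 0" using ND'(2)[of "\<pi> z"] sect_\<pi>[OF True] N0[of "\<pi> z"] hU(2) by auto
      then show ?thesis by simp
    next
      case False
      then show ?thesis using z hV(2) by auto
    qed
    then show "p y = 0" using nonzerodivisor_onD(2)[OF hV(1) p(1)] y by blast
  qed
  have "birational_chart X Y \<pi> F H P Q"
  proof
    show "real_algebraic_set X" "real_algebraic_set Y" "polynomial_function F"
      "nonzerodivisor_on X H" "nonzerodivisor_on Y (\<lambda>y. H (F y))" by fact+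
    show "\<pi> y = F y" if "y \<in> Y" for y using F(2) that .
    show "\<pi> y \<in> X" if "y \<in> Y" for y using \<pi> that by blast
    show "real_polynomial_function (P i)" "real_polynomial_function (Q i)" for i by (rule PQ)+
    show "Q i x \<noteq> 0" if "x \<in> X" "H x \<noteq> 0" for x i using PQ(3)[OF HU[OF that]] .
    show "(\<chi> i. P i x / Q i x) \<in> Y" if "x \<in> X" "H x \<noteq> 0" for x
      using inv[OF HU[OF that]] sect_in(1)[OF HU[OF that]] hV(2) by auto
    show "\<pi> (\<chi> i. P i x / Q i x) = x" if "x \<in> X" "H x \<noteq> 0" for x
      using inv[OF HU[OF that]] sect_in(2)[OF HU[OF that]] by simp
    show "(\<chi> i. P i (\<pi> y) / Q i (\<pi> y)) = y" if "y \<in> Y" "H (\<pi> y) \<noteq> 0" for y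
      using inv[OF HU[of "\<pi> y"]] \<pi> that sect_\<pi>[OF HV[OF that]] by auto
  qed
  then show ?thesis using that by blast
qed

section \<open>Continuous rational functions on the central locus\<close>

definition K0_functions :: "(real^'n) set \<Rightarrow> (real^'n \<Rightarrow> real) set" where
  "K0_functions X = {f \<in> extensional (Cent X). continuous_on (Cent X) f \<and>
     (\<exists>U g. zariski_dense_open X U \<and> regular_on U g \<and> (\<forall>x\<in>U \<inter> Cent X. f x = g x))}"

lemma K0_Cent_eq: "K0_Cent X = function_ring (Cent X) (K0_functions X)"
  by (simp add: K0_Cent_def K0_functions_def)

lemma K0_functionsI:
  assumes "f \<in> extensional (Cent X)" "continuous_on (Cent X) f" "nonzerodivisor_on X h"
    "real_polynomial_function p" "real_polynomial_function q"
    "\<And>x. x \<in> X \<Longrightarrow> h x \<noteq> 0 \<Longrightarrow> q x \<noteq> 0" "\<And>x. x \<in> Cent X \<Longrightarrow> h x \<noteq> 0 \<Longrightarrow> f x = p x / q x"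
  shows "f \<in> K0_functions X"
proof -
  have "zariski_dense_open X {x \<in> X. h x \<noteq> 0}"
    unfolding zariski_dense_open_iff using assms(3) by blast
  moreover have "regular_on {x \<in> X. h x \<noteq> 0} (\<lambda>x. p x / q x)"
    unfolding regular_on_def using assms(4-6) by blast
  moreover have "\<forall>x\<in>{x \<in> X. h x \<noteq> 0} \<inter> Cent X. f x = p x / q x" using assms(7) by blast
  ultimately show ?thesis unfolding K0_functions_def using assms(1,2) by blast
qed

lemma K0_functionsD:
  assumes "f \<in> K0_functions X"
  shows "\<exists>h p q. nonzerodivisor_on X h \<and> real_polynomial_function p \<and> real_polynomial_function q \<and>
    (\<forall>x\<in>X. h x \<noteq> 0 \<longrightarrow> q x \<noteq> 0) \<and> (\<forall>x\<in>Cent X. h x \<noteq> 0 \<longrightarrow> f x = p x / q x)"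
proof -
  obtain U g where f: "zariski_dense_open X U" "regular_on U g" "\<forall>x\<in>U \<inter> Cent X. f x = g x"
    using assms unfolding K0_functions_def by blast
  obtain h where h: "nonzerodivisor_on X h" "U = {x \<in> X. h x \<noteq> 0}"
    using f(1) unfolding zariski_dense_open_iff by blast
  obtain p q where pq: "real_polynomial_function p" "real_polynomial_function q"
    "\<forall>x\<in>U. q x \<noteq> 0 \<and> g x = p x / q x" using f(2) unfolding regular_on_def by blast
  have "\<forall>x\<in>X. h x \<noteq> 0 \<longrightarrow> q x \<noteq> 0" using pq(3) h(2) by blast
  moreover have "f x = p x / q x" if x: "x \<in> Cent X" "h x \<noteq> 0" for x
  proof -
    have "x \<in> U" using h(2) x Cent_subset by blast
    then show ?thesis using pq(3) f(3) x(1) by auto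
  qed
  ultimately show ?thesis using h(1) pq(1,2) by blast
qed

lemma nonzerodivisor_on_one: "nonzerodivisor_on X (\<lambda>_. 1)"
  unfolding nonzerodivisor_on_def by (simp add: rpf_const)

lemma continuous_on_restrict_iff: "continuous_on D (restrict f D) \<longleftrightarrow> continuous_on D f"
  by (rule continuous_on_cong) auto

lemma polynomial_continuous_on: "real_polynomial_function p \<Longrightarrow> continuous_on S p"
  by (intro continuous_on_polymonial_function) (simp add: real_polynomial_function_eq)

lemma polys_on_K0: "polys_on (Cent X) \<subseteq> K0_functions X"
proof
  fix f assume "f \<in> polys_on (Cent X)"
  then obtain p where p: "real_polynomial_function p" "f = restrict p (Cent X)" by (rule polys_onE)
  show "f \<in> K0_functions X"
    by (rule K0_functionsI[OF _ _ nonzerodivisor_on_one p(1) rpf_const[of 1]])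
       (auto simp: p(2) continuous_on_restrict_iff polynomial_continuous_on[OF p(1)])
qed

lemma function_subring_K0: "function_subring (Cent X) (K0_functions X)"
proof
  show "K0_functions X \<subseteq> extensional (Cent X)" by (auto simp: K0_functions_def)
  show "(\<lambda>x\<in>Cent X. c) \<in> K0_functions X" for c
    using polys_on_K0 polys_onI[OF rpf_const[of c]] by blast
next
  fix f g assume "f \<in> K0_functions X" "g \<in> K0_functions X"
  have cont: "continuous_on (Cent X) f" "continuous_on (Cent X) g"
    using \<open>f \<in> K0_functions X\<close> \<open>g \<in> K0_functions X\<close> by (auto simp: K0_functions_def)
  obtain h p q where f: "nonzerodivisor_on X h" "real_polynomial_function p" "real_polynomial_function q"
    "\<forall>x\<in>X. h x \<noteq> 0 \<longrightarrow> q x \<noteq> 0" "\<forall>x\<in>Cent X. h x \<noteq> 0 \<longrightarrow> f x = p x / q x"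
    using K0_functionsD[OF \<open>f \<in> K0_functions X\<close>] by blast
  obtain k r s where g: "nonzerodivisor_on X k" "real_polynomial_function r" "real_polynomial_function s"
    "\<forall>x\<in>X. k x \<noteq> 0 \<longrightarrow> s x \<noteq> 0" "\<forall>x\<in>Cent X. k x \<noteq> 0 \<longrightarrow> g x = r x / s x"
    using K0_functionsD[OF \<open>g \<in> K0_functions X\<close>] by blast
  have X: "x \<in> X" if "x \<in> Cent X" for x using that Cent_subset by blast
  show "(\<lambda>x\<in>Cent X. f x + g x) \<in> K0_functions X"
  proof (rule K0_functionsI[OF _ _ nonzerodivisor_on_mult[OF f(1) g(1)]])
    show "real_polynomial_function (\<lambda>x. p x * s x + r x * q x)" "real_polynomial_function (\<lambda>x. q x * s x)"
      by (intro rpf_add rpf_mult f g)+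
    show "continuous_on (Cent X) (\<lambda>x\<in>Cent X. f x + g x)"
      unfolding continuous_on_restrict_iff by (intro continuous_on_add cont)
  qed (use f(4,5) g(4,5) X in \<open>auto simp: add_frac_eq\<close>)
  show "(\<lambda>x\<in>Cent X. f x * g x) \<in> K0_functions X"
  proof (rule K0_functionsI[OF _ _ nonzerodivisor_on_mult[OF f(1) g(1)]])
    show "real_polynomial_function (\<lambda>x. p x * r x)" "real_polynomial_function (\<lambda>x. q x * s x)"
      by (intro rpf_mult f g)+
    show "continuous_on (Cent X) (\<lambda>x\<in>Cent X. f x * g x)"
      unfolding continuous_on_restrict_iff by (intro continuous_on_mult cont)
  qed (use f(4,5) g(4,5) X in auto)
qed

context function_subring
begin

lemma pow_R: "f \<in> F \<Longrightarrow> f [^]\<^bsub>R\<^esub> (n::nat) = (\<lambda>x\<in>D. f x ^ n)"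
proof (induction n)
  case 0
  then show ?case by (simp add: function_ring_def)
next
  case (Suc n)
  interpret cring R by (rule cring_R)
  have "f [^]\<^bsub>R\<^esub> Suc n = f [^]\<^bsub>R\<^esub> n \<otimes>\<^bsub>R\<^esub> f" by simp
  also have "\<dots> = (\<lambda>x\<in>D. f x ^ Suc n)" unfolding Suc.IH[OF Suc.prems]
    by (auto simp: fun_eq_iff mult.commute)
  finally show ?case .
qed

lemma power_mem: "f \<in> F \<Longrightarrow> (\<lambda>x\<in>D. f x ^ n) \<in> F"
proof -
  assume f: "f \<in> F"
  interpret cring R by (rule cring_R)
  have "f [^]\<^bsub>R\<^esub> n \<in> F" using f nat_pow_closed[of f n] by simp
  then show ?thesis using pow_R[OF f] by simp
qed

lemma finsum_R:
  assumes "finite I" "\<And>i. i \<in> I \<Longrightarrow> h i \<in> F"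
  shows "(\<Oplus>\<^bsub>R\<^esub>i\<in>I. h i) = (\<lambda>x\<in>D. \<Sum>i\<in>I. h i x)"
proof -
  interpret cring R by (rule cring_R)
  show ?thesis
    using assms
  proof (induction I rule: finite_induct)
    case empty
    then show ?case by simp
  next
    case (insert j I)
    have "(\<Oplus>\<^bsub>R\<^esub>i\<in>insert j I. h i) = h j \<oplus>\<^bsub>R\<^esub> (\<Oplus>\<^bsub>R\<^esub>i\<in>I. h i)"
      using insert by (intro finsum_insert) auto
    also have "(\<Oplus>\<^bsub>R\<^esub>i\<in>I. h i) = (\<lambda>x\<in>D. \<Sum>i\<in>I. h i x)" using insert by auto
    finally show ?case using insert by (auto simp: fun_eq_iff)
  qed
qed

end

lemma (in function_subring) integral_closure_iff:
  fixes f :: "'a \<Rightarrow> real"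
  assumes f: "f \<in> F" and B: "B \<subseteq> F"
  shows "f \<in> integral_closure R B \<longleftrightarrow>
    (\<exists>n a. (\<forall>i<n. a i \<in> B) \<and> (\<forall>x\<in>D. f x ^ n + (\<Sum>i<n. a i x * f x ^ i) = 0))"
proof -
  have "f [^]\<^bsub>R\<^esub> n \<oplus>\<^bsub>R\<^esub> (\<Oplus>\<^bsub>R\<^esub>i\<in>{..<n}. a i \<otimes>\<^bsub>R\<^esub> f [^]\<^bsub>R\<^esub> i) = \<zero>\<^bsub>R\<^esub> \<longleftrightarrow>
      (\<forall>x\<in>D. f x ^ n + (\<Sum>i<n. a i x * f x ^ i) = 0)"
    if a: "\<forall>i<n. a i \<in> B" for n :: nat and a
  proof -
    have summand: "a i \<otimes>\<^bsub>R\<^esub> f [^]\<^bsub>R\<^esub> i = (\<lambda>x\<in>D. a i x * f x ^ i)" for i :: nat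
      unfolding pow_R[OF f] by (auto simp: fun_eq_iff)
    have mem: "(\<lambda>x\<in>D. a i x * f x ^ i) \<in> F" if "i \<in> {..<n}" for i
    proof -
      have "(\<lambda>x\<in>D. a i x * (\<lambda>x\<in>D. f x ^ i) x) \<in> F"
        using a that B by (intro mult_mem power_mem f) auto
      moreover have "(\<lambda>x\<in>D. a i x * (\<lambda>x\<in>D. f x ^ i) x) = (\<lambda>x\<in>D. a i x * f x ^ i)"
        by (auto simp: fun_eq_iff)
      ultimately show ?thesis by simp
    qed
    have "(\<Oplus>\<^bsub>R\<^esub>i\<in>{..<n}. a i \<otimes>\<^bsub>R\<^esub> f [^]\<^bsub>R\<^esub> i) = (\<lambda>x\<in>D. \<Sum>i<n. (\<lambda>x\<in>D. a i x * f x ^ i) x)"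
      unfolding summand by (rule finsum_R) (use mem in auto)
    then have "f [^]\<^bsub>R\<^esub> n \<oplus>\<^bsub>R\<^esub> (\<Oplus>\<^bsub>R\<^esub>i\<in>{..<n}. a i \<otimes>\<^bsub>R\<^esub> f [^]\<^bsub>R\<^esub> i) =
        (\<lambda>x\<in>D. f x ^ n + (\<Sum>i<n. a i x * f x ^ i))"
      unfolding pow_R[OF f] by (auto simp: fun_eq_iff)
    then show ?thesis unfolding R_simps(5) by (simp add: restrict_eq_iff)
  qed
  then have "(\<exists>(n::nat) a. (\<forall>i<n. a i \<in> B) \<and>
        f [^]\<^bsub>R\<^esub> n \<oplus>\<^bsub>R\<^esub> (\<Oplus>\<^bsub>R\<^esub>i\<in>{..<n}. a i \<otimes>\<^bsub>R\<^esub> f [^]\<^bsub>R\<^esub> i) = \<zero>\<^bsub>R\<^esub>) \<longleftrightarrow>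
    (\<exists>n a. (\<forall>i<n. a i \<in> B) \<and> (\<forall>x\<in>D. f x ^ n + (\<Sum>i<n. a i x * f x ^ i) = 0))"
    by blast
  then show ?thesis unfolding integral_closure_def using f by simp
qed

lemma integral_relation_iff:
  fixes D :: "(real^'n) set"
  shows "(\<exists>n a. (\<forall>i<n. a i \<in> polys_on D) \<and> (\<forall>x\<in>D. f x ^ n + (\<Sum>i<n. a i x * f x ^ i) = 0))
    \<longleftrightarrow> integral_on D (\<lambda>x. x) f"
proof
  assume "\<exists>n a. (\<forall>i<n. a i \<in> polys_on D) \<and> (\<forall>x\<in>D. f x ^ n + (\<Sum>i<n. a i x * f x ^ i) = 0)"
  then obtain n :: nat and a where a: "\<forall>i<n. a i \<in> polys_on D"
    "\<forall>x\<in>D. f x ^ n + (\<Sum>i<n. a i x * f x ^ i) = 0" by blast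
  have "\<forall>i. \<exists>p. real_polynomial_function p \<and> (i < n \<longrightarrow> a i = restrict p D)"
    using a(1) polys_onE rpf_const by metis
  from choice[OF this] obtain p where
    p: "\<forall>i. real_polynomial_function (p i) \<and> (i < n \<longrightarrow> a i = restrict (p i) D)" ..
  have "f x ^ n = (\<Sum>i<n. - p i x * f x ^ i)" if x: "x \<in> D" for x
  proof -
    have "(\<Sum>i<n. a i x * f x ^ i) = (\<Sum>i<n. p i x * f x ^ i)"
      using p x by (intro sum.cong) auto
    moreover have "f x ^ n + (\<Sum>i<n. a i x * f x ^ i) = 0" using a(2) x by blast
    ultimately show ?thesis by (simp add: sum_negf eq_neg_iff_add_eq_0)
  qed
  then show "integral_on D (\<lambda>x. x) f"
    unfolding integral_on_def using p real_polynomial_function_minus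
    by (intro exI[of _ n] exI[of _ "\<lambda>i x. - p i x"]) auto
next
  assume "integral_on D (\<lambda>x. x) f"
  then obtain n a where a: "\<forall>i. real_polynomial_function (a i)"
    "\<forall>x\<in>D. f x ^ n = (\<Sum>i<n. a i x * f x ^ i)" unfolding integral_on_def by blast
  have "restrict (\<lambda>x. - a i x) D \<in> polys_on D" for i
    using a(1) real_polynomial_function_minus by (intro polys_onI) blast
  moreover have "f x ^ n + (\<Sum>i<n. restrict (\<lambda>x. - a i x) D x * f x ^ i) = 0" if "x \<in> D" for x
    using a(2) that by (simp add: sum_negf)
  ultimately show "\<exists>n a. (\<forall>i<n. a i \<in> polys_on D) \<and> (\<forall>x\<in>D. f x ^ n + (\<Sum>i<n. a i x * f x ^ i) = 0)"
    by (intro exI[of _ n] exI[of _ "\<lambda>i. restrict (\<lambda>x. - a i x) D"]) blast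
qed

lemma integral_closure_K0:
  "integral_closure (K0_Cent X) (polys_on (Cent X)) =
     {f \<in> K0_functions X. integral_on (Cent X) (\<lambda>x. x) f}"
proof -
  interpret function_subring "Cent X" "K0_functions X" by (rule function_subring_K0)
  have car: "integral_closure R (polys_on (Cent X)) \<subseteq> K0_functions X"
    unfolding integral_closure_def by auto
  show ?thesis
    unfolding K0_Cent_eq
    using car integral_closure_iff[OF _ polys_on_K0] integral_relation_iff[of "Cent X"] by blast
qed

section \<open>Transfer along the ring isomorphism of the weak normalization\<close>

text \<open>The ring isomorphism \<open>\<phi>\<close> turns continuous rational functions on the central locus into polynomial
  functions on \<open>W\<close>.\<close>

locale weak_normalization =
  fixes X :: "(real^'n) set" and W :: "(real^'l) set" and \<pi>w :: "real^'l \<Rightarrow> real^'n"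
    and \<phi> :: "(real^'n \<Rightarrow> real) \<Rightarrow> real^'l \<Rightarrow> real"
  assumes \<phi>: "\<phi> \<in> ring_iso
      (K0_Cent X \<lparr>carrier := integral_closure (K0_Cent X) (polys_on (Cent X))\<rparr>) (poly_fun_ring W)"
    and \<phi>_poly: "\<And>p. real_polynomial_function p \<Longrightarrow>
      \<phi> (restrict p (Cent X)) = restrict (p \<circ> \<pi>w) W"
begin

abbreviation "integral_K0 \<equiv> {f \<in> K0_functions X. integral_on (Cent X) (\<lambda>x. x) f}"

lemma \<phi>_bij: "bij_betw \<phi> integral_K0 (polys_on W)"
  using \<phi> unfolding ring_iso_def integral_closure_K0
  by (simp add: poly_fun_ring_def function_ring_def)

lemma \<phi>_add_mult:
  assumes "u \<in> integral_K0" "v \<in> integral_K0"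
  shows "\<phi> (\<lambda>x\<in>Cent X. u x + v x) = (\<lambda>w\<in>W. \<phi> u w + \<phi> v w)"
    "\<phi> (\<lambda>x\<in>Cent X. u x * v x) = (\<lambda>w\<in>W. \<phi> u w * \<phi> v w)"
  using \<phi> assms unfolding ring_iso_def ring_hom_def integral_closure_K0
  by (auto simp: poly_fun_ring_def K0_Cent_eq function_ring_def)

definition corresponds :: "(real^'n \<Rightarrow> real) \<Rightarrow> (real^'l \<Rightarrow> real) \<Rightarrow> bool" where
  "corresponds u v \<longleftrightarrow> restrict u (Cent X) \<in> integral_K0 \<and> \<phi> (restrict u (Cent X)) = restrict v W"

lemma corresponds_eq_iff:
  assumes "corresponds u v" "corresponds u' v'"
  shows "(\<forall>x\<in>Cent X. u x = u' x) \<longleftrightarrow> (\<forall>w\<in>W. v w = v' w)"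
proof -
  have "restrict u (Cent X) = restrict u' (Cent X) \<longleftrightarrow>
      \<phi> (restrict u (Cent X)) = \<phi> (restrict u' (Cent X))"
    using inj_on_eq_iff[OF bij_betw_imp_inj_on[OF \<phi>_bij]] assms unfolding corresponds_def by blast
  then show ?thesis
    using assms unfolding corresponds_def by (simp add: restrict_eq_iff)
qed

lemma integral_K0_closed:
  assumes "u \<in> integral_K0" "v \<in> integral_K0"
  shows "(\<lambda>x\<in>Cent X. u x + v x) \<in> integral_K0" "(\<lambda>x\<in>Cent X. u x * v x) \<in> integral_K0"
proof -
  interpret function_subring "Cent X" "K0_functions X" by (rule function_subring_K0)
  have "integral_on (Cent X) (\<lambda>x. x) (\<lambda>x. u x + v x)" "integral_on (Cent X) (\<lambda>x. x) (\<lambda>x. u x * v x)"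
    using assms by (auto intro: integral_on_add_mult)
  then have "integral_on (Cent X) (\<lambda>x. x) (\<lambda>x\<in>Cent X. u x + v x)"
    "integral_on (Cent X) (\<lambda>x. x) (\<lambda>x\<in>Cent X. u x * v x)"
    by (simp_all add: integral_on_def)
  then show "(\<lambda>x\<in>Cent X. u x + v x) \<in> integral_K0" "(\<lambda>x\<in>Cent X. u x * v x) \<in> integral_K0"
    using assms add_mem mult_mem by auto
qed

lemma corresponds_add:
  assumes "corresponds u v" "corresponds u' v'"
  shows "corresponds (\<lambda>x. u x + u' x) (\<lambda>w. v w + v' w)"
proof -
  let ?u = "restrict u (Cent X)" and ?u' = "restrict u' (Cent X)"
  have eq: "restrict (\<lambda>x. u x + u' x) (Cent X) = (\<lambda>x\<in>Cent X. ?u x + ?u' x)"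
    by (auto simp: restrict_eq_iff)
  show ?thesis
    unfolding corresponds_def eq
    using integral_K0_closed(1)[of ?u ?u'] \<phi>_add_mult(1)[of ?u ?u'] assms
    unfolding corresponds_def by (simp add: restrict_eq_iff)
qed

lemma corresponds_mult:
  assumes "corresponds u v" "corresponds u' v'"
  shows "corresponds (\<lambda>x. u x * u' x) (\<lambda>w. v w * v' w)"
proof -
  let ?u = "restrict u (Cent X)" and ?u' = "restrict u' (Cent X)"
  have eq: "restrict (\<lambda>x. u x * u' x) (Cent X) = (\<lambda>x\<in>Cent X. ?u x * ?u' x)"
    by (auto simp: restrict_eq_iff)
  show ?thesis
    unfolding corresponds_def eq
    using integral_K0_closed(2)[of ?u ?u'] \<phi>_add_mult(2)[of ?u ?u'] assms
    unfolding corresponds_def by (simp add: restrict_eq_iff)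
qed

lemma corresponds_polynomial:
  assumes p: "real_polynomial_function p"
  shows "corresponds p (\<lambda>w. p (\<pi>w w))"
proof -
  have "integral_on (Cent X) (\<lambda>x. x) (restrict p (Cent X))"
    using integral_on_polynomial[OF p, of "Cent X" "\<lambda>x. x"] by (simp add: integral_on_def)
  then show ?thesis
    unfolding corresponds_def using polys_on_K0 polys_onI[OF p] \<phi>_poly[OF p] by (auto simp: o_def)
qed

lemma corresponds_const: "corresponds (\<lambda>_. c) (\<lambda>_. c)"
  using corresponds_polynomial[OF rpf_const[of c]] .

text \<open>A polynomial identity between the coordinates of a map on \<open>Cent X\<close> holds if and only if it holds
  between the corresponding functions on \<open>W\<close>.  The functions in question stay integral because sums
  and products of integral functions are integral.\<close>

lemma corresponds_compose:
  fixes f :: "real^'n \<Rightarrow> real^'m" and g :: "real^'l \<Rightarrow> real^'m"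
  assumes fg: "\<And>i. corresponds (\<lambda>x. f x $ i) (\<lambda>w. g w $ i)" and p: "real_polynomial_function p"
  shows "corresponds (\<lambda>x. p (f x)) (\<lambda>w. p (g w))"
  using p
proof induction
  case (linear L)
  have expand: "L v = (\<Sum>i\<in>UNIV. v $ i * L (axis i 1))" for v
    by (rule linear_functional_expand[OF bounded_linear.linear[OF linear]])
  have "corresponds (\<lambda>x. \<Sum>i\<in>I. f x $ i * L (axis i 1)) (\<lambda>w. \<Sum>i\<in>I. g w $ i * L (axis i 1))"
    if "finite I" for I
    using that
  proof (induction I rule: finite_induct)
    case empty
    show ?case using corresponds_const[of 0] by simp
  next
    case (insert j I)
    have "corresponds (\<lambda>x. f x $ j * L (axis j 1)) (\<lambda>w. g w $ j * L (axis j 1))"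
      by (intro corresponds_mult fg corresponds_const)
    from corresponds_add[OF this insert.IH] show ?case using insert.hyps by simp
  qed
  from this[of UNIV] show ?case unfolding expand[of "f _"] expand[of "g _"] by simp
qed (auto intro: corresponds_const corresponds_add corresponds_mult)

end

section \<open>Properness of finite maps\<close>

lemma monic_root_bound:
  fixes t :: real
  assumes eq: "t ^ n = (\<Sum>i<n. a i * t ^ i)"
  shows "\<bar>t\<bar> \<le> max 1 (\<Sum>i<n. \<bar>a i\<bar>)"
proof (cases "\<bar>t\<bar> \<le> 1")
  case False
  then have t: "\<bar>t\<bar> > 1" by simp
  obtain m where m: "n = Suc m" using eq by (cases n) auto
  have "\<bar>t\<bar> * \<bar>t\<bar> ^ m = \<bar>t ^ n\<bar>" by (simp add: m abs_mult power_abs)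
  also have "\<dots> = \<bar>\<Sum>i<n. a i * t ^ i\<bar>" unfolding eq ..
  also have "\<dots> \<le> (\<Sum>i<n. \<bar>a i * t ^ i\<bar>)" by (rule sum_abs)
  also have "\<dots> \<le> (\<Sum>i<n. \<bar>a i\<bar> * \<bar>t\<bar> ^ m)"
  proof (rule sum_mono)
    fix i assume "i \<in> {..<n}"
    then have "\<bar>t\<bar> ^ i \<le> \<bar>t\<bar> ^ m" using t m by (intro power_increasing) auto
    then show "\<bar>a i * t ^ i\<bar> \<le> \<bar>a i\<bar> * \<bar>t\<bar> ^ m"
      by (simp add: abs_mult power_abs mult_left_mono)
  qed
  also have "\<dots> = (\<Sum>i<n. \<bar>a i\<bar>) * \<bar>t\<bar> ^ m" by (simp add: sum_distrib_right)
  finally have "\<bar>t\<bar> \<le> (\<Sum>i<n. \<bar>a i\<bar>)" using t by (simp add: mult_le_cancel_right)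
  then show ?thesis by simp
qed simp

text \<open>The coordinates of a point of \<open>Y\<close> are roots of monic polynomials whose coefficients depend
  continuously on the image in \<open>X\<close>.\<close>

lemma finite_map_preimage_bounded:
  fixes Y :: "(real^'m) set" and X :: "(real^'n) set"
  assumes fin: "finite_map Y X \<pi>" and \<pi>: "\<pi> \<in> Y \<rightarrow> X" and K: "compact K"
  shows "bounded {y \<in> Y. \<pi> y \<in> K}"
proof -
  have "\<exists>B. \<forall>y\<in>{y \<in> Y. \<pi> y \<in> K}. \<bar>y $ i\<bar> \<le> B" for i
  proof -
    obtain n a where a: "\<And>k. real_polynomial_function (a k)"
      "\<And>y. y \<in> Y \<Longrightarrow> (y $ i) ^ n = (\<Sum>k<n. a k (\<pi> y) * (y $ i) ^ k)"
      using finite_map_integral[OF fin \<pi> rpf_coord[of i]] unfolding integral_on_def by blast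
    have "continuous_on K (\<lambda>z. max 1 (\<Sum>k<n. \<bar>a k z\<bar>))"
      by (intro continuous_intros polynomial_continuous_on a)
    then have "bounded ((\<lambda>z. max 1 (\<Sum>k<n. \<bar>a k z\<bar>)) ` K)"
      by (intro compact_imp_bounded compact_continuous_image K)
    then obtain B where B: "\<forall>z\<in>K. \<bar>max 1 (\<Sum>k<n. \<bar>a k z\<bar>)\<bar> \<le> B"
      unfolding bounded_iff by auto
    have "\<bar>y $ i\<bar> \<le> B" if y: "y \<in> Y" "\<pi> y \<in> K" for y
    proof -
      have "\<bar>y $ i\<bar> \<le> max 1 (\<Sum>k<n. \<bar>a k (\<pi> y)\<bar>)"
        by (rule monic_root_bound[OF a(2)[OF y(1)]])
      also have "\<dots> \<le> B" using B y(2) by (meson abs_le_D1)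
      finally show ?thesis .
    qed
    then show ?thesis by blast
  qed
  then obtain B where B: "\<And>i y. y \<in> Y \<Longrightarrow> \<pi> y \<in> K \<Longrightarrow> \<bar>y $ i\<bar> \<le> B i"
    by (metis (mono_tags, lifting) mem_Collect_eq)
  show ?thesis
    unfolding bounded_iff
  proof (intro exI ballI)
    fix y assume y: "y \<in> {y \<in> Y. \<pi> y \<in> K}"
    have "norm y \<le> (\<Sum>i\<in>UNIV. \<bar>y $ i\<bar>)" by (rule norm_le_l1_cart)
    also have "\<dots> \<le> (\<Sum>i\<in>UNIV. B i)" using y B by (intro sum_mono) auto
    finally show "norm y \<le> (\<Sum>i\<in>UNIV. B i)" .
  qed
qed

lemma continuous_limit_in_closed:
  fixes f :: "'a::metric_space \<Rightarrow> 'b::metric_space"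
  assumes f: "continuous_on C f" and S: "closed S" and D: "D \<subseteq> C" "\<And>x. x \<in> D \<Longrightarrow> f x \<in> S"
    and x: "x \<in> C" "x \<in> closure D"
  shows "f x \<in> S"
proof -
  obtain s where s: "\<And>n. s n \<in> D" "s \<longlonglongrightarrow> x" using x(2) unfolding closure_sequential by blast
  have "\<forall>\<^sub>F n in sequentially. s n \<in> C" using s(1) D(1) by (intro always_eventually) blast
  then have "(\<lambda>n. f (s n)) \<longlonglongrightarrow> f x" by (rule continuous_on_tendsto_compose[OF f s(2) x(1)])
  then show ?thesis using closed_sequentially[OF S, of "\<lambda>n. f (s n)"] s(1) D(2) by blast
qed

text \<open>Over a closed ball, \<open>\<pi>\<close> restricts to a continuous injection of a compact set.\<close>

lemma continuous_inverse_of_finite_map: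
  fixes Y :: "(real^'m) set" and X :: "(real^'n) set"
  assumes fin: "finite_map Y X \<pi>" and \<pi>: "\<pi> \<in> Y \<rightarrow> X"
    and F: "polynomial_function F" "\<And>y. y \<in> Y \<Longrightarrow> \<pi> y = F y"
    and S: "closed S" "S \<subseteq> Y" and bij: "bij_betw \<pi> S C"
  shows "continuous_on C (inv_into S \<pi>)"
proof -
  let ?f = "inv_into S \<pi>"
  have image: "\<pi> ` S = C" using bij by (rule bij_betw_imp_surj_on)
  have f: "?f x \<in> S" "F (?f x) = x" if x: "x \<in> C" for x
  proof -
    show S': "?f x \<in> S" using x image inv_into_into by metis
    have "\<pi> (?f x) = x" using x image f_inv_into_f by metis
    then show "F (?f x) = x" using F(2)[of "?f x"] S(2) S' by auto
  qed
  have fF: "?f (F y) = y" "F y \<in> C" if "y \<in> S" for y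
  proof -
    have "F y = \<pi> y" using F(2)[of y] S(2) that by auto
    then show "?f (F y) = y" "F y \<in> C"
      using inv_into_f_f[OF bij_betw_imp_inj_on[OF bij] that] image that by auto
  qed
  have contF: "continuous_on A F" for A by (rule continuous_on_polymonial_function[OF F(1)])
  have "continuous (at x within C) ?f" if x: "x \<in> C" for x
  proof -
    define K where "K = S \<inter> F -` cball x 1"
    have "closed (F -` cball x 1)"
      using contF[of UNIV] by (intro continuous_closed_vimage) (auto simp: continuous_on_eq_continuous_at)
    then have "closed K" unfolding K_def using S(1) by (intro closed_Int)
    moreover have "bounded K"
    proof (rule bounded_subset[OF finite_map_preimage_bounded[OF fin \<pi> compact_cball]])
      show "K \<subseteq> {y \<in> Y. \<pi> y \<in> cball x 1}" unfolding K_def using S(2) F(2) by auto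
    qed
    ultimately have "compact K" by (simp add: compact_eq_bounded_closed)
    then have "continuous_on (F ` K) ?f"
      using fF unfolding K_def by (intro continuous_on_inv[OF contF]) auto
    moreover have "F ` K = C \<inter> cball x 1"
    proof
      show "F ` K \<subseteq> C \<inter> cball x 1" unfolding K_def using fF(2) by auto
      show "C \<inter> cball x 1 \<subseteq> F ` K"
      proof
        fix z assume z: "z \<in> C \<inter> cball x 1"
        then show "z \<in> F ` K" unfolding K_def
          using f[of z] by (intro image_eqI[of _ _ "?f z"]) auto
      qed
    qed
    ultimately have "continuous (at x within C \<inter> cball x 1) ?f"
      using x by (auto simp: continuous_on_eq_continuous_within)
    moreover have "at x within C = at x within C \<inter> cball x 1"
      by (rule at_within_nhd[of x "ball x 1"]) auto
    ultimately show ?thesis by simp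
  qed
  then show ?thesis by (simp add: continuous_on_eq_continuous_within)
qed

section \<open>The two implications\<close>

locale weak_normalization_birational =
  weak_normalization X W \<pi>w \<phi> + birational_chart X Y \<pi> F H P Q
  for X :: "(real^'n) set" and W :: "(real^'l) set" and \<pi>w and \<phi>
    and Y :: "(real^'m) set" and \<pi> F and H P Q +
  assumes fin: "finite_map Y X \<pi>"
begin

lemma Y_equation: obtains k where "real_polynomial_function k" "Y = {y. k y = 0}"
  using algY real_algebraic_set_iff by blast

lemma F_coord_rpf: "real_polynomial_function (\<lambda>y. F y $ j)"
  by (rule polynomial_function_vecD[OF F(1)])

text \<open>Over the open set where \<open>\<pi>\<close> is an isomorphism, every section agrees with the rational inverse.\<close>

lemma section_agrees:
  assumes "x \<in> Cent X" "H x \<noteq> 0" "y \<in> Y" "F y = x"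
  shows "sect x = y"
  using sect_inverse(3)[OF assms(3)] assms by simp

text \<open>The inverse of \<open>\<pi>\<close> on the central loci has coordinates that are continuous, rational and integral;
  their images under \<open>\<phi>\<close> are the coordinates of \<open>\<psi>\<close>.\<close>

lemma factorization_if_bij:
  assumes bij: "bij_betw \<pi> (Cent Y) (Cent X)"
  shows "\<exists>\<psi>. polynomial_map W Y \<psi> \<and> (\<forall>w\<in>W. \<pi>w w = \<pi> (\<psi> w))"
proof -
  have \<pi>: "\<pi> \<in> Y \<rightarrow> X" using \<pi>X by blast
  define f where "f = inv_into (Cent Y) \<pi>"
  have f: "f x \<in> Y" "F (f x) = x" if "x \<in> Cent X" for x
  proof -
    have image: "\<pi> ` Cent Y = Cent X" using bij by (rule bij_betw_imp_surj_on)
    have "f x \<in> Cent Y" unfolding f_def using that image inv_into_into by metis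
    then show Y: "f x \<in> Y" using Cent_subset by blast
    have "\<pi> (f x) = x" unfolding f_def using that image f_inv_into_f by metis
    then show "F (f x) = x" using F(2)[OF Y] by simp
  qed
  have cont: "continuous_on (Cent X) f"
    unfolding f_def
    by (rule continuous_inverse_of_finite_map[OF fin \<pi> F closed_Cent[OF algY] Cent_subset bij])
  have mem: "restrict (\<lambda>x. f x $ i) (Cent X) \<in> integral_K0" for i
  proof -
    have "restrict (\<lambda>x. f x $ i) (Cent X) \<in> K0_functions X"
    proof (rule K0_functionsI[OF _ _ HX P[of i] Q[of i]])
      show "continuous_on (Cent X) (restrict (\<lambda>x. f x $ i) (Cent X))"
        unfolding continuous_on_restrict_iff by (intro continuous_intros cont)
      show "Q i x \<noteq> 0" if "x \<in> X" "H x \<noteq> 0" for x using Q_nz[OF that] .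
      show "restrict (\<lambda>x. f x $ i) (Cent X) x = P i x / Q i x" if x: "x \<in> Cent X" "H x \<noteq> 0" for x
      proof -
        have "sect x = f x" by (rule section_agrees[OF x f[OF x(1)]])
        then have "f x $ i = sect x $ i" by simp
        then show ?thesis using x(1) by (simp add: sect_def)
      qed
    qed simp
    moreover have "integral_on (Cent X) (\<lambda>x. x) (restrict (\<lambda>x. f x $ i) (Cent X))"
    proof -
      obtain n a where "\<forall>k. real_polynomial_function (a k)"
        "\<forall>y\<in>Y. (y $ i) ^ n = (\<Sum>k<n. a k (\<pi> y) * (y $ i) ^ k)"
        using finite_map_integral[OF fin \<pi> rpf_coord[of i]] unfolding integral_on_def by blast
      then show ?thesis
        unfolding integral_on_def using f F(2)
        by (intro exI[of _ n] exI[of _ a]) auto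
    qed
    ultimately show ?thesis by blast
  qed
  have "\<forall>i. \<exists>q. real_polynomial_function q \<and> \<phi> (restrict (\<lambda>x. f x $ i) (Cent X)) = restrict q W"
  proof
    fix i
    have "\<phi> (restrict (\<lambda>x. f x $ i) (Cent X)) \<in> polys_on W"
      using \<phi>_bij mem[of i] unfolding bij_betw_def by blast
    then show "\<exists>q. real_polynomial_function q \<and> \<phi> (restrict (\<lambda>x. f x $ i) (Cent X)) = restrict q W"
      by (auto elim: polys_onE)
  qed
  from choice[OF this] obtain q where
    q: "\<forall>i. real_polynomial_function (q i) \<and> \<phi> (restrict (\<lambda>x. f x $ i) (Cent X)) = restrict (q i) W" ..
  define \<psi> where "\<psi> w = (\<chi> i. q i w)" for w
  have corr: "corresponds (\<lambda>x. f x $ i) (\<lambda>w. \<psi> w $ i)" for i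
    unfolding corresponds_def \<psi>_def using mem q by simp
  obtain k where k: "real_polynomial_function k" "Y = {y. k y = 0}" by (rule Y_equation)
  have "\<forall>x\<in>Cent X. k (f x) = 0" using f(1) k(2) by blast
  then have "\<forall>w\<in>W. k (\<psi> w) = 0"
    using corresponds_eq_iff[OF corresponds_compose[OF corr k(1)] corresponds_const[of 0]] by blast
  then have \<psi>Y: "\<psi> w \<in> Y" if "w \<in> W" for w using that k(2) by blast
  have "\<pi>w w $ j = F (\<psi> w) $ j" if w: "w \<in> W" for w j
  proof -
    have "\<forall>x\<in>Cent X. x $ j = F (f x) $ j" using f(2) by simp
    then show ?thesis
      using corresponds_eq_iff[OF corresponds_polynomial[OF rpf_coord[of j]]
          corresponds_compose[OF corr F_coord_rpf[of j]]] w by blast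
  qed
  then have "\<pi>w w = \<pi> (\<psi> w)" if "w \<in> W" for w
    using F(2)[OF \<psi>Y[OF that]] that by (simp add: vec_eq_iff)
  moreover have "polynomial_function \<psi>"
    by (rule polynomial_function_vecI) (use q in \<open>simp add: \<psi>_def\<close>)
  then have "polynomial_map W Y \<psi>" unfolding polynomial_map_def using \<psi>Y by blast
  ultimately show ?thesis by blast
qed

text \<open>The coordinates of \<open>\<psi>\<close> come from continuous functions on \<open>Cent X\<close>, which form a section \<open>f\<close> of
  \<open>\<pi>\<close>.  That \<open>f\<close> maps \<open>Cent X\<close> to \<open>Cent Y\<close> and is inverse to \<open>\<pi>\<close> holds over the dense open set
  where \<open>\<pi>\<close> is an isomorphism, and extends by continuity.\<close>

lemma bij_if_factorization:
  assumes \<psi>: "polynomial_map W Y \<psi>" "\<forall>w\<in>W. \<pi>w w = \<pi> (\<psi> w)"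
  shows "bij_betw \<pi> (Cent Y) (Cent X)"
proof -
  obtain G where G: "polynomial_function G" "\<And>w. w \<in> W \<Longrightarrow> \<psi> w = G w"
    using \<psi>(1) unfolding polynomial_map_def by blast
  have GY: "G w \<in> Y" if "w \<in> W" for w
  proof -
    have "\<psi> w \<in> Y" using \<psi>(1) that unfolding polynomial_map_def by blast
    then show ?thesis using G(2)[OF that] by simp
  qed
  have FG: "F (G w) = \<pi>w w" if "w \<in> W" for w
    using \<psi>(2) G(2)[OF that] F(2)[OF GY[OF that]] that by simp
  have "\<forall>i. \<exists>u. u \<in> integral_K0 \<and> \<phi> u = restrict (\<lambda>w. G w $ i) W"
  proof
    fix i
    have "restrict (\<lambda>w. G w $ i) W \<in> polys_on W"
      by (rule polys_onI[OF polynomial_function_vecD[OF G(1)]])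
    then have "restrict (\<lambda>w. G w $ i) W \<in> \<phi> ` integral_K0"
      using \<phi>_bij by (simp add: bij_betw_def)
    then show "\<exists>u. u \<in> integral_K0 \<and> \<phi> u = restrict (\<lambda>w. G w $ i) W" by (auto simp: image_iff)
  qed
  from choice[OF this] obtain u where u: "\<forall>i. u i \<in> integral_K0 \<and> \<phi> (u i) = restrict (\<lambda>w. G w $ i) W" ..
  define f where "f x = (\<chi> i. u i x)" for x
  have uK: "u i \<in> K0_functions X" for i using u by blast
  have ext: "restrict (u i) (Cent X) = u i" for i
    using uK[of i] by (intro extensional_restrict) (simp add: K0_functions_def)
  have corr: "corresponds (\<lambda>x. f x $ i) (\<lambda>w. G w $ i)" for i
    unfolding corresponds_def f_def using u ext by simp
  have cont: "continuous_on (Cent X) f"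
    unfolding f_def using uK by (intro continuous_on_vec_lambda) (simp add: K0_functions_def)
  obtain k where k: "real_polynomial_function k" "Y = {y. k y = 0}" by (rule Y_equation)
  have "\<forall>w\<in>W. k (G w) = 0" using GY k(2) by blast
  then have "\<forall>x\<in>Cent X. k (f x) = 0"
    using corresponds_eq_iff[OF corresponds_compose[OF corr k(1)] corresponds_const[of 0]] by blast
  then have fY: "f x \<in> Y" if "x \<in> Cent X" for x using that k(2) by blast
  have "x $ j = F (f x) $ j" if x: "x \<in> Cent X" for x j
  proof -
    have "\<forall>w\<in>W. \<pi>w w $ j = F (G w) $ j" using FG by simp
    then show ?thesis
      using corresponds_eq_iff[OF corresponds_polynomial[OF rpf_coord[of j]]
          corresponds_compose[OF corr F_coord_rpf[of j]]] x by blast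
  qed
  then have Ff: "F (f x) = x" if "x \<in> Cent X" for x using that by (simp add: vec_eq_iff)
  have CentX: "central X x" if "x \<in> Cent X" for x using that Cent_eq_central[OF algX] by blast
  have f_Cent: "f x \<in> Cent Y" if x: "x \<in> Cent X" for x
  proof (rule continuous_limit_in_closed[OF cont closed_Cent[OF algY] _ _ x])
    show "Cent X \<inter> {x. H x \<noteq> 0} \<subseteq> Cent X" by blast
    show "x \<in> closure (Cent X \<inter> {x. H x \<noteq> 0})" using Cent_dense_off_zeros[OF algX HX] x by blast
    fix z assume z: "z \<in> Cent X \<inter> {x. H x \<noteq> 0}"
    then have "sect z = f z" using section_agrees fY Ff by simp
    moreover have "central Y (sect z)" using central_section CentX z by blast
    ultimately show "f z \<in> Cent Y" using Cent_eq_central[OF algY] by simp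
  qed
  have F_Cent: "F y \<in> Cent X" if "y \<in> Cent Y" for y
    using central_image that Cent_eq_central[OF algX] Cent_eq_central[OF algY] by blast
  have fF: "f (F y) = y" if y: "y \<in> Cent Y" for y
  proof -
    have "continuous_on (Cent Y) (\<lambda>y. f (F y) - y)"
      using F_Cent
      by (intro continuous_on_diff continuous_on_id continuous_on_compose2[OF cont]
          continuous_on_polymonial_function[OF F(1)]) auto
    moreover have "f (F z) - z \<in> {0}" if z: "z \<in> Cent Y \<inter> {y. H (F y) \<noteq> 0}" for z
    proof -
      have "z \<in> Y" using z Cent_subset by blast
      then have "sect (F z) = z" using sect_inverse(3) z by blast
      moreover have "sect (F z) = f (F z)"
        using section_agrees[of "F z" "f (F z)"] F_Cent[of z] fY Ff z by simp
      ultimately show ?thesis by simp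
    qed
    moreover have "y \<in> closure (Cent Y \<inter> {y. H (F y) \<noteq> 0})"
      using Cent_dense_off_zeros[OF algY HY] y by blast
    ultimately have "f (F y) - y \<in> {0}"
      using continuous_limit_in_closed[of "Cent Y" "\<lambda>y. f (F y) - y" "{0}"
          "Cent Y \<inter> {y. H (F y) \<noteq> 0}" y] y by simp
    then show ?thesis by simp
  qed
  have \<pi>F: "\<pi> y = F y" if "y \<in> Cent Y" for y using F(2) that Cent_subset by blast
  show ?thesis
  proof (rule bij_betw_byWitness[where f' = f])
    show "\<forall>y\<in>Cent Y. f (\<pi> y) = y" using fF \<pi>F by simp
    show "\<forall>x\<in>Cent X. \<pi> (f x) = x" using Ff F(2) fY by simp
    show "\<pi> ` Cent Y \<subseteq> Cent X" using F_Cent \<pi>F by auto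
    show "f ` Cent X \<subseteq> Cent Y" using f_Cent by blast
  qed
qed

end

theorem theorem4p10:
  fixes X :: "(real^'n) set" and X' :: "(real^'k) set" and Y :: "(real^'m) set"
    and W :: "(real^'l) set"
    and \<pi>' :: "real^'k \<Rightarrow> real^'n" and \<pi> :: "real^'m \<Rightarrow> real^'n" and \<pi>w :: "real^'l \<Rightarrow> real^'n"
  assumes "real_algebraic_set X"
    and "is_normalization X X' \<pi>'"
    and "real_algebraic_set Y"
    and "polynomial_map Y X \<pi>" and "finite_map Y X \<pi>" and "birational_map Y X \<pi>"
    and "is_weak_normalization_Cent X W \<pi>w"
  shows "bij_betw \<pi> (Cent Y) (Cent X) \<longleftrightarrow>
    (\<exists>\<psi>. polynomial_map W Y \<psi> \<and> (\<forall>w\<in>W. \<pi>w w = \<pi> (\<psi> w)))"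
proof -
  obtain F H P Q where "birational_chart X Y \<pi> F H P Q"
    using birational_chart_exists[OF assms(1,3,4,5,6)] by blast
  moreover obtain \<phi> where "weak_normalization X W \<pi>w \<phi>"
    using assms(7) unfolding is_weak_normalization_Cent_def weak_normalization_def by blast
  ultimately interpret weak_normalization_birational X W \<pi>w \<phi> Y \<pi> F H P Q
    using assms(5) by (simp add: weak_normalization_birational_def weak_normalization_birational_axioms_def)
  show ?thesis using factorization_if_bij bij_if_factorization by blast
qed

end
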